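(* Let $q\in[1,\infty]$ and $\tau>0$. Assume the model and sampling setup (M), that the kernels satisfy (K1), (K2), (K4) and (K3) with $p=q$, $s=\tau$, and that (T-a) and (T-b) hold with these $q$ and $\tau$. If $R\in\mathrm W^\tau_q(\mathbb S^{d-1})$ and $$T_N\asymp\Big(\frac{N}{(\log N)^{\kappa_q}}\Big)^{\frac{1}{2\tau+d-1}},$$ then $$\|\hat R-R\|_q=O_p\Big(\Big(\frac{N}{(\log N)^{\kappa_q}}\Big)^{-\frac{\tau}{2\tau+d-1}}\Big).$$ Moreover, if $q=\infty$ and (T-a) and (T-c) hold (with $\tau$), then there is a constant $C$ such that, almost surely, $$\limsup_{N\to\infty}\Big(\frac{N}{(\log N)^{2r+1}}\Big)^{\frac{\tau}{2\tau+d-1}}\|\hat R-R\|_\infty\le C.$$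
   Context: Spherical harmonics: $\mathbb S^{d-1}$ ($d\ge2$) is the unit sphere in $\mathbb R^d$ with surface measure $\sigma$, $|\mathbb S^{d-1}|=2\pi^{d/2}/\Gamma(d/2)$, $\|\cdot\|_p$ the $\mathrm L^p(\sigma)$ norm. $H^{n,d}$: restrictions to $\mathbb S^{d-1}$ of homogeneous harmonic polynomials of degree $n$, dimension $h(n,d)=\frac{(2n+d-2)(n+d-2)!}{n!(d-2)!(n+d-2)}$ ($h(0,d)=1$, $h(n,2)=2$ for $n\ge1$); $Q_{n,d}$ the orthogonal projector onto $H^{n,d}$, with kernel $q_{n,d}(x,y)=\frac{h(n,d)C_n^{\nu(d)}(x'y)}{|\mathbb S^{d-1}|C_n^{\nu(d)}(1)}$, $\nu(d)=(d-2)/2$, $C_n^\nu$ Gegenbauer polynomials ($C_n^\nu(t)=\sum_{l=0}^{\lfloor n/2\rfloor}\frac{(-1)^l(\nu)_{n-l}}{l!(n-2l)!}(2t)^{n-2l}$ for $\nu>0$; $C_0^0=1$, $C_n^0(t)=\frac2n\cos(n\arccos t)$). $\zeta_{n,d}=n(n+d-2)$. $\mathrm W^s_p(\mathbb S^{d-1})$: $f\in\mathrm L^p$ with $(-\Delta^S)^{s/2}f:=\sum_n\zeta_{n,d}^{s/2}Q_{n,d}f\in\mathrm L^p$ (as a distribution), norm $\|f\|_{p,s}=\|f\|_p+\|(-\Delta^S)^{s/2}f\|_p$. Kernels: $K_T(x,y)=\sum_{n=0}^T\chi(n,T)q_{n,d}(x,y)$ with real weights; conditions: (K1) $\sup_T\|K_T(x,\cdot)\|_1<\infty$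 (independent of $x$); (K2) $\exists C,\alpha$: $|K_T(z,x)-K_T(z,y)|\le C\|x-y\|T^\alpha$ for all $x,y,z,T$; (K3) for given $p,s$: $\exists C$ $\forall f\in\mathrm W^s_p$, $\|f-\int K_T(\cdot,y)f(y)d\sigma(y)\|_p\le CT^{-s}\|f\|_{p,s}$; (K4) $\chi(n,T)\in[0,1]$ and $\exists c>0$: $\chi(n,T)\ge c$ for $0\le n\le\lfloor T/2\rfloor$. The odd part is $K_{2T}^-(x,y)=\sum_{p=0}^{T-1}\chi(2p+1,2T)q_{2p+1,d}(x,y)$. Setup (M): $\beta,X$ independent random vectors in $\mathbb S^{d-1}$, $\beta$ with probability density $f_\beta$ w.r.t. $\sigma$, $X$ with density $f_X$ w.r.t. $\sigma$, positive $\sigma$-a.e. on $H^+=\{x:x_1\ge0\}$ and zero outside; $Y=\mathbb I\{X'\beta\ge0\}$; $r(x)=\mathbb P(Y=1|X=x)$ on $H^+$; $R(x)=r(x)$ for $x_1\ge0$ and $R(x)=1-r(-x)$ for $x_1<0$. Data $(y_i,x_i)_{i=1}^N$ are i.i.d. copies of $(Y,X)$; $\hat f_X$ is an estimator of $f_X$ computed from the data; $r>0$ is a trimming constant; $T_N$ is a sequence of integers. Estimator: $\hat R(x)=\frac12+\frac1N\sum_{i=1}^N\frac{(2y_i-1)K_{2T_N}^-(x_i,x)}{\max(\hat f_X(x_i),(\log N)^{-r})}$. Trimming conditions, for given $q\in[1,\infty]$, $\tau>0$: let $\kappa_q=2r+(1-2/q)\mathbb I\{q\ge2\}$ ($\kappa_\infty=2r+1$)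 and $M_N=\max_{i\le N}\big|\frac{\max(f_X(x_i),(\log N)^{-r})}{\max(\hat f_X(x_i),(\log N)^{-r})}-1\big|$. (T-a) $\sup_{H^+}f_X<\infty$ and $\sigma(\{0<f_X<(\log N)^{-r}\})=o\big((N/(\log N)^{\kappa_q})^{-\frac{\tau+(d-1)(1-1/q)}{2\tau+d-1}}\big)$; (T-b) $(N/(\log N)^{\kappa_q})^{\frac{\tau}{2\tau+d-1}}(\log N)^rM_N=O_p(1)$; (T-c) for some constant $C$, $\limsup_N(N/(\log N)^{2r+1})^{\frac{\tau}{2\tau+d-1}}(\log N)^rM_N\le C$ a.s. *)

theory Defs
  imports "HOL-Probability.Probability" "HOL-Library.Landau_Symbols"
begin

text \<open>Surface measure on the unit sphere of real^'d, defined as the cone measure: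
  sigma(A) = d * lambda_d({t x : x in A, 0 < t <= 1}).\<close>
definition sphere_measure :: "(real^'d) measure" where
  "sphere_measure = measure_of (sphere (0::real^'d) 1)
      (sets (restrict_space lborel (sphere (0::real^'d) 1)))
      (\<lambda>A. of_nat CARD('d) * emeasure lborel {t *\<^sub>R x | t x. x \<in> A \<and> 0 < t \<and> t \<le> 1})"

definition sphere_area :: "nat \<Rightarrow> real" where
  "sphere_area d = 2 * pi powr (real d / 2) / Gamma (real d / 2)"

definition lpnorm :: "'a measure \<Rightarrow> ereal \<Rightarrow> ('a \<Rightarrow> real) \<Rightarrow> real" where
  "lpnorm M p f = (if p = \<infinity> then real_of_ereal (esssup M (\<lambda>x. ereal \<bar>f x\<bar>))
     else (LINT x|M. \<bar>f x\<bar> powr real_of_ereal p) powr (1 / real_of_ereal p))"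

definition in_Lp :: "'a measure \<Rightarrow> ereal \<Rightarrow> ('a \<Rightarrow> real) \<Rightarrow> bool" where
  "in_Lp M p f \<longleftrightarrow> f \<in> borel_measurable M \<and>
     (if p = \<infinity> then esssup M (\<lambda>x. ereal \<bar>f x\<bar>) < \<infinity>
      else integrable M (\<lambda>x. \<bar>f x\<bar> powr real_of_ereal p))"

definition gegenbauer :: "real \<Rightarrow> nat \<Rightarrow> real \<Rightarrow> real" where
  "gegenbauer \<nu> n t = (if \<nu> = 0 then (if n = 0 then 1 else 2 / real n * cos (real n * arccos t))
     else (\<Sum>l\<le>n div 2. (-1)^l * pochhammer \<nu> (n - l) / (fact l * fact (n - 2*l)) * (2*t)^(n - 2*l)))"

definition harm_dim :: "nat \<Rightarrow> nat \<Rightarrow> real" where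
  "harm_dim n d = (if n = 0 then 1 else
     real (2*n + d - 2) * fact (n + d - 2) / (fact n * fact (d - 2) * real (n + d - 2)))"

definition gnu :: "nat \<Rightarrow> real" where
  "gnu d = (real d - 2) / 2"

text \<open>Kernel q_{n,d} of the orthogonal projector onto H^{n,d}, d = CARD('d).\<close>
definition zonal :: "nat \<Rightarrow> real^'d \<Rightarrow> real^'d \<Rightarrow> real" where
  "zonal n x y = harm_dim n CARD('d) * gegenbauer (gnu CARD('d)) n (x \<bullet> y)
      / (sphere_area CARD('d) * gegenbauer (gnu CARD('d)) n 1)"

definition harm_proj :: "nat \<Rightarrow> (real^'d \<Rightarrow> real) \<Rightarrow> real^'d \<Rightarrow> real" where
  "harm_proj n f x = (LINT y|sphere_measure. zonal n x y * f y)"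

definition zeta :: "nat \<Rightarrow> nat \<Rightarrow> real" where
  "zeta n d = real n * (real n + real d - 2)"

text \<open>Sobolev space W^s_p: f in L^p and the distribution sum_n zeta^{s/2} Q_n f is
  (represented by) an L^p function g, i.e. Q_n g = zeta^{s/2} Q_n f for all n.\<close>
definition frac_lap_rep :: "ereal \<Rightarrow> real \<Rightarrow> (real^'d \<Rightarrow> real) \<Rightarrow> (real^'d \<Rightarrow> real) \<Rightarrow> bool" where
  "frac_lap_rep p s f g \<longleftrightarrow> in_Lp sphere_measure p g \<and>
     (\<forall>n. AE x in sphere_measure. harm_proj n g x = zeta n CARD('d) powr (s/2) * harm_proj n f x)"

definition sobolev :: "ereal \<Rightarrow> real \<Rightarrow> (real^'d \<Rightarrow> real) \<Rightarrow> bool" where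
  "sobolev p s f \<longleftrightarrow> in_Lp sphere_measure p f \<and> (\<exists>g. frac_lap_rep p s f g)"

definition sob_norm :: "ereal \<Rightarrow> real \<Rightarrow> (real^'d \<Rightarrow> real) \<Rightarrow> real" where
  "sob_norm p s f = lpnorm sphere_measure p f + lpnorm sphere_measure p (SOME g. frac_lap_rep p s f g)"

definition kern :: "(nat \<Rightarrow> nat \<Rightarrow> real) \<Rightarrow> nat \<Rightarrow> real^'d \<Rightarrow> real^'d \<Rightarrow> real" where
  "kern ch T x y = (\<Sum>n\<le>T. ch n T * zonal n x y)"

definition kern_odd :: "(nat \<Rightarrow> nat \<Rightarrow> real) \<Rightarrow> nat \<Rightarrow> real^'d \<Rightarrow> real^'d \<Rightarrow> real" where
  "kern_odd ch T x y = (\<Sum>p<T. ch (2*p+1) (2*T) * zonal (2*p+1) x y)"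

definition K1 :: "(nat \<Rightarrow> nat \<Rightarrow> real) \<Rightarrow> 'd::finite itself \<Rightarrow> bool" where
  "K1 ch _ \<longleftrightarrow> (\<exists>B. \<forall>T. \<forall>x\<in>sphere (0::real^'d) 1.
      (LINT y|sphere_measure. \<bar>kern ch T x y\<bar>) \<le> B)"

definition K2 :: "(nat \<Rightarrow> nat \<Rightarrow> real) \<Rightarrow> 'd::finite itself \<Rightarrow> bool" where
  "K2 ch _ \<longleftrightarrow> (\<exists>C \<alpha>. \<forall>T. \<forall>x\<in>sphere (0::real^'d) 1. \<forall>y\<in>sphere (0::real^'d) 1.
      \<forall>z\<in>sphere (0::real^'d) 1.
      \<bar>kern ch T z x - kern ch T z y\<bar> \<le> C * norm (x - y) * real T powr \<alpha>)"

definition K3 :: "(nat \<Rightarrow> nat \<Rightarrow> real) \<Rightarrow> ereal \<Rightarrow> real \<Rightarrow> 'd::finite itself \<Rightarrow> bool" where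
  "K3 ch p s _ \<longleftrightarrow> (\<exists>C. \<forall>f::real^'d \<Rightarrow> real. sobolev p s f \<longrightarrow> (\<forall>T\<ge>1.
      lpnorm sphere_measure p (\<lambda>x. f x - (LINT y|sphere_measure. kern ch T x y * f y))
        \<le> C * real T powr (- s) * sob_norm p s f))"

definition K4 :: "(nat \<Rightarrow> nat \<Rightarrow> real) \<Rightarrow> bool" where
  "K4 ch \<longleftrightarrow> (\<forall>n T. 0 \<le> ch n T \<and> ch n T \<le> 1) \<and>
      (\<exists>c>0. \<forall>T n. n \<le> T div 2 \<longrightarrow> c \<le> ch n T)"

text \<open>R from r, with H^+ = {x. x $ e1 >= 0} (e1 the distinguished first coordinate).\<close>
definition Rfun :: "'d \<Rightarrow> (real^'d \<Rightarrow> real) \<Rightarrow> real^'d \<Rightarrow> real" where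
  "Rfun e1 r x = (if 0 \<le> x $ e1 then r x else 1 - r (- x))"

definition trim_level :: "real \<Rightarrow> nat \<Rightarrow> real" where
  "trim_level rt N = ln (real N) powr (- rt)"

text \<open>Rhat; data yx i = (y_i, x_i), i < N; fhat N w is the density estimator at sample size N.\<close>
definition Rhat :: "(nat \<Rightarrow> nat \<Rightarrow> real) \<Rightarrow> (nat \<Rightarrow> nat) \<Rightarrow> real \<Rightarrow>
     (nat \<Rightarrow> 'w \<Rightarrow> real^'d \<Rightarrow> real) \<Rightarrow> (nat \<Rightarrow> 'w \<Rightarrow> real \<times> (real^'d)) \<Rightarrow>
     nat \<Rightarrow> 'w \<Rightarrow> real^'d \<Rightarrow> real" where
  "Rhat ch T rt fhat yx N \<omega> x = 1/2 + 1 / real N * (\<Sum>i<N.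
      (2 * fst (yx i \<omega>) - 1) * kern_odd ch (T N) (snd (yx i \<omega>)) x
      / max (fhat N \<omega> (snd (yx i \<omega>))) (trim_level rt N))"

definition kappa :: "real \<Rightarrow> ereal \<Rightarrow> real" where
  "kappa rt q = (if q = \<infinity> then 2 * rt + 1
     else 2 * rt + (if q \<ge> 2 then 1 - 2 / real_of_ereal q else 0))"

definition qinv :: "ereal \<Rightarrow> real" where
  "qinv q = (if q = \<infinity> then 0 else 1 / real_of_ereal q)"

definition base_rate :: "real \<Rightarrow> nat \<Rightarrow> real" where
  "base_rate k N = real N / ln (real N) powr k"

definition Mtrim :: "(real^'d \<Rightarrow> real) \<Rightarrow> (nat \<Rightarrow> 'w \<Rightarrow> real^'d \<Rightarrow> real) \<Rightarrow>
     (nat \<Rightarrow> 'w \<Rightarrow> real \<times> (real^'d)) \<Rightarrow> real \<Rightarrow> nat \<Rightarrow> 'w \<Rightarrow> real" where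
  "Mtrim fX fhat yx rt N \<omega> = Max (insert 0 {\<bar>max (fX (snd (yx i \<omega>))) (trim_level rt N)
        / max (fhat N \<omega> (snd (yx i \<omega>))) (trim_level rt N) - 1\<bar> | i. i < N})"

text \<open>Z_N = O_p(a_N), with outer probabilities (no measurability needed).\<close>
definition bounded_in_prob :: "'w measure \<Rightarrow> (nat \<Rightarrow> 'w \<Rightarrow> real) \<Rightarrow> (nat \<Rightarrow> real) \<Rightarrow> bool" where
  "bounded_in_prob P Z a \<longleftrightarrow> (\<forall>\<epsilon>>0. \<exists>B N0. \<forall>N\<ge>N0. \<exists>A\<in>sets P.
      {\<omega>\<in>space P. \<bar>Z N \<omega>\<bar> > B * a N} \<subseteq> A \<and> measure P A < \<epsilon>)"

end

theory Submission
  imports Defs "HOL-Real_Asymp.Real_Asymp"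
begin

text \<open>
  Write k for the odd kernel and d for the dimension. The error splits into four parts. Replacing the
  estimated by the true density in the denominator costs at most the relative trimming error M times an
  empirical mean of |k(x_i, x)| / max(f, trim), which is bounded since k has bounded L1 norm. The centred
  empirical mean has pointwise variance at most v of order T^(d-1) (log N)^(2r) / N; a Bernstein bound on
  a polynomially fine net together with the Lipschitz condition K2 gives a supremum of order
  sqrt(v log N), and interpolating this with the L2 bound gives the exponent kappa_q. Trimming the true
  density contributes sigma(0 < f < trim) T^((d-1)(1-1/q)) by interpolation between the L1 and the sup
  norm of k. Finally, R - 1/2 is odd, so the smoothing error is the odd part of R - K R and is
  controlled by K3. Besides K1--K4 the kernel enters only through parity and the sup bound
  k = O(T^(d-1)), which rests on |C_n(t)| <= C_n(1) for Gegenbauer polynomials.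
\<close>

section \<open>Gegenbauer polynomials\<close>

text \<open>The density estimate depends on the whole sample, so the summands of \<open>Rhat\<close>
  are not independent. It is therefore compared with the true density outcome by outcome, and
  probability enters only through the i.i.d. sums of \<open>G\<close> and of its absolute value. The
  data live on one half sphere. Since k and R - 1/2 are both odd, their product is even, and the
  integral of (2r - 1) k over the half sphere is already the integral of k R over the whole sphere.
  With nr = N / (log N)^kappa, dl = 2 tau + d - 1 and T of order nr^(1/dl), the quotient T^(d-1) / N
  is of order rho^2 (log N)^(-kappa), where rho = nr^(-tau/dl) is the target rate; this balance
  fixes every exponent. Two kinds of exceptional events occur. The one for the supremum has
  probability O(N^(-2)) and serves both conclusions, through Borel-Cantelli in the almost sure one.
  The one for the L2 norm comes from Markov's inequality, is only as small as a chosen epsilon, and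
  is used for finite q alone. As constants do not matter, a triangle inequality with factor 4 stands
  in for Minkowski's.\<close>

definition geg_coeff :: "real \<Rightarrow> nat \<Rightarrow> nat \<Rightarrow> real" where
  "geg_coeff \<nu> n l = (if 2 * l \<le> n
     then (-1)^l * pochhammer \<nu> (n - l) / (fact l * fact (n - 2*l)) else 0)"

text \<open>The coefficients vanish for 2 l > n, so the summation bound may be enlarged freely. This
  lets the three sums of different degree in the recurrence share one index range.\<close>

lemma gegenbauer_eq_sum:
  assumes "\<nu> \<noteq> 0" "n div 2 \<le> M"
  shows "gegenbauer \<nu> n t = (\<Sum>l\<le>M. geg_coeff \<nu> n l * (2*t)^(n - 2*l))"
proof -
  have "(\<Sum>l\<le>M. geg_coeff \<nu> n l * (2*t)^(n - 2*l))
      = (\<Sum>l\<le>n div 2. geg_coeff \<nu> n l * (2*t)^(n - 2*l))"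
    by (rule sum.mono_neutral_right) (use assms in \<open>auto simp: geg_coeff_def\<close>)
  also have "\<dots> = (\<Sum>l\<le>n div 2. (-1)^l * pochhammer \<nu> (n - l) / (fact l * fact (n - 2*l)) * (2*t)^(n - 2*l))"
    by (rule sum.cong) (auto simp: geg_coeff_def)
  finally show ?thesis using assms by (simp add: gegenbauer_def)
qed

lemma geg_coeff_rec_0:
  "real (n + 2) * geg_coeff \<nu> (n + 2) 0 = (real (n + 1) + \<nu>) * geg_coeff \<nu> (n + 1) 0"
proof -
  have "pochhammer \<nu> (n + 2) = pochhammer \<nu> (n + 1) * (\<nu> + real (n + 1))"
    by (metis add_Suc_right nat_1_add_1 plus_1_eq_Suc add.commute pochhammer_Suc)
  moreover have "fact (n + 2) = real (n + 2) * fact (n + 1)" by simp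
  ultimately show ?thesis
    unfolding geg_coeff_def by (simp add: divide_simps del: fact_Suc)
qed

text \<open>The three-term recurrence read off at a single power of 2t. The index shift reflects
  that C_n has degree two less than C_(n+2).\<close>

lemma geg_coeff_rec:
  "real (n + 2) * geg_coeff \<nu> (n + 2) (Suc l)
    = (real (n + 1) + \<nu>) * geg_coeff \<nu> (n + 1) (Suc l) - (real n + 2 * \<nu>) * geg_coeff \<nu> n l"
proof (cases "2 * l \<le> n")
  case False
  then show ?thesis by (simp add: geg_coeff_def)
next
  case True
  then obtain j where j: "n = 2 * l + j" by (metis le_iff_add)
  show ?thesis
  proof (cases j)
    \<comment> \<open>At the boundary n = 2 l the middle coefficient is zero, since 2 (l + 1) > n +
      1.\<close>
    case 0
    then have n: "n = 2 * l" using j by simp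
    have p: "pochhammer \<nu> (Suc l) = pochhammer \<nu> l * (\<nu> + real l)" by (rule pochhammer_Suc)
    show ?thesis unfolding geg_coeff_def n using p
      by (simp add: divide_simps) (simp add: algebra_simps)
  next
    case (Suc i)
    then have n: "n = 2 * l + i + 1" using j by simp
    define c where "c = pochhammer \<nu> (l + i + 1)"
    have p: "pochhammer \<nu> (l + i + 2) = c * (\<nu> + real (l + i + 1))"
      unfolding c_def by (metis add_Suc_right nat_1_add_1 plus_1_eq_Suc add.commute pochhammer_Suc)
    have e: "n + 2 - Suc l = l + i + 2" "n + 1 - Suc l = l + i + 1" "n - l = l + i + 1"
      "n + 2 - 2 * Suc l = Suc i" "n + 1 - 2 * Suc l = i" "n - 2 * l = Suc i"
      "2 * Suc l \<le> n + 2" "2 * Suc l \<le> n + 1" "2 * l \<le> n" using n by auto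
    have nr: "real n = 2 * real l + real i + 1" using n by simp
    show ?thesis unfolding geg_coeff_def e p c_def[symmetric] if_True e if_P[OF e(7)] if_P[OF e(8)] if_P[OF e(9)]
      using nr
      by (simp add: divide_simps del: of_nat_Suc) (simp add: algebra_simps)
  qed
qed

lemma gegenbauer_0 [simp]: "gegenbauer \<nu> 0 t = 1"
  by (simp add: gegenbauer_def)

lemma gegenbauer_1: "\<nu> \<noteq> 0 \<Longrightarrow> gegenbauer \<nu> 1 t = 2 * \<nu> * t"
  by (simp add: gegenbauer_def)

lemma gegenbauer_rec:
  assumes "\<nu> \<noteq> 0"
  shows "real (n + 2) * gegenbauer \<nu> (n + 2) t
    = 2 * (real (n + 1) + \<nu>) * t * gegenbauer \<nu> (n + 1) t - (real n + 2 * \<nu>) * gegenbauer \<nu> n t"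
proof -
  define M where "M = n + 2"
  have s1: "gegenbauer \<nu> (n + 2) t = geg_coeff \<nu> (n+2) 0 * (2*t)^(n+2)
      + (\<Sum>l\<le>M. geg_coeff \<nu> (n+2) (Suc l) * (2*t)^(n+2 - 2*Suc l))"
    using gegenbauer_eq_sum[OF assms, of "n+2" "Suc M" t] unfolding sum.atMost_Suc_shift
    by (simp add: M_def)
  have s2: "gegenbauer \<nu> (n + 1) t = geg_coeff \<nu> (n+1) 0 * (2*t)^(n+1)
      + (\<Sum>l\<le>M. geg_coeff \<nu> (n+1) (Suc l) * (2*t)^(n+1 - 2*Suc l))"
    using gegenbauer_eq_sum[OF assms, of "n+1" "Suc M" t] unfolding sum.atMost_Suc_shift
    by (simp add: M_def)
  have s3: "gegenbauer \<nu> n t = (\<Sum>l\<le>M. geg_coeff \<nu> n l * (2*t)^(n - 2*l))"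
    using gegenbauer_eq_sum[OF assms, of n M t] by (simp add: M_def)
  have shift: "2 * t * (geg_coeff \<nu> (n+1) (Suc l) * (2*t)^(n+1 - 2*Suc l))
      = geg_coeff \<nu> (n+1) (Suc l) * (2*t)^(n - 2*l)" for l
  proof (cases "2 * Suc l \<le> n + 1")
    case True
    then have "n - 2 * l = Suc (n + 1 - 2 * Suc l)" by auto
    then show ?thesis by simp
  qed (simp add: geg_coeff_def)
  have "real (n + 2) * gegenbauer \<nu> (n + 2) t = (real (n + 2) * geg_coeff \<nu> (n+2) 0) * (2*t)^(n+2)
      + (\<Sum>l\<le>M. (real (n + 2) * geg_coeff \<nu> (n+2) (Suc l)) * (2*t)^(n - 2*l))"
    unfolding s1 distrib_left sum_distrib_left by (simp add: mult.assoc)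
  also have "\<dots> = (real (n + 1) + \<nu>) * geg_coeff \<nu> (n + 1) 0 * (2*t)^(n+2)
      + (real (n + 1) + \<nu>) * (\<Sum>l\<le>M. geg_coeff \<nu> (n+1) (Suc l) * (2*t)^(n - 2*l))
      - (real n + 2 * \<nu>) * gegenbauer \<nu> n t"
    unfolding geg_coeff_rec geg_coeff_rec_0 s3 sum_distrib_left
    by (simp add: algebra_simps sum_subtractf sum.distrib)
  also have "\<dots> = (real (n + 1) + \<nu>) * (2 * t * gegenbauer \<nu> (n + 1) t) - (real n + 2 * \<nu>) * gegenbauer \<nu> n t"
    unfolding s2 distrib_left sum_distrib_left shift[symmetric]
    by (simp add: algebra_simps sum_distrib_left)
  finally show ?thesis by (simp add: algebra_simps)
qed

text \<open>The binomial series of (1 - u z)^(-nu), given by its coefficients so that their moduli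
  can be read off directly.\<close>

definition binom_fps :: "real \<Rightarrow> complex \<Rightarrow> complex fps" where
  "binom_fps \<nu> u = Abs_fps (\<lambda>n. of_real (pochhammer \<nu> n / fact n) * u ^ n)"

lemma binom_fps_deriv:
  "(1 - fps_const u * fps_X) * fps_deriv (binom_fps \<nu> u) = fps_const (of_real \<nu> * u) * binom_fps \<nu> u"
proof (rule fps_ext)
  fix n
  define c where "c k = complex_of_real (pochhammer \<nu> k / fact k)" for k
  have c: "binom_fps \<nu> u = Abs_fps (\<lambda>n. c n * u ^ n)" by (simp add: binom_fps_def c_def)
  have cS: "of_nat (Suc k) * c (Suc k) = (of_real \<nu> + of_nat k) * c k" for k
    using of_nat_neq_0[of k, where 'a = complex]
    by (simp add: c_def pochhammer_Suc divide_simps)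
  show "fps_nth ((1 - fps_const u * fps_X) * fps_deriv (binom_fps \<nu> u)) n
      = fps_nth (fps_const (of_real \<nu> * u) * binom_fps \<nu> u) n"
  proof (cases n)
    case 0
    then show ?thesis using cS[of 0] by (simp add: c algebra_simps)
  next
    case (Suc m)
    have "fps_nth ((1 - fps_const u * fps_X) * fps_deriv (binom_fps \<nu> u)) n
       = (of_nat (Suc (Suc m)) * c (Suc (Suc m))) * u ^ Suc (Suc m)
         - of_nat (Suc m) * c (Suc m) * u ^ Suc (Suc m)"
      unfolding Suc c by (simp add: left_diff_distrib mult.assoc del: of_nat_Suc)
    also have "\<dots> = of_real \<nu> * c (Suc m) * u ^ Suc (Suc m)"
      unfolding cS[of "Suc m"] by (simp add: algebra_simps)
    finally show ?thesis unfolding Suc c by (simp add: mult_ac)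
  qed
qed

text \<open>This is the generating function (1 - 2 t z + z^2)^(-nu), factored as (1 - u z)^(-nu) (1
  - v z)^(-nu). The product H satisfies (1 - 2 t z + z^2) H' = nu (2 t - 2 z) H; comparing
  coefficients yields the Gegenbauer recurrence with the same two initial values.\<close>

lemma gegenbauer_eq_fps_nth:
  assumes \<nu>: "\<nu> \<noteq> 0" and uv: "u * v = 1" "u + v = of_real (2 * t)"
  shows "of_real (gegenbauer \<nu> n t) = fps_nth (binom_fps \<nu> u * binom_fps \<nu> v) n"
proof -
  define F where "F = binom_fps \<nu> u"
  define G where "G = binom_fps \<nu> v"
  define H where "H = F * G"
  let ?U = "1 - fps_const u * fps_X" and ?V = "1 - fps_const v * fps_X"
  have UV: "?U * ?V = 1 - fps_const (of_real (2 * t)) * fps_X + fps_X ^ 2"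
  proof -
    have "?U * ?V = 1 - fps_const (u + v) * fps_X + fps_const (u * v) * fps_X ^ 2"
      by (simp add: algebra_simps power2_eq_square flip: fps_const_add fps_const_mult)
    then show ?thesis by (simp add: uv)
  qed
  have "?U * ?V * fps_deriv H = ?V * G * (?U * fps_deriv F) + ?U * F * (?V * fps_deriv G)"
    unfolding H_def fps_deriv_mult by (simp only: algebra_simps)
  also have "\<dots> = ?V * G * (fps_const (of_real \<nu> * u) * F) + ?U * F * (fps_const (of_real \<nu> * v) * G)"
    unfolding F_def G_def by (simp only: binom_fps_deriv)
  also have "\<dots> = fps_const (of_real \<nu>) * (fps_const (u + v) - fps_const (2 * (u * v)) * fps_X) * H"
    unfolding H_def by (simp add: algebra_simps flip: fps_const_add fps_const_mult numeral_fps_const)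
  finally have ode: "(1 - fps_const (of_real (2 * t)) * fps_X + fps_X ^ 2) * fps_deriv H
      = fps_const (of_real \<nu>) * (fps_const (of_real (2 * t)) - fps_const 2 * fps_X) * H"
    unfolding UV by (simp add: uv)
  have H0: "fps_nth H 0 = 1" by (simp add: H_def F_def G_def binom_fps_def)
  have coef: "fps_nth (fps_deriv H) n - of_real (2 * t) * (if n = 0 then 0 else fps_nth (fps_deriv H) (n - 1))
       + (if n < 2 then 0 else fps_nth (fps_deriv H) (n - 2))
      = of_real \<nu> * (of_real (2 * t) * fps_nth H n - 2 * (if n = 0 then 0 else fps_nth H (n - 1)))" for n
  proof -
    have "fps_nth ((1 - fps_const (of_real (2 * t)) * fps_X + fps_X ^ 2) * fps_deriv H) n
      = fps_nth (fps_const (of_real \<nu>) * ((fps_const (of_real (2 * t)) - fps_const 2 * fps_X) * H)) n"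
      using ode by (simp only: mult.assoc)
    then show ?thesis
      by (simp add: distrib_right left_diff_distrib mult.assoc fps_X_power_mult_nth del: fps_deriv_nth)
  qed
  have H1: "fps_nth H 1 = of_real (2 * \<nu> * t)" using coef[of 0] H0 by simp
  have rec: "of_nat (n + 2) * fps_nth H (n + 2)
      = of_real (2 * (real (n + 1) + \<nu>) * t) * fps_nth H (n + 1) - of_real (real n + 2 * \<nu>) * fps_nth H n" for n
  proof (cases n)
    case 0
    then show ?thesis using coef[of 1] by (simp add: algebra_simps)
  next
    case (Suc k)
    then show ?thesis using coef[of "n + 1"] by (simp add: algebra_simps)
  qed
  have "of_real (gegenbauer \<nu> n t) = fps_nth H n"
  proof (induction n rule: less_induct)
    case (less n)
    consider "n = 0" | "n = 1" | k where "n = k + 2"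
      by (metis One_nat_def add_2_eq_Suc' not0_implies_Suc)
    then show ?case
    proof cases
      case 3
      have "of_nat (k + 2) * fps_nth H (k + 2) = of_nat (k + 2) * of_real (gegenbauer \<nu> (k + 2) t)"
      proof -
        have "of_nat (k + 2) * complex_of_real (gegenbauer \<nu> (k + 2) t)
            = of_real (real (k + 2) * gegenbauer \<nu> (k + 2) t)" by simp
        also have "\<dots> = of_real (2 * (real (k + 1) + \<nu>) * t) * of_real (gegenbauer \<nu> (k + 1) t)
            - of_real (real k + 2 * \<nu>) * of_real (gegenbauer \<nu> k t)"
          unfolding gegenbauer_rec[OF \<nu>] by simp
        also have "\<dots> = of_real (2 * (real (k + 1) + \<nu>) * t) * fps_nth H (k + 1) - of_real (real k + 2 * \<nu>) * fps_nth H k"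
          using less[of k] less[of "k + 1"] 3 by simp
        finally show ?thesis using rec[of k] by simp
      qed
      then show ?thesis using 3 by (metis add_is_0 mult_cancel_left of_nat_eq_0_iff zero_neq_numeral)
    qed (use H0 H1 gegenbauer_1[OF \<nu>] in auto)
  qed
  then show ?thesis by (simp add: H_def F_def G_def)
qed

text \<open>For t = cos x the polynomial is the n-th coefficient of the product of the series
  (1 - exp(ix) z)^(-nu) and (1 - exp(-ix) z)^(-nu), which are dominated by the series for x = 0.\<close>

lemma abs_gegenbauer_le:
  assumes "0 \<le> \<nu>" "\<bar>t\<bar> \<le> 1"
  shows "\<bar>gegenbauer \<nu> n t\<bar> \<le> \<bar>gegenbauer \<nu> n 1\<bar>"
proof (cases "\<nu> = 0")
  case True
  then show ?thesis by (auto simp: gegenbauer_def abs_mult intro!: divide_right_mono)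
next
  case False
  define u where "u = Complex t (sqrt (1 - t^2))"
  have t2: "t^2 \<le> 1" using assms(2) by (simp add: abs_square_le_1)
  have nu: "norm u = 1" unfolding u_def cmod_def using t2 by simp
  have uv: "u * cnj u = 1" using nu complex_norm_square[of u] by simp
  have uv': "u + cnj u = of_real (2 * t)" by (simp add: u_def complex_eq_iff)
  have p: "0 \<le> pochhammer \<nu> k / fact k" for k
    using assms(1) False by (simp add: pochhammer_nonneg)
  have "\<bar>gegenbauer \<nu> n t\<bar> = norm (fps_nth (binom_fps \<nu> u * binom_fps \<nu> (cnj u)) n)"
    unfolding gegenbauer_eq_fps_nth[OF False uv uv', symmetric] by simp
  also have "\<dots> \<le> (\<Sum>i=0..n. pochhammer \<nu> i / fact i * (pochhammer \<nu> (n - i) / fact (n - i)))"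
    unfolding fps_mult_nth
  proof (rule order_trans[OF norm_sum], rule sum_mono)
    fix i
    show "norm (fps_nth (binom_fps \<nu> u) i * fps_nth (binom_fps \<nu> (cnj u)) (n - i))
        \<le> pochhammer \<nu> i / fact i * (pochhammer \<nu> (n - i) / fact (n - i))"
      using p[of i] p[of "n - i"] assms(1) False
      by (simp add: binom_fps_def norm_mult norm_power norm_divide nu pochhammer_nonneg)
  qed
  also have "\<dots> = \<bar>gegenbauer \<nu> n 1\<bar>"
  proof -
    have "complex_of_real (gegenbauer \<nu> n 1)
        = of_real (\<Sum>i=0..n. pochhammer \<nu> i / fact i * (pochhammer \<nu> (n - i) / fact (n - i)))"
      using gegenbauer_eq_fps_nth[OF False, of 1 1 1 n] by (simp add: binom_fps_def fps_mult_nth)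
    then have "gegenbauer \<nu> n 1
        = (\<Sum>i=0..n. pochhammer \<nu> i / fact i * (pochhammer \<nu> (n - i) / fact (n - i)))"
      by (simp only: of_real_eq_iff)
    moreover have "0 \<le> (\<Sum>i=0..n. pochhammer \<nu> i / fact i * (pochhammer \<nu> (n - i) / fact (n - i)))"
      using p by (intro sum_nonneg mult_nonneg_nonneg)
    ultimately show ?thesis by simp
  qed
  finally show ?thesis .
qed

lemma gegenbauer_minus:
  assumes "\<bar>t\<bar> \<le> 1"
  shows "gegenbauer \<nu> n (- t) = (-1)^n * gegenbauer \<nu> n t"
proof (cases "\<nu> = 0")
  case True
  have "cos (real n * (pi - arccos t)) = (-1)^n * cos (real n * arccos t)"
    by (simp add: right_diff_distrib cos_diff mult.commute[of "real n" pi])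
  then show ?thesis using True assms by (auto simp: gegenbauer_def arccos_minus_abs)
next
  case False
  have "(- (2 * t)) ^ (n - 2 * l) = (-1)^n * (2 * t) ^ (n - 2 * l)" if "l \<le> n div 2" for l
  proof -
    have "even n = even (n - 2 * l)" using that by auto
    then have "(-1::real) ^ (n - 2 * l) = (-1) ^ n" by (metis neg_one_even_power neg_one_odd_power)
    then show ?thesis by (metis power_minus)
  qed
  then show ?thesis using False
    by (auto simp: gegenbauer_def sum_distrib_left intro!: sum.cong)
qed

section \<open>The surface measure of the sphere\<close>

lemma sets_sphere_measure:
  "sets (sphere_measure :: (real^'d) measure) = sets (restrict_space borel (sphere 0 1))"
proof -
  have "sigma_algebra (sphere (0::real^'d) 1) (sets (restrict_space lborel (sphere (0::real^'d) 1)))"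
    using sets.sigma_algebra_axioms[of "restrict_space lborel (sphere (0::real^'d) 1)"]
    by (simp add: space_restrict_space)
  then have "sets (sphere_measure :: (real^'d) measure) = sets (restrict_space lborel (sphere (0::real^'d) 1))"
    unfolding sphere_measure_def by (rule sigma_algebra.sets_measure_of_eq)
  also have "\<dots> = sets (restrict_space borel (sphere (0::real^'d) 1))"
    by (rule sets_restrict_space_cong) simp
  finally show ?thesis .
qed

lemma space_sphere_measure [simp]: "space (sphere_measure :: (real^'d) measure) = sphere 0 1"
  using sets_eq_imp_space_eq[OF sets_sphere_measure] by (simp add: space_restrict_space)

lemma measurable_sphere_measure [measurable (raw)]:
  "f \<in> measurable borel M \<Longrightarrow> f \<in> measurable (sphere_measure :: (real^'d) measure) M"
  by (subst measurable_cong_sets[OF sets_sphere_measure refl]) (rule measurable_restrict_space1)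

lemma borel_measurable_of_sphere_measure:
  assumes "X \<in> measurable M (sphere_measure :: (real^'d) measure)"
  shows "X \<in> borel_measurable M"
  using measurable_compose[OF assms, of "\<lambda>x. x" borel] by simp

text \<open>The cone over A is the preimage of A under radial projection of the punctured ball, so
  the cone measure is a pushforward of Lebesgue measure.\<close>

lemma sphere_emeasure_cone:
  fixes A :: "(real^'d) set"
  assumes A: "A \<in> sets (sphere_measure :: (real^'d) measure)"
  shows "{t *\<^sub>R x | t x. x \<in> A \<and> 0 < t \<and> t \<le> 1} = {y \<in> cball 0 1 - {0}. y /\<^sub>R norm y \<in> A}"
proof -
  have sub: "A \<subseteq> sphere 0 1" using sets.sets_into_space[OF A] by simp
  show ?thesis
  proof (intro set_eqI iffI)
    fix y assume "y \<in> {t *\<^sub>R x | t x. x \<in> A \<and> 0 < t \<and> t \<le> 1}"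
    then obtain t x where tx: "y = t *\<^sub>R x" "x \<in> A" "0 < t" "t \<le> 1" by blast
    then have "norm x = 1" using sub by auto
    then show "y \<in> {y \<in> cball 0 1 - {0}. y /\<^sub>R norm y \<in> A}" using tx by auto
  next
    fix y assume y: "y \<in> {y \<in> cball 0 1 - {0}. y /\<^sub>R norm y \<in> A}"
    then have "y = norm y *\<^sub>R (y /\<^sub>R norm y)" by auto
    moreover have "0 < norm y" "norm y \<le> 1" using y by auto
    ultimately show "y \<in> {t *\<^sub>R x | t x. x \<in> A \<and> 0 < t \<and> t \<le> 1}" using y by blast
  qed
qed

lemma emeasure_distr_sphere_proj:
  fixes A :: "(real^'d) set"
  assumes A: "A \<in> sets (restrict_space borel (sphere 0 1))"
  shows "emeasure (distr (restrict_space lborel (cball 0 1 - {0})) (restrict_space borel (sphere 0 1)) (\<lambda>y. y /\<^sub>R norm y)) A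
    = emeasure lborel {y \<in> cball 0 1 - {0}. y /\<^sub>R norm y \<in> A}"
proof -
  have m: "(\<lambda>y::real^'d. y /\<^sub>R norm y) \<in> measurable (restrict_space lborel (cball 0 1 - {0})) (restrict_space borel (sphere 0 1))"
    by (rule measurable_restrict_space3) auto
  have "(\<lambda>y. y /\<^sub>R norm y) -` A \<inter> (cball 0 1 - {0}) = {y \<in> cball 0 1 - {0}. y /\<^sub>R norm y \<in> A}"
    by auto
  then have "(\<lambda>y. y /\<^sub>R norm y) -` A \<inter> space (restrict_space lborel (cball 0 1 - {0})) = {y \<in> cball 0 1 - {0}. y /\<^sub>R norm y \<in> A}"
    by (simp only: space_restrict_space space_lborel Int_UNIV_right space_borel)
  moreover have "emeasure (restrict_space lborel (cball 0 1 - {0})) {y \<in> cball 0 1 - {0}. y /\<^sub>R norm y \<in> A}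
      = emeasure lborel {y \<in> cball 0 1 - {0}. y /\<^sub>R norm y \<in> A}"
    by (rule emeasure_restrict_space) auto
  ultimately show ?thesis
    unfolding emeasure_distr[OF m A] by simp
qed

text \<open>A measure built by \<open>measure_of\<close> has the prescribed values only if these are
  countably additive. Recognising them as those of a scaled pushforward supplies this, and every
  later fact about \<open>sphere_measure\<close> rests on it.\<close>

lemma sphere_measure_eq:
  "(sphere_measure :: (real^'d) measure) = scale_measure (of_nat CARD('d))
     (distr (restrict_space lborel (cball 0 1 - {0})) (restrict_space borel (sphere 0 1)) (\<lambda>y. y /\<^sub>R norm y))"
    (is "_ = ?M")
proof -
  have eqs: "sets (restrict_space lborel (sphere (0::real^'d) 1)) = sets (restrict_space borel (sphere (0::real^'d) 1))"
    by (rule sets_restrict_space_cong) simp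
  have sM: "space ?M = sphere 0 1" by (simp add: space_restrict_space space_scale_measure)
  have "?M = measure_of (space ?M) (sets ?M) (emeasure ?M)" by (rule measure_of_of_measure[symmetric])
  also have "\<dots> = measure_of (sphere 0 1) (sets (restrict_space lborel (sphere (0::real^'d) 1))) (emeasure ?M)"
    unfolding sM by (simp add: eqs)
  also have "\<dots> = sphere_measure"
    unfolding sphere_measure_def
  proof (rule measure_of_eq)
    show "sets (restrict_space lborel (sphere (0::real^'d) 1)) \<subseteq> Pow (sphere 0 1)"
      using sets.space_closed[of "restrict_space lborel (sphere (0::real^'d) 1)"]
      by (simp add: space_restrict_space)
    fix A assume "A \<in> sigma_sets (sphere (0::real^'d) 1) (sets (restrict_space lborel (sphere (0::real^'d) 1)))"
    then have A: "A \<in> sets (restrict_space borel (sphere (0::real^'d) 1))"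
      unfolding eqs
      using sets.sigma_sets_eq[of "restrict_space borel (sphere (0::real^'d) 1)"]
      by (simp add: space_restrict_space)
    have "emeasure ?M A = of_nat CARD('d) * emeasure lborel {y \<in> cball 0 1 - {0}. y /\<^sub>R norm y \<in> A}"
      using A by (simp only: emeasure_distr_sphere_proj emeasure_scale_measure)
    then show "emeasure ?M A = of_nat CARD('d) * emeasure lborel {t *\<^sub>R x | t x. x \<in> A \<and> 0 < t \<and> t \<le> 1}"
      using sphere_emeasure_cone[of A] A by (simp add: sets_sphere_measure)
  qed
  finally show ?thesis ..
qed

lemma emeasure_sphere_measure:
  fixes A :: "(real^'d) set"
  assumes A: "A \<in> sets (sphere_measure :: (real^'d) measure)"
  shows "emeasure sphere_measure A = of_nat CARD('d) * emeasure lborel {y \<in> cball 0 1 - {0}. y /\<^sub>R norm y \<in> A}"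
  using A unfolding sets_sphere_measure
  by (simp only: sphere_measure_eq emeasure_distr_sphere_proj emeasure_scale_measure)

lemma finite_sphere_measure: "finite_measure (sphere_measure :: (real^'d) measure)"
proof
  have "emeasure (sphere_measure :: (real^'d) measure) (space sphere_measure)
      \<le> of_nat CARD('d) * emeasure lborel (cball (0::real^'d) 1)"
    by (subst emeasure_sphere_measure[OF sets.top]) (auto intro!: mult_left_mono emeasure_mono)
  also have "\<dots> < \<infinity>"
    using emeasure_lborel_cball_finite[of "0::real^'d" 1] by (simp add: ennreal_mult_less_top of_nat_less_top)
  finally show "emeasure (sphere_measure :: (real^'d) measure) (space sphere_measure) \<noteq> \<infinity>" by simp
qed

text \<open>Lebesgue measure is invariant under reflection at the origin, and radial projection
  commutes with that reflection. All parity arguments rely on this invariance.\<close>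

lemma sphere_measure_distr_uminus:
  "distr sphere_measure sphere_measure uminus = (sphere_measure :: (real^'d) measure)"
proof (rule measure_eqI)
  show "sets (distr sphere_measure sphere_measure uminus) = sets (sphere_measure :: (real^'d) measure)" by simp
  have mb: "(uminus :: real^'d \<Rightarrow> _) \<in> measurable sphere_measure sphere_measure"
    unfolding measurable_cong_sets[OF sets_sphere_measure sets_sphere_measure]
    by (rule measurable_restrict_space3) auto
  fix A assume "A \<in> sets (distr sphere_measure sphere_measure (uminus :: real^'d \<Rightarrow> _))"
  then have A: "A \<in> sets (sphere_measure :: (real^'d) measure)" by simp
  let ?C = "\<lambda>B. {y \<in> cball (0::real^'d) 1 - {0}. y /\<^sub>R norm y \<in> B}"
  have B: "uminus -` A \<inter> sphere 0 1 \<in> sets (sphere_measure :: (real^'d) measure)"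
    using measurable_sets[OF mb A] by simp
  obtain A' where A': "A' \<in> sets borel" "A = A' \<inter> sphere 0 1"
    using A unfolding sets_sphere_measure sets_restrict_space by auto
  have CB: "?C A \<in> sets borel"
  proof -
    have "?C A = {y \<in> space borel. norm y \<le> 1 \<and> y \<noteq> 0 \<and> y /\<^sub>R norm y \<in> A'}"
      using A' by auto
    also have "\<dots> \<in> sets borel"
    proof -
      have [measurable]: "(\<lambda>y::real^'d. y /\<^sub>R norm y) \<in> borel_measurable borel" by measurable
      have [measurable]: "A' \<in> sets borel" by (rule A'(1))
      show ?thesis by measurable
    qed
    finally show ?thesis .
  qed
  have lm: "distr lborel borel uminus = (lborel :: (real^'d) measure)"
    using lborel_affine[of "-1" "0 :: real^'d"] by (simp add: density_1)
  have "emeasure lborel (?C A) = emeasure (distr lborel borel uminus) (?C A)"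
    unfolding lm ..
  also have "\<dots> = emeasure lborel (uminus -` (?C A))"
    using CB by (subst emeasure_distr) auto
  also have "uminus -` (?C A) = ?C (uminus -` A \<inter> sphere 0 1)"
    by auto
  finally show "emeasure (distr sphere_measure sphere_measure uminus) A = emeasure sphere_measure A"
    using A B mb by (simp add: emeasure_distr emeasure_sphere_measure)
qed

lemma sphere_measure_measurable_uminus [measurable]:
  "(uminus :: real^'d \<Rightarrow> _) \<in> measurable sphere_measure sphere_measure"
  unfolding measurable_cong_sets[OF sets_sphere_measure sets_sphere_measure]
  by (rule measurable_restrict_space3) auto

lemma sphere_integral_uminus:
  fixes f :: "real^'d \<Rightarrow> real"
  assumes [measurable]: "f \<in> borel_measurable sphere_measure"
  shows "(LINT x|sphere_measure. f (- x)) = (LINT x|sphere_measure. f x)"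
  using integral_distr[of uminus sphere_measure sphere_measure f]
  by (simp add: sphere_measure_distr_uminus)

lemma AE_sphere_uminus:
  assumes "AE x in (sphere_measure :: (real^'d) measure). Q x"
  shows "AE x in (sphere_measure :: (real^'d) measure). Q (- x)"
proof -
  have "AE x in distr sphere_measure sphere_measure (uminus :: real^'d \<Rightarrow> _). Q x"
    using assms unfolding sphere_measure_distr_uminus .
  then show ?thesis by (rule AE_distrD[rotated]) simp
qed

text \<open>The cone over the equator lies in a hyperplane. The equator has to be discarded because
  there \<open>Rfun\<close> takes its first branch at both x and -x, so that R(-x) = 1 - R(x) may
  fail.\<close>

lemma AE_sphere_coordinate_ne_0:
  "AE x in (sphere_measure :: (real^'d) measure). x $ e \<noteq> 0"
proof (rule AE_I')
  let ?A = "{x \<in> sphere (0::real^'d) 1. x $ e = 0}"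
  have "?A = {x \<in> space (sphere_measure :: (real^'d) measure). x $ e = 0}" by simp
  also have "\<dots> \<in> sets sphere_measure" by measurable
  finally have A: "?A \<in> sets sphere_measure" .
  have "{y \<in> cball 0 1 - {0}. y /\<^sub>R norm y \<in> ?A} \<subseteq> {y::real^'d. axis e 1 \<bullet> y = 0}"
    by (auto simp: inner_axis')
  moreover have "{y::real^'d. axis e 1 \<bullet> y = 0} \<in> null_sets lborel"
  proof -
    have "negligible {y::real^'d. axis e 1 \<bullet> y = 0}"
      by (rule negligible_hyperplane) (auto simp: axis_eq_0_iff)
    then have "{y::real^'d. axis e 1 \<bullet> y = 0} \<in> null_sets lebesgue" by (simp add: negligible_iff_null_sets)
    moreover have "{y::real^'d. axis e 1 \<bullet> y = 0} \<in> sets borel" by simp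
    ultimately show ?thesis by (simp add: null_sets_def)
  qed
  ultimately have "emeasure lborel {y \<in> cball 0 1 - {0}. y /\<^sub>R norm y \<in> ?A} = 0"
    using emeasure_mono[of _ "{y::real^'d. axis e 1 \<bullet> y = 0}" lborel]
    by (metis (no_types, lifting) null_setsD1 null_setsD2 le_zero_eq)
  then show "?A \<in> null_sets sphere_measure"
    using A emeasure_sphere_measure[OF A] by (simp add: null_sets_def)
  show "{x \<in> space sphere_measure. \<not> (x $ e \<noteq> 0)} \<subseteq> ?A" by auto
qed

section \<open>The projection kernels\<close>

text \<open>The kernels are controlled only for inner products in [-1, 1]; clamping yields kernels that agree
  on the sphere and are continuous and bounded on the whole space.\<close>

definition clamp1 :: "real \<Rightarrow> real" where
  "clamp1 t = max (-1) (min 1 t)"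

lemma clamp1_eq: "\<bar>t\<bar> \<le> 1 \<Longrightarrow> clamp1 t = t"
  and abs_clamp1: "\<bar>clamp1 t\<bar> \<le> 1"
  and clamp1_minus: "clamp1 (- t) = - clamp1 t"
  by (auto simp: clamp1_def)

lemma continuous_on_gegenbauer_clamp1: "continuous_on UNIV (\<lambda>t. gegenbauer \<nu> n (clamp1 t))"
proof (cases "\<nu> = 0")
  case True
  have "continuous_on UNIV (\<lambda>t. arccos (clamp1 t))"
    by (rule continuous_on_compose2[OF continuous_on_arccos'])
       (auto simp: clamp1_def intro!: continuous_intros)
  then show ?thesis using True
    by (cases "n = 0") (auto simp: gegenbauer_def intro!: continuous_intros)
next
  case False
  then show ?thesis by (auto simp: gegenbauer_def clamp1_def intro!: continuous_intros)
qed

lemma abs_inner_sphere_le: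
  fixes x y :: "'a::real_inner"
  assumes "x \<in> sphere 0 1" "y \<in> sphere 0 1"
  shows "\<bar>x \<bullet> y\<bar> \<le> 1"
  using Cauchy_Schwarz_ineq2[of x y] assms by simp

definition czonal :: "nat \<Rightarrow> real^'d \<Rightarrow> real^'d \<Rightarrow> real" where
  "czonal n x y = harm_dim n CARD('d) * gegenbauer (gnu CARD('d)) n (clamp1 (x \<bullet> y))
      / (sphere_area CARD('d) * gegenbauer (gnu CARD('d)) n 1)"

lemma czonal_eq: "x \<in> sphere 0 1 \<Longrightarrow> y \<in> sphere 0 1 \<Longrightarrow> czonal n x y = zonal n x y"
  using abs_inner_sphere_le[of x y] by (simp add: czonal_def zonal_def clamp1_eq)

lemma czonal_commute: "czonal n x y = czonal n y x"
  by (simp add: czonal_def inner_commute)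

lemma czonal_minus: "czonal n (- x) y = (-1) ^ n * czonal n x y"
  by (simp add: czonal_def clamp1_minus gegenbauer_minus[OF abs_clamp1])

lemma continuous_on_czonal: "continuous_on UNIV (\<lambda>p. czonal n (fst p) (snd p))"
  unfolding czonal_def divide_inverse
  by (intro continuous_intros continuous_on_compose2[OF continuous_on_gegenbauer_clamp1])
     (auto intro!: continuous_intros)

lemma harm_dim_nonneg: "2 \<le> d \<Longrightarrow> 0 \<le> harm_dim n d"
  by (simp add: harm_dim_def)

text \<open>The quotient C_n(t) / C_n(1) has modulus at most 1; were C_n(1) zero, the quotient would
  be 0 by convention. For the same economy the area constant enters by its modulus, which avoids
  determining its sign.\<close>

lemma abs_czonal_le:
  assumes "2 \<le> CARD('d)"
  shows "\<bar>czonal n (x :: real^'d) y\<bar> \<le> harm_dim n CARD('d) / \<bar>sphere_area CARD('d)\<bar>"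
proof -
  let ?g = "\<lambda>t. gegenbauer (gnu CARD('d)) n t"
  have "\<bar>?g (clamp1 (x \<bullet> y))\<bar> \<le> \<bar>?g 1\<bar>"
    using assms by (intro abs_gegenbauer_le abs_clamp1) (simp add: gnu_def)
  then have le: "\<bar>?g (clamp1 (x \<bullet> y))\<bar> / \<bar>?g 1\<bar> \<le> 1"
    by (cases "?g 1 = 0") (auto simp: divide_simps)
  have "\<bar>czonal n x y\<bar> = (harm_dim n CARD('d) / \<bar>sphere_area CARD('d)\<bar>) * (\<bar>?g (clamp1 (x \<bullet> y))\<bar> / \<bar>?g 1\<bar>)"
    using harm_dim_nonneg[OF assms] by (simp add: czonal_def abs_mult)
  also have "\<dots> \<le> (harm_dim n CARD('d) / \<bar>sphere_area CARD('d)\<bar>) * 1"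
    using harm_dim_nonneg[OF assms] by (intro mult_left_mono le) auto
  finally show ?thesis by simp
qed

text \<open>With m = d - 2 the dimension is (2n + m)/(n + m) times the binomial coefficient of n + m
  over m. The first factor is at most 2, the second is a product of m factors (n + j)/j, each at
  most n + 1.\<close>

lemma harm_dim_le:
  assumes "2 \<le> d" "1 \<le> n"
  shows "harm_dim n d \<le> 2 * real (n + 1) ^ (d - 2)"
proof -
  define m where "m = d - 2"
  have d: "d = m + 2" using assms(1) by (simp add: m_def)
  have fle: "fact (n + m) \<le> (fact n * fact m * real (n + 1) ^ m :: real)" for m
  proof (induction m)
    case (Suc m)
    have "fact (n + Suc m) = real (n + Suc m) * fact (n + m)" by simp
    also have "\<dots> \<le> (real (Suc m) * real (n + 1)) * (fact n * fact m * real (n + 1) ^ m)"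
      using Suc by (intro mult_mono) (auto simp: algebra_simps)
    finally show ?case by (simp add: algebra_simps)
  qed simp
  have "harm_dim n d = (real (2*n + m) / real (n + m)) * (fact (n + m) / (fact n * fact m))"
    using assms by (simp add: harm_dim_def d)
  also have "\<dots> \<le> 2 * real (n + 1) ^ m"
  proof (rule mult_mono)
    show "real (2*n + m) / real (n + m) \<le> 2" using assms by (simp add: divide_simps)
    show "fact (n + m) / (fact n * fact m) \<le> real (n + 1) ^ m"
      using fle[of m] by (simp add: divide_simps mult_ac)
  qed auto
  finally show ?thesis by (simp add: d)
qed

section \<open>The odd kernel: size, L1 norm and Lipschitz constant\<close>

definition codd :: "(nat \<Rightarrow> nat \<Rightarrow> real) \<Rightarrow> nat \<Rightarrow> real^'d \<Rightarrow> real^'d \<Rightarrow> real" where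
  "codd ch T x y = (\<Sum>p<T. ch (2*p+1) (2*T) * czonal (2*p+1) x y)"

lemma codd_eq_kern_odd:
  "x \<in> sphere 0 1 \<Longrightarrow> y \<in> sphere 0 1 \<Longrightarrow> codd ch T x y = kern_odd ch T x y"
  by (simp add: codd_def kern_odd_def czonal_eq)

lemma codd_commute: "codd ch T x y = codd ch T y x"
  unfolding codd_def by (subst czonal_commute) simp

lemma codd_minus: "codd ch T (- x) y = - codd ch T x y"
  by (simp add: codd_def czonal_minus sum_negf)

lemma continuous_on_codd: "continuous_on UNIV (\<lambda>p. codd ch T (fst p) (snd p))"
  unfolding codd_def by (intro continuous_intros continuous_on_czonal)

lemma borel_measurable_codd [measurable (raw)]:
  fixes f g :: "'b \<Rightarrow> real^'d"
  assumes [measurable]: "f \<in> borel_measurable M" "g \<in> borel_measurable M"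
  shows "(\<lambda>x. codd ch T (f x) (g x)) \<in> borel_measurable M"
proof -
  have "(\<lambda>p. codd ch T (fst p) (snd p)) \<in> borel_measurable (borel :: ((real^'d) \<times> (real^'d)) measure)"
    by (rule borel_measurable_continuous_onI[OF continuous_on_codd])
  then have "(\<lambda>x. (\<lambda>p. codd ch T (fst p) (snd p)) (f x, g x)) \<in> borel_measurable M"
    by (rule measurable_compose[rotated]) simp
  then show ?thesis by simp
qed

text \<open>There are T summands. Each has weight at most 1 by \<open>K4\<close> and size
  O(T^(d-2)), because p < T gives 2 p + 2 <= 2 T.\<close>

lemma abs_codd_le:
  fixes x y :: "real^'d"
  assumes d: "2 \<le> CARD('d)" and K4: "K4 ch"
  shows "\<bar>codd ch T x y\<bar> \<le> 2 ^ (CARD('d) - 1) / \<bar>sphere_area CARD('d)\<bar> * real T ^ (CARD('d) - 1)"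
proof -
  let ?d = "CARD('d)" and ?A = "\<bar>sphere_area CARD('d)\<bar>"
  have "\<bar>codd ch T x y\<bar> \<le> (\<Sum>p<T. \<bar>ch (2*p+1) (2*T)\<bar> * \<bar>czonal (2*p+1) x y\<bar>)"
    unfolding codd_def by (rule order_trans[OF sum_abs]) (simp add: abs_mult)
  also have "\<dots> \<le> (\<Sum>p<T. 1 * (2 * (2 * real T) ^ (?d - 2) / ?A))"
  proof (intro sum_mono mult_mono)
    fix p assume "p \<in> {..<T}"
    then have p: "p < T" by simp
    have "harm_dim (2*p+1) ?d \<le> 2 * real (2*p+1 + 1) ^ (?d - 2)" using d by (intro harm_dim_le) auto
    also have "\<dots> \<le> 2 * (2 * real T) ^ (?d - 2)" using p by (intro mult_left_mono power_mono) auto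
    finally show "\<bar>czonal (2*p+1) x y\<bar> \<le> 2 * (2 * real T) ^ (?d - 2) / ?A"
      using abs_czonal_le[OF d, of "2*p+1" x y] by (meson divide_right_mono abs_ge_zero order_trans)
  qed (use K4 in \<open>auto simp: K4_def\<close>)
  also have "\<dots> = 2 ^ (Suc (?d - 2)) / ?A * real T ^ (Suc (?d - 2))"
    by (simp add: power_mult_distrib)
  also have "Suc (?d - 2) = ?d - 1" using d by simp
  finally show ?thesis .
qed

text \<open>Antisymmetrising in the first argument doubles the odd degrees and removes the even
  ones. Through this formula the conditions on the full kernel pass to its odd part.\<close>

lemma codd_eq_kern_diff:
  assumes "x \<in> sphere 0 1" "y \<in> sphere 0 1"
  shows "codd ch T x y = (kern ch (2*T) x y - kern ch (2*T) (- x) y) / 2"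
proof -
  have mx: "- x \<in> sphere 0 1" using assms by simp
  have "kern ch (2*T) x y - kern ch (2*T) (- x) y
      = (\<Sum>n\<le>2*T. (if odd n then 2 * (ch n (2*T) * zonal n x y) else 0))"
    unfolding kern_def sum_subtractf[symmetric] czonal_eq[OF assms, symmetric] czonal_eq[OF mx assms(2), symmetric] czonal_minus
    by (rule sum.cong) auto
  also have "\<dots> = (\<Sum>n\<in>(\<lambda>p. 2*p+1) ` {..<T}. 2 * (ch n (2*T) * zonal n x y))"
  proof (subst sum.inter_filter[symmetric], simp, rule sum.cong)
    show "{n \<in> {..2*T}. odd n} = (\<lambda>p. 2*p+1) ` {..<T}"
    proof (intro set_eqI iffI)
      fix n assume "n \<in> {n \<in> {..2*T}. odd n}"
      then have n: "n \<le> 2 * T" "odd n" by auto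
      then obtain p where p: "n = 2 * p + 1" by (auto elim: oddE)
      then show "n \<in> (\<lambda>p. 2*p+1) ` {..<T}" using n by auto
    qed auto
  qed auto
  also have "\<dots> = (\<Sum>p<T. 2 * (ch (2*p+1) (2*T) * zonal (2*p+1) x y))"
    by (subst sum.reindex) (auto simp: inj_on_def)
  also have "\<dots> = 2 * codd ch T x y"
    using codd_eq_kern_odd[OF assms, of ch T] by (simp add: kern_odd_def sum_distrib_left)
  finally show ?thesis by simp
qed

lemma borel_measurable_kern:
  assumes "x \<in> sphere (0::real^'d) 1"
  shows "(\<lambda>y. kern ch T x y) \<in> borel_measurable sphere_measure"
proof -
  have "continuous_on UNIV (\<lambda>y. czonal n x y)" for n
    by (rule continuous_on_compose2[OF continuous_on_czonal[of n], of UNIV "\<lambda>y. (x, y)", simplified])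
       (intro continuous_intros)
  then have "(\<lambda>y. (\<Sum>n\<le>T. ch n T * czonal n x y)) \<in> borel_measurable borel"
    by (intro borel_measurable_continuous_onI continuous_intros)
  then have "(\<lambda>y. (\<Sum>n\<le>T. ch n T * czonal n x y)) \<in> borel_measurable sphere_measure" by simp
  then show ?thesis
    by (subst measurable_cong[of _ _ "\<lambda>y. (\<Sum>n\<le>T. ch n T * czonal n x y)"])
       (use assms in \<open>auto simp: kern_def czonal_eq\<close>)
qed

lemma abs_kern_le:
  assumes "2 \<le> CARD('d)" "x \<in> sphere (0::real^'d) 1" "y \<in> sphere 0 1"
  shows "\<bar>kern ch T x y\<bar> \<le> (\<Sum>n\<le>T. \<bar>ch n T\<bar> * (harm_dim n CARD('d) / \<bar>sphere_area CARD('d)\<bar>))"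
  unfolding kern_def czonal_eq[OF assms(2,3), symmetric]
  by (rule order_trans[OF sum_abs], rule sum_mono) (subst abs_mult, intro mult_left_mono abs_czonal_le assms abs_ge_zero)

lemma integrable_kern:
  assumes "2 \<le> CARD('d)" "x \<in> sphere (0::real^'d) 1"
  shows "integrable sphere_measure (\<lambda>y. kern ch T x y)"
proof -
  interpret finite_measure "sphere_measure :: (real^'d) measure" by (rule finite_sphere_measure)
  show ?thesis
    by (rule integrable_const_bound[OF _ borel_measurable_kern[OF assms(2)]])
       (auto intro!: AE_I2 abs_kern_le assms)
qed

lemma codd_L1_bound:
  assumes d: "2 \<le> CARD('d)" and "K1 ch TYPE('d)"
  obtains B where "0 < B" "\<And>T x. x \<in> sphere (0::real^'d) 1 \<Longrightarrow> (LINT y|sphere_measure. \<bar>codd ch T x y\<bar>) \<le> B"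
proof -
  interpret finite_measure "sphere_measure :: (real^'d) measure" by (rule finite_sphere_measure)
  obtain B where B: "\<And>T x. x \<in> sphere (0::real^'d) 1 \<Longrightarrow> (LINT y|sphere_measure. \<bar>kern ch T x y\<bar>) \<le> B"
    using assms(2) unfolding K1_def by blast
  show ?thesis
  \<comment> \<open>The added 1 makes the bound strictly positive.\<close>
  proof (rule that[of "\<bar>B\<bar> + 1"])
    fix T and x :: "real^'d" assume x: "x \<in> sphere 0 1"
    then have mx: "- x \<in> sphere 0 1" by simp
    have i: "integrable sphere_measure (\<lambda>y. \<bar>kern ch (2*T) x y\<bar>)" "integrable sphere_measure (\<lambda>y. \<bar>kern ch (2*T) (- x) y\<bar>)"
      using integrable_kern[OF d x] integrable_kern[OF d mx] by auto
    have "integrable sphere_measure (\<lambda>y. \<bar>(kern ch (2*T) x y - kern ch (2*T) (- x) y) / 2\<bar>)"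
      using integrable_kern[OF d x] integrable_kern[OF d mx] by auto
    then have i2: "integrable sphere_measure (\<lambda>y. \<bar>codd ch T x y\<bar>)"
      by (rule Bochner_Integration.integrable_cong[THEN iffD1, rotated 2]) (auto simp: codd_eq_kern_diff[OF x])
    have "(LINT y|sphere_measure. \<bar>codd ch T x y\<bar>)
        \<le> (LINT y|sphere_measure. (\<bar>kern ch (2*T) x y\<bar> + \<bar>kern ch (2*T) (- x) y\<bar>) / 2)"
    proof (rule integral_mono[OF i2])
      show "integrable sphere_measure (\<lambda>y. (\<bar>kern ch (2*T) x y\<bar> + \<bar>kern ch (2*T) (- x) y\<bar>) / 2)" using i by simp
      fix y :: "real^'d" assume "y \<in> space sphere_measure"
      then have y: "y \<in> sphere 0 1" by simp
      show "\<bar>codd ch T x y\<bar> \<le> (\<bar>kern ch (2*T) x y\<bar> + \<bar>kern ch (2*T) (- x) y\<bar>) / 2"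
        using abs_triangle_ineq4[of "kern ch (2*T) x y" "kern ch (2*T) (- x) y"]
        by (simp add: codd_eq_kern_diff[OF x y])
    qed
    also have "\<dots> = ((LINT y|sphere_measure. \<bar>kern ch (2*T) x y\<bar>) + (LINT y|sphere_measure. \<bar>kern ch (2*T) (- x) y\<bar>)) / 2"
      using i by simp
    also have "\<dots> \<le> B"
      using add_mono[OF B[OF x, of "2*T"] B[OF mx, of "2*T"]] by (simp add: field_simps)
    finally show "(LINT y|sphere_measure. \<bar>codd ch T x y\<bar>) \<le> \<bar>B\<bar> + 1" by linarith
  qed auto
qed

lemma codd_Lipschitz:
  assumes "K2 ch TYPE('d)"
  obtains C a where "0 \<le> C" "0 \<le> a"
    "\<And>T x y z. 1 \<le> T \<Longrightarrow> x \<in> sphere (0::real^'d) 1 \<Longrightarrow> y \<in> sphere 0 1 \<Longrightarrow> z \<in> sphere 0 1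
       \<Longrightarrow> \<bar>codd ch T z x - codd ch T z y\<bar> \<le> C * norm (x - y) * real T powr a"
proof -
  obtain C a where C: "\<And>T x y z. x \<in> sphere (0::real^'d) 1 \<Longrightarrow> y \<in> sphere 0 1 \<Longrightarrow> z \<in> sphere 0 1
       \<Longrightarrow> \<bar>kern ch T z x - kern ch T z y\<bar> \<le> C * norm (x - y) * real T powr a"
    using assms unfolding K2_def by blast
  show ?thesis
  \<comment> \<open>Replacing \<open>a\<close> by its modulus only enlarges the power because T >=
    1; \<open>2 powr \<bar>a\<bar>\<close> absorbs the degree 2 T of the full kernel.\<close>
  proof (rule that[of "\<bar>C\<bar> * 2 powr \<bar>a\<bar>" "\<bar>a\<bar>"])
    fix T :: nat and x y z :: "real^'d"
    assume T: "1 \<le> T" and x: "x \<in> sphere 0 1" and y: "y \<in> sphere 0 1" and z: "z \<in> sphere 0 1"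
    then have mz: "- z \<in> sphere 0 1" by simp
    have "\<bar>codd ch T z x - codd ch T z y\<bar> \<le> C * norm (x - y) * real (2*T) powr a"
    proof -
      have avg: "\<bar>(a - c) / 2 - (b - d) / 2\<bar> \<le> K"
        if "\<bar>a - b\<bar> \<le> K" "\<bar>c - d\<bar> \<le> K" for a b c d K :: real
        using that unfolding abs_le_iff by (auto simp: field_simps)
      show ?thesis
        unfolding codd_eq_kern_diff[OF z x] codd_eq_kern_diff[OF z y]
        by (rule avg[OF C[OF x y z] C[OF x y mz]])
    qed
    also have "\<dots> \<le> \<bar>C\<bar> * norm (x - y) * real (2*T) powr \<bar>a\<bar>"
      using T by (intro mult_mono powr_mono) auto
    also have "\<dots> = \<bar>C\<bar> * 2 powr \<bar>a\<bar> * norm (x - y) * real T powr \<bar>a\<bar>"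
      using T by (simp add: powr_mult)
    finally show "\<bar>codd ch T z x - codd ch T z y\<bar> \<le> \<bar>C\<bar> * 2 powr \<bar>a\<bar> * norm (x - y) * real T powr \<bar>a\<bar>" .
  qed auto
qed

section \<open>Deviations of empirical means\<close>

lemma exp_le_one_plus_square:
  fixes u :: real
  assumes "\<bar>u\<bar> \<le> 1"
  shows "exp u \<le> 1 + u + u\<^sup>2"
proof (cases "0 \<le> u")
  case True
  then show ?thesis using assms by (intro exp_bound) auto
next
  case False
  define v where "v = - u"
  have v: "0 < v" using False by (simp add: v_def)
  \<comment> \<open>With u = -v the claim reads (1 - v + v^2) exp v >= 1. Replacing exp v by 1 + v,
    allowed as the first factor is nonnegative, gives 1 + v^3.\<close>
  have "(1 - v + v\<^sup>2) * exp v \<ge> (1 - v + v\<^sup>2) * (1 + v)"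
  proof (rule mult_left_mono)
    show "1 + v \<le> exp v" by (rule exp_ge_add_one_self)
    have "0 \<le> (v - 1/2)\<^sup>2" by simp
    then show "0 \<le> 1 - v + v\<^sup>2" by (simp add: power2_eq_square algebra_simps)
  qed
  moreover have "(1 - v + v\<^sup>2) * (1 + v) = 1 + v ^ 3" by (simp add: algebra_simps power2_eq_square power3_eq_cube)
  ultimately have "1 \<le> (1 - v + v\<^sup>2) * exp v" using v by (smt (verit) zero_less_power)
  then have "exp (- v) \<le> 1 - v + v\<^sup>2" by (simp add: exp_minus field_simps)
  then show ?thesis by (simp add: v_def)
qed

context prob_space begin

text \<open>A coarse Bernstein inequality in which one number V bounds both the summands and their
  second moments. The moment generating function is at most exp(l m + l^2 V) as long as l V <= 1,
  and independence multiplies these bounds.\<close>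

lemma Chernoff_sum_ge:
  fixes Z :: "nat \<Rightarrow> 'a \<Rightarrow> real"
  assumes ind: "indep_vars (\<lambda>_. borel) Z UNIV"
    and bnd: "\<And>i w. \<bar>Z i w\<bar> \<le> V" and mean: "\<And>i. expectation (Z i) = m"
    and sq: "\<And>i. expectation (\<lambda>w. (Z i w)\<^sup>2) \<le> V" and V: "0 < V" and t: "0 \<le> t" "t \<le> 2"
  shows "prob {w \<in> space M. (\<Sum>i<N. Z i w) \<ge> real N * (m + t)} \<le> exp (- (real N * t\<^sup>2 / (4 * V)))"
proof -
  have [measurable]: "Z i \<in> borel_measurable M" for i using ind by (auto simp: indep_vars_def)
  \<comment> \<open>The minimiser of l^2 V - l t, with minimum -t^2 / (4 V). The condition t <= 2 is
    what makes l V <= 1.\<close>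
  define l where "l = t / (2 * V)"
  have l: "0 \<le> l" "l * V \<le> 1" using t V by (auto simp: l_def field_simps)
  have lZ: "\<bar>l * Z i w\<bar> \<le> 1" for i w
  proof -
    have "\<bar>l * Z i w\<bar> = l * \<bar>Z i w\<bar>" using l by (simp add: abs_mult)
    also have "\<dots> \<le> l * V" using l bnd by (intro mult_left_mono) auto
    finally show ?thesis using l by simp
  qed
  have iZ: "integrable M (Z i)" for i by (rule integrable_const_bound[where B = V]) (use bnd in auto)
  have iZ2: "integrable M (\<lambda>w. (Z i w)\<^sup>2)" for i
  proof (rule integrable_const_bound[where B = "V\<^sup>2"])
    show "AE w in M. norm ((Z i w)\<^sup>2) \<le> V\<^sup>2"
      using bnd[of i] V by (auto simp: abs_le_square_iff[symmetric])
  qed auto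
  have ie: "integrable M (\<lambda>w. exp (l * Z i w))" for i
  proof (rule integrable_const_bound[where B = "exp 1"])
    show "AE w in M. norm (exp (l * Z i w)) \<le> exp 1" using lZ[of i] by (auto simp: abs_le_iff)
  qed auto
  have mgf: "expectation (\<lambda>w. exp (l * Z i w)) \<le> exp (l * m + l\<^sup>2 * V)" for i
  proof -
    have "expectation (\<lambda>w. exp (l * Z i w)) \<le> expectation (\<lambda>w. 1 + l * Z i w + l\<^sup>2 * (Z i w)\<^sup>2)"
    proof (rule integral_mono[OF ie])
      show "integrable M (\<lambda>w. 1 + l * Z i w + l\<^sup>2 * (Z i w)\<^sup>2)" using iZ iZ2 by simp
      show "exp (l * Z i w) \<le> 1 + l * Z i w + l\<^sup>2 * (Z i w)\<^sup>2" for w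
        using exp_le_one_plus_square[OF lZ] by (simp add: power_mult_distrib)
    qed
    also have "\<dots> = 1 + l * m + l\<^sup>2 * expectation (\<lambda>w. (Z i w)\<^sup>2)"
      using iZ[of i] iZ2[of i] mean[of i] by (simp add: prob_space)
    also have "\<dots> \<le> 1 + (l * m + l\<^sup>2 * V)" using sq[of i] by (simp add: mult_left_mono)
    also have "\<dots> \<le> exp (l * m + l\<^sup>2 * V)" by (rule exp_ge_add_one_self)
    finally show ?thesis .
  qed
  have indN: "indep_vars (\<lambda>_. borel) (\<lambda>i w. exp (l * Z i w)) {..<N}"
    by (rule indep_vars_compose2[where Y = "\<lambda>_ z. exp (l * z)", OF indep_vars_subset[OF ind]]) auto
  let ?u = "\<lambda>w. \<Prod>i<N. exp (l * Z i w)"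
  have iu: "integrable M ?u" by (rule indep_vars_integrable[OF _ indN]) (auto intro: ie)
  have Eu: "expectation ?u \<le> exp (l * m + l\<^sup>2 * V) ^ N"
  proof -
    have "expectation ?u = (\<Prod>i<N. expectation (\<lambda>w. exp (l * Z i w)))"
      by (rule indep_vars_lebesgue_integral[OF _ indN]) (auto intro: ie)
    also have "\<dots> \<le> (\<Prod>i<N. exp (l * m + l\<^sup>2 * V))" by (intro prod_mono) (auto intro: mgf)
    finally show ?thesis by simp
  qed
  have "{w \<in> space M. (\<Sum>i<N. Z i w) \<ge> real N * (m + t)} \<subseteq> {w \<in> space M. ?u w \<ge> exp (l * (real N * (m + t)))}"
    using l by (auto simp: exp_sum[symmetric] sum_distrib_left[symmetric] mult_left_mono)
  then have "prob {w \<in> space M. (\<Sum>i<N. Z i w) \<ge> real N * (m + t)} \<le> prob {w \<in> space M. ?u w \<ge> exp (l * (real N * (m + t)))}"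
    by (intro finite_measure_mono) auto
  also have "\<dots> \<le> expectation ?u / exp (l * (real N * (m + t)))"
    by (rule integral_Markov_inequality_measure[OF iu sets.top]) (auto intro!: AE_I2 prod_nonneg)
  also have "\<dots> \<le> exp (l * m + l\<^sup>2 * V) ^ N / exp (l * (real N * (m + t)))"
    by (intro divide_right_mono Eu) auto
  also have "\<dots> = exp (real N * (l * m + l\<^sup>2 * V) - l * (real N * (m + t)))"
    by (simp add: exp_diff exp_of_nat_mult)
  also have "real N * (l * m + l\<^sup>2 * V) - l * (real N * (m + t)) = real N * (l\<^sup>2 * V - l * t)"
    by (simp add: algebra_simps)
  also have "l\<^sup>2 * V - l * t = - (t\<^sup>2 / (4 * V))"
    using V by (simp add: l_def power2_eq_square field_simps)
  finally show ?thesis by simp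
qed

lemma Chernoff_mean_abs_ge:
  fixes Z :: "nat \<Rightarrow> 'a \<Rightarrow> real"
  assumes ind: "indep_vars (\<lambda>_. borel) Z UNIV"
    and bnd: "\<And>i w. \<bar>Z i w\<bar> \<le> V" and mean: "\<And>i. expectation (Z i) = m"
    and sq: "\<And>i. expectation (\<lambda>w. (Z i w)\<^sup>2) \<le> V" and V: "0 < V" and t: "0 \<le> t" "t \<le> 2" and N: "0 < N"
  shows "prob {w \<in> space M. \<bar>1 / real N * (\<Sum>i<N. Z i w) - m\<bar> \<ge> t} \<le> 2 * exp (- (real N * t\<^sup>2 / (4 * V)))"
proof -
  have [measurable]: "Z i \<in> borel_measurable M" for i using ind by (auto simp: indep_vars_def)
  have ind': "indep_vars (\<lambda>_. borel) (\<lambda>i w. - Z i w) UNIV"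
    by (rule indep_vars_compose2[where Y = "\<lambda>_ z. - z", OF ind]) auto
  let ?A = "{w \<in> space M. (\<Sum>i<N. Z i w) \<ge> real N * (m + t)}"
  let ?B = "{w \<in> space M. (\<Sum>i<N. - Z i w) \<ge> real N * (- m + t)}"
  have "{w \<in> space M. \<bar>1 / real N * (\<Sum>i<N. Z i w) - m\<bar> \<ge> t} \<subseteq> ?A \<union> ?B"
  proof
    fix w assume w: "w \<in> {w \<in> space M. \<bar>1 / real N * (\<Sum>i<N. Z i w) - m\<bar> \<ge> t}"
    define S where "S = (\<Sum>i<N. Z i w)"
    have "S / real N - m \<ge> t \<or> - (S / real N - m) \<ge> t" using w by (auto simp: S_def)
    then have "S \<ge> real N * (m + t) \<or> - S \<ge> real N * (- m + t)"
      using N by (auto simp: field_simps)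
    then show "w \<in> ?A \<union> ?B" using w by (auto simp: S_def sum_negf)
  qed
  then have "prob {w \<in> space M. \<bar>1 / real N * (\<Sum>i<N. Z i w) - m\<bar> \<ge> t} \<le> prob (?A \<union> ?B)"
    by (intro finite_measure_mono) auto
  also have "\<dots> \<le> prob ?A + prob ?B" by (intro measure_Un_le) auto
  also have "\<dots> \<le> exp (- (real N * t\<^sup>2 / (4 * V))) + exp (- (real N * t\<^sup>2 / (4 * V)))"
    by (intro add_mono Chernoff_sum_ge ind ind') (use bnd mean sq V t in auto)
  finally show ?thesis by simp
qed

text \<open>Centred independent summands are orthogonal, so their second moments add, and centring
  does not increase a second moment. Integrability of the squared partial sums is carried along in
  the induction.\<close>

lemma second_moment_mean_le:
  fixes Z :: "nat \<Rightarrow> 'a \<Rightarrow> real"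
  assumes ind: "indep_vars (\<lambda>_. borel) Z UNIV"
    and bnd: "\<And>i w. \<bar>Z i w\<bar> \<le> V" and mean: "\<And>i. expectation (Z i) = m"
    and sq: "\<And>i. expectation (\<lambda>w. (Z i w)\<^sup>2) \<le> V" and N: "0 < N"
  shows "expectation (\<lambda>w. (1 / real N * (\<Sum>i<N. Z i w) - m)\<^sup>2) \<le> V / real N"
proof -
  have [measurable]: "Z i \<in> borel_measurable M" for i using ind by (auto simp: indep_vars_def)
  have V: "0 \<le> V" using bnd[of 0 undefined] by linarith
  define U where "U i w = Z i w - m" for i w
  have [measurable]: "U i \<in> borel_measurable M" for i unfolding U_def[abs_def] by measurable
  have indU: "indep_vars (\<lambda>_. borel) U UNIV"
    unfolding U_def by (rule indep_vars_compose2[where Y = "\<lambda>_ z. z - m", OF ind]) auto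
  have iZ: "integrable M (Z i)" for i by (rule integrable_const_bound[where B = V]) (use bnd in auto)
  have iZ2: "integrable M (\<lambda>w. (Z i w)\<^sup>2)" for i
    by (rule integrable_const_bound[where B = "V\<^sup>2"])
       (use bnd V in \<open>auto simp: abs_le_square_iff[symmetric]\<close>)
  have iU: "integrable M (U i)" for i unfolding U_def using iZ[of i] by simp
  have EU: "expectation (U i) = 0" for i
    unfolding U_def using iZ[of i] mean[of i] by (simp add: prob_space)
  have iU2: "integrable M (\<lambda>w. (U i w)\<^sup>2)" for i
    unfolding U_def power2_diff using iZ[of i] iZ2[of i] by simp
  have EU2: "expectation (\<lambda>w. (U i w)\<^sup>2) \<le> V" for i
  proof -
    have "expectation (\<lambda>w. (U i w)\<^sup>2) = expectation (\<lambda>w. (Z i w)\<^sup>2) - m\<^sup>2"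
      unfolding U_def power2_diff using iZ[of i] iZ2[of i] mean[of i]
      by (simp add: prob_space power2_eq_square)
    then show ?thesis using sq[of i] by (smt (verit) zero_le_power2)
  qed
  have "integrable M (\<lambda>w. (\<Sum>i<n. U i w)\<^sup>2) \<and> expectation (\<lambda>w. (\<Sum>i<n. U i w)\<^sup>2) \<le> real n * V" for n
  proof (induction n)
    case (Suc n)
    have iv: "indep_var borel (U n) borel (\<lambda>w. \<Sum>i<n. U i w)"
      by (rule indep_vars_sum) (auto intro: indep_vars_subset[OF indU])
    have iS: "integrable M (\<lambda>w. \<Sum>i<n. U i w)" using iU by simp
    have cross: "expectation (\<lambda>w. U n w * (\<Sum>i<n. U i w)) = 0" "integrable M (\<lambda>w. U n w * (\<Sum>i<n. U i w))"
      using indep_var_lebesgue_integral[OF iv iU iS] indep_var_integrable[OF iv iU iS] EU by auto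
    have eq: "(\<Sum>i<Suc n. U i w)\<^sup>2 = (\<Sum>i<n. U i w)\<^sup>2 + 2 * (U n w * (\<Sum>i<n. U i w)) + (U n w)\<^sup>2" for w
      by (simp add: power2_eq_square algebra_simps)
    show ?case unfolding eq using Suc iU2[of n] EU2[of n] cross by (simp add: algebra_simps)
  qed simp
  note S = this[of N]
  have eq: "1 / real N * (\<Sum>i<N. Z i w) - m = 1 / real N * (\<Sum>i<N. U i w)" for w
    using N by (simp add: U_def sum_subtractf field_simps)
  have "expectation (\<lambda>w. (1 / real N * (\<Sum>i<N. Z i w) - m)\<^sup>2) = (1 / real N)\<^sup>2 * expectation (\<lambda>w. (\<Sum>i<N. U i w)\<^sup>2)"
    unfolding eq power_mult_distrib by simp
  also have "\<dots> \<le> (1 / real N)\<^sup>2 * (real N * V)" using S by (intro mult_left_mono) auto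
  also have "\<dots> = V / real N" using N by (simp add: power2_eq_square)
  finally show ?thesis .
qed

end

text \<open>The vector of the floors of n x_i takes at most 2 n + 1 values per coordinate. One point
  of the sphere is chosen from each occupied cell, so the net lies on the sphere itself, where the
  kernel estimates hold; points of one cell differ by at most 1/n in each coordinate.\<close>

lemma sphere_finite_net:
  fixes n :: nat
  assumes n: "0 < n"
  obtains F :: "(real^'d) set" where "finite F" "F \<subseteq> sphere 0 1" "card F \<le> (2 * n + 1) ^ CARD('d)"
    "\<And>x. x \<in> sphere 0 1 \<Longrightarrow> \<exists>y\<in>F. norm (x - y) \<le> real CARD('d) / real n"
proof -
  define c where "c x = (\<lambda>i. \<lfloor>real n * x $ i\<rfloor>)" for x :: "real^'d"
  let ?S = "sphere (0 :: real^'d) 1"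
  define I where "I = c ` ?S"
  have "I \<subseteq> (UNIV \<rightarrow>\<^sub>E {- int n..int n})"
  proof
    fix h assume "h \<in> I"
    then obtain x where x: "x \<in> ?S" "h = c x" by (auto simp: I_def)
    have "h i \<in> {- int n..int n}" for i
    proof -
      have "\<bar>x $ i\<bar> \<le> 1" using component_le_norm_cart[of x i] x by simp
      then have "\<bar>real n * x $ i\<bar> \<le> real n" by (simp add: abs_mult mult_left_le)
      then have "- real n \<le> real n * x $ i" "real n * x $ i \<le> real n" by auto
      then show ?thesis using x by (auto simp: c_def le_floor_iff floor_le_iff)
    qed
    then show "h \<in> UNIV \<rightarrow>\<^sub>E {- int n..int n}" by auto
  qed
  moreover have "card ((UNIV :: 'd set) \<rightarrow>\<^sub>E {- int n..int n}) = (2 * n + 1) ^ CARD('d)"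
    by (subst card_PiE) (auto simp: nat_add_distrib nat_mult_distrib)
  moreover have "finite ((UNIV :: 'd set) \<rightarrow>\<^sub>E {- int n..int n})" by (rule finite_PiE) auto
  ultimately have I: "finite I" "card I \<le> (2 * n + 1) ^ CARD('d)"
    by (metis finite_subset) (metis \<open>I \<subseteq> _\<close> \<open>card _ = _\<close> \<open>finite _\<close> card_mono)
  define s where "s h = (SOME x. x \<in> ?S \<and> c x = h)" for h
  have s: "s h \<in> ?S \<and> c (s h) = h" if "h \<in> I" for h
    unfolding s_def by (rule someI_ex) (use that in \<open>auto simp: I_def\<close>)
  show ?thesis
  proof (rule that[of "s ` I"])
    show "finite (s ` I)" using I by simp
    show "s ` I \<subseteq> ?S" using s by auto
    show "card (s ` I) \<le> (2 * n + 1) ^ CARD('d)" using I card_image_le[of I s] by linarith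
    fix x :: "real^'d" assume x: "x \<in> ?S"
    define y where "y = s (c x)"
    have cI: "c x \<in> I" using x by (auto simp: I_def)
    have cy: "c y = c x" using s[OF cI] by (simp add: y_def)
    have "\<bar>(x - y) $ i\<bar> \<le> 1 / real n" for i
    proof -
      have f: "\<lfloor>real n * x $ i\<rfloor> = \<lfloor>real n * y $ i\<rfloor>" using cy unfolding c_def by metis
      have "\<bar>real n * x $ i - real n * y $ i\<bar> \<le> 1"
        using floor_correct[of "real n * x $ i"] floor_correct[of "real n * y $ i"] unfolding f by linarith
      then have "real n * \<bar>(x - y) $ i\<bar> \<le> 1"
        by (simp add: right_diff_distrib[symmetric] abs_mult)
      then show ?thesis using n by (simp add: field_simps)
    qed
    then have "(\<Sum>i\<in>UNIV. \<bar>(x - y) $ i\<bar>) \<le> (\<Sum>i\<in>(UNIV :: 'd set). 1 / real n)" by (intro sum_mono)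
    then have "norm (x - y) \<le> real CARD('d) / real n"
      using norm_le_l1_cart[of "x - y"] by simp
    moreover have "y \<in> s ` I" using cI by (simp add: y_def)
    ultimately show "\<exists>y\<in>s ` I. norm (x - y) \<le> real CARD('d) / real n" by blast
  qed
qed

section \<open>Bounds in L^q\<close>

text \<open>\<open>lq M q f c\<close> says that f lies in L^q with norm at most c. Unlike \<open>lpnorm M q f \<le> c\<close> it is false
  for functions that are not integrable, for which lpnorm takes the junk value 0.\<close>

definition lq :: "'a measure \<Rightarrow> ereal \<Rightarrow> ('a \<Rightarrow> real) \<Rightarrow> real \<Rightarrow> bool" where
  "lq M q f c \<longleftrightarrow> f \<in> borel_measurable M \<and> 0 \<le> c \<and>
     (if q = \<infinity> then AE x in M. \<bar>f x\<bar> \<le> c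
      else integrable M (\<lambda>x. \<bar>f x\<bar> powr real_of_ereal q) \<and>
           (LINT x|M. \<bar>f x\<bar> powr real_of_ereal q) \<le> c powr real_of_ereal q)"

lemma one_le_real_of_ereal: "1 \<le> q \<Longrightarrow> q \<noteq> \<infinity> \<Longrightarrow> 1 \<le> real_of_ereal q"
  by (cases q) auto

text \<open>The critical case is q = \<infinity>. Infinite values of the essential supremum are sent
  to 0. A finite negative value r is impossible: it would force the space to be null, and then r - 1
  would be an essential bound too.\<close>

lemma lpnorm_nonneg: "0 \<le> lpnorm M q f"
proof (cases "q = \<infinity>")
  case True
  let ?e = "esssup M (\<lambda>x. ereal \<bar>f x\<bar>)"
  have "0 \<le> real_of_ereal ?e"
  proof (cases "?e")
    case (real r)
    show ?thesis
    proof (rule ccontr)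
      assume "\<not> ?thesis"
      then have r: "r < 0" using real by simp
      have meas: "(\<lambda>x. ereal \<bar>f x\<bar>) \<in> borel_measurable M"
        using real esssup_non_measurable[of "\<lambda>x. ereal \<bar>f x\<bar>" M] by (auto simp: top_ereal_def)
      have "AE x in M. ereal \<bar>f x\<bar> \<le> ?e" by (rule esssup_AE)
      then have "AE x in M. ereal \<bar>f x\<bar> \<le> ereal (r - 1)"
        unfolding real by (rule AE_mp) (use r in auto)
      then have "?e \<le> ereal (r - 1)" by (rule esssup_I[OF meas])
      then show False using real by simp
    qed
  qed auto
  then show ?thesis by (simp add: lpnorm_def True)
qed (simp add: lpnorm_def)

lemma lpnorm_le_of_lq:
  assumes q: "1 \<le> q" and lq: "lq M q f c"
  shows "lpnorm M q f \<le> c"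
proof (cases "q = \<infinity>")
  case True
  have [measurable]: "f \<in> borel_measurable M" and c: "0 \<le> c" and ae: "AE x in M. \<bar>f x\<bar> \<le> c"
    using lq by (auto simp: lq_def True)
  have "esssup M (\<lambda>x. ereal \<bar>f x\<bar>) \<le> ereal c" by (rule esssup_I) (use ae in auto)
  then have "real_of_ereal (esssup M (\<lambda>x. ereal \<bar>f x\<bar>)) \<le> c"
    using c by (cases "esssup M (\<lambda>x. ereal \<bar>f x\<bar>)") auto
  then show ?thesis by (simp add: lpnorm_def True)
next
  case False
  define p where "p = real_of_ereal q"
  have p: "1 \<le> p" using one_le_real_of_ereal[OF q False] by (simp add: p_def)
  have c: "0 \<le> c" and le: "(LINT x|M. \<bar>f x\<bar> powr p) \<le> c powr p"
    using lq by (auto simp: lq_def False p_def)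
  have "(LINT x|M. \<bar>f x\<bar> powr p) powr (1 / p) \<le> (c powr p) powr (1 / p)"
    using p le by (intro powr_mono2) (auto intro!: integral_nonneg_AE)
  also have "\<dots> = c" using p c by (simp add: powr_powr)
  finally show ?thesis by (simp add: lpnorm_def False p_def)
qed

lemma (in finite_measure) integrable_abs_powr:
  fixes f :: "'a \<Rightarrow> real"
  assumes [measurable]: "f \<in> borel_measurable M" and b: "AE x in M. \<bar>f x\<bar> \<le> b" and u: "0 \<le> u"
  shows "integrable M (\<lambda>x. \<bar>f x\<bar> powr u)"
proof (rule integrable_const_bound[where B = "b powr u"])
  show "AE x in M. norm (\<bar>f x\<bar> powr u) \<le> b powr u"
    using b by (rule AE_mp) (use u in \<open>auto intro!: powr_mono2\<close>)
qed simp

text \<open>The a.e. bound \<open>b\<close>, whose size does not enter the result, excludes the junk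
  value 0 that \<open>lpnorm\<close> takes for a divergent integral or an infinite essential
  supremum. It is needed to exploit \<open>K3\<close>, which speaks of
  \<open>lpnorm\<close>.\<close>

lemma lq_of_lpnorm_le:
  assumes "finite_measure M" and q: "1 \<le> q" and f[measurable]: "f \<in> borel_measurable M"
    and b: "AE x in M. \<bar>f x\<bar> \<le> b" and c: "0 \<le> c" and le: "lpnorm M q f \<le> c"
  shows "lq M q f c"
proof (cases "q = \<infinity>")
  case True
  interpret finite_measure M by fact
  let ?e = "esssup M (\<lambda>x. ereal \<bar>f x\<bar>)"
  have "?e \<le> ereal b" by (rule esssup_I) (use b in auto)
  then have "?e \<noteq> \<infinity>" by auto
  moreover have "real_of_ereal ?e \<le> c" using le by (simp add: lpnorm_def True)
  ultimately have ec: "?e \<le> ereal c" by (cases ?e) auto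
  have "AE x in M. ereal \<bar>f x\<bar> \<le> ?e" by (rule esssup_AE)
  then have "AE x in M. \<bar>f x\<bar> \<le> c" by (rule AE_mp) (intro AE_I2 impI, drule order_trans[OF _ ec], simp)
  then show ?thesis using c by (simp add: lq_def True)
next
  case False
  interpret finite_measure M by fact
  define p where "p = real_of_ereal q"
  have p: "1 \<le> p" using one_le_real_of_ereal[OF q False] by (simp add: p_def)
  have int: "integrable M (\<lambda>x. \<bar>f x\<bar> powr p)" using p by (intro integrable_abs_powr[OF f b]) simp
  let ?I = "LINT x|M. \<bar>f x\<bar> powr p"
  have I: "0 \<le> ?I" by (auto intro!: integral_nonneg_AE)
  have "?I powr (1 / p) \<le> c" using le by (simp add: lpnorm_def False p_def)
  then have "(?I powr (1 / p)) powr p \<le> c powr p" using p by (intro powr_mono2) auto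
  also have "(?I powr (1 / p)) powr p = ?I" using p I by (simp add: powr_powr)
  finally show ?thesis using int c f by (simp add: lq_def False p_def)
qed

lemma lq_mono: "1 \<le> q \<Longrightarrow> lq M q f c \<Longrightarrow> c \<le> c' \<Longrightarrow> lq M q f c'"
  using one_le_real_of_ereal[of q] powr_mono2[of "real_of_ereal q" c c']
  by (auto simp: lq_def split: if_splits)

lemma lq_dominated:
  assumes "1 \<le> q" "lq M q g c" and f[measurable]: "f \<in> borel_measurable M" and le: "AE x in M. \<bar>f x\<bar> \<le> \<bar>g x\<bar>"
  shows "lq M q f c"
proof (cases "q = \<infinity>")
  case True
  have "AE x in M. \<bar>f x\<bar> \<le> c" using le assms(2) by (auto simp: lq_def True)
  then show ?thesis using assms(2) by (auto simp: lq_def True)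
next
  case False
  define p where "p = real_of_ereal q"
  have p: "1 \<le> p" using one_le_real_of_ereal[OF assms(1) False] by (simp add: p_def)
  have [measurable]: "g \<in> borel_measurable M" and c: "0 \<le> c" and ig: "integrable M (\<lambda>x. \<bar>g x\<bar> powr p)"
    and leg: "(LINT x|M. \<bar>g x\<bar> powr p) \<le> c powr p"
    using assms(2) by (auto simp: lq_def False p_def)
  have ae: "AE x in M. \<bar>f x\<bar> powr p \<le> \<bar>g x\<bar> powr p"
    using le by (rule AE_mp) (use p in \<open>auto intro!: powr_mono2\<close>)
  have i: "integrable M (\<lambda>x. \<bar>f x\<bar> powr p)"
    by (rule Bochner_Integration.integrable_bound[OF ig]) (use ae in auto)
  have "(LINT x|M. \<bar>f x\<bar> powr p) \<le> (LINT x|M. \<bar>g x\<bar> powr p)"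
    by (rule integral_mono_AE[OF i ig ae])
  then show ?thesis using i c leg by (simp add: lq_def False p_def)
qed

text \<open>For finite q = p one has |u + v|^p <= 2^p (|u|^p + |v|^p), and a^p + b^p <= 2 (a + b)^p
  <= 2^p (a + b)^p. Together these give 4^p, a constant that does not depend on q and also covers q
  = \<infinity>.\<close>

lemma lq_add:
  assumes q: "1 \<le> q" and f: "lq M q f a" and g: "lq M q g b"
  shows "lq M q (\<lambda>x. f x + g x) (4 * (a + b))"
proof (cases "q = \<infinity>")
  case True
  have a: "0 \<le> a" "AE x in M. \<bar>f x\<bar> \<le> a" and b: "0 \<le> b" "AE x in M. \<bar>g x\<bar> \<le> b"
    using f g by (auto simp: lq_def True)
  have "AE x in M. \<bar>f x + g x\<bar> \<le> 4 * (a + b)"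
  proof -
    have bound: "\<bar>u + v\<bar> \<le> 4 * (a + b)" if "\<bar>u\<bar> \<le> a" "\<bar>v\<bar> \<le> b" for u v
    proof -
      have "\<bar>u + v\<bar> \<le> a + b" by (rule order_trans[OF abs_triangle_ineq add_mono[OF that]])
      also have "\<dots> \<le> 4 * (a + b)" using a(1) b(1) by simp
      finally show ?thesis .
    qed
    show ?thesis using a(2) b(2) by eventually_elim (rule bound)
  qed
  then show ?thesis using f g by (auto simp: lq_def True)
next
  case False
  define p where "p = real_of_ereal q"
  have p: "1 \<le> p" using one_le_real_of_ereal[OF q False] by (simp add: p_def)
  have [measurable]: "f \<in> borel_measurable M" "g \<in> borel_measurable M" and ab: "0 \<le> a" "0 \<le> b"
    and i: "integrable M (\<lambda>x. \<bar>f x\<bar> powr p)" "integrable M (\<lambda>x. \<bar>g x\<bar> powr p)"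
    and le: "(LINT x|M. \<bar>f x\<bar> powr p) \<le> a powr p" "(LINT x|M. \<bar>g x\<bar> powr p) \<le> b powr p"
    using f g by (auto simp: lq_def False p_def)
  have pw: "\<bar>u + v\<bar> powr p \<le> 2 powr p * (\<bar>u\<bar> powr p + \<bar>v\<bar> powr p)" for u v :: real
  proof -
    have "\<bar>u + v\<bar> powr p \<le> (2 * max \<bar>u\<bar> \<bar>v\<bar>) powr p" using p by (intro powr_mono2) auto
    also have "\<dots> = 2 powr p * (max \<bar>u\<bar> \<bar>v\<bar>) powr p" by (simp add: powr_mult)
    also have "(max \<bar>u\<bar> \<bar>v\<bar>) powr p \<le> \<bar>u\<bar> powr p + \<bar>v\<bar> powr p" by (auto simp: max_def)
    finally show ?thesis by simp
  qed
  have ir: "integrable M (\<lambda>x. 2 powr p * (\<bar>f x\<bar> powr p + \<bar>g x\<bar> powr p))" using i by simp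
  have il: "integrable M (\<lambda>x. \<bar>f x + g x\<bar> powr p)"
    by (rule Bochner_Integration.integrable_bound[OF ir]) (use pw in \<open>auto simp: abs_mult\<close>)
  have "(LINT x|M. \<bar>f x + g x\<bar> powr p) \<le> (LINT x|M. 2 powr p * (\<bar>f x\<bar> powr p + \<bar>g x\<bar> powr p))"
    by (rule integral_mono[OF il ir pw])
  also have "\<dots> = 2 powr p * ((LINT x|M. \<bar>f x\<bar> powr p) + (LINT x|M. \<bar>g x\<bar> powr p))" using i by simp
  also have "\<dots> \<le> 2 powr p * (a powr p + b powr p)" using le by (intro mult_left_mono add_mono) auto
  also have "\<dots> \<le> 2 powr p * ((a + b) powr p + (a + b) powr p)"
    using p ab by (intro mult_left_mono add_mono powr_mono2) auto
  also have "\<dots> \<le> 2 powr p * (2 powr p * (a + b) powr p)"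
  proof -
    have "2 \<le> (2::real) powr p" using powr_mono[of 1 p 2] p by simp
    then have "2 * (a + b) powr p \<le> 2 powr p * (a + b) powr p" by (intro mult_right_mono) auto
    then show ?thesis by simp
  qed
  also have "\<dots> = (4 * (a + b)) powr p"
    using ab by (simp add: powr_mult[symmetric])
  finally show ?thesis using il ab by (simp add: lq_def False p_def)
qed

text \<open>The factor 1 + |M| works for every q at once: being at least 1, its p-th power still
  exceeds the total mass |M|.\<close>

lemma lq_of_bounded:
  assumes "finite_measure M" and q: "1 \<le> q" and f[measurable]: "f \<in> borel_measurable M"
    and c: "0 \<le> c" and le: "AE x in M. \<bar>f x\<bar> \<le> c"
  shows "lq M q f (c * (1 + measure M (space M)))"
proof (cases "q = \<infinity>")
  case True
  interpret finite_measure M by fact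
  have "c \<le> c * (1 + measure M (space M))" using c by (simp add: algebra_simps)
  then show ?thesis using c le by (auto simp: lq_def True intro: order_trans)
next
  case False
  interpret finite_measure M by fact
  define p where "p = real_of_ereal q"
  have p: "1 \<le> p" using one_le_real_of_ereal[OF q False] by (simp add: p_def)
  let ?m = "measure M (space M)"
  have ae: "AE x in M. \<bar>f x\<bar> powr p \<le> c powr p"
    using le by (rule AE_mp) (use p in \<open>auto intro!: powr_mono2\<close>)
  have i: "integrable M (\<lambda>x. \<bar>f x\<bar> powr p)" using p by (intro integrable_abs_powr[OF f le]) simp
  have "(LINT x|M. \<bar>f x\<bar> powr p) \<le> (LINT x|M. c powr p)" by (rule integral_mono_AE[OF i _ ae]) simp
  also have "\<dots> = c powr p * ?m" by simp
  also have "\<dots> \<le> c powr p * (1 + ?m) powr p"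
    using powr_mono[of 1 p "1 + ?m"] p by (intro mult_left_mono) auto
  also have "\<dots> = (c * (1 + ?m)) powr p" using c by (simp add: powr_mult)
  finally show ?thesis using i c by (simp add: lq_def False p_def)
qed

text \<open>Pointwise |f|^q <= b^(q-p) |f|^p. It is used with p = 1 for the trimming bias and with p
  = 2 for the random deviation.\<close>

lemma lq_interpolate:
  assumes "finite_measure M" and q: "1 \<le> q" "q \<noteq> \<infinity>" and f[measurable]: "f \<in> borel_measurable M"
    and p: "0 < p" "p \<le> real_of_ereal q" and b: "0 \<le> b" "AE x in M. \<bar>f x\<bar> \<le> b"
    and s: "(LINT x|M. \<bar>f x\<bar> powr p) \<le> s"
    and c: "0 \<le> c" "b powr (real_of_ereal q - p) * s \<le> c powr real_of_ereal q"
  shows "lq M q f c"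
proof -
  interpret finite_measure M by fact
  define r where "r = real_of_ereal q"
  have pr: "p \<le> r" using p by (simp add: r_def)
  have i: "integrable M (\<lambda>x. \<bar>f x\<bar> powr u)" if "0 < u" for u
    using that by (intro integrable_abs_powr[OF f b(2)]) simp
  have ir: "integrable M (\<lambda>x. \<bar>f x\<bar> powr r)" using p pr by (intro i) auto
  have "(LINT x|M. \<bar>f x\<bar> powr r) \<le> (LINT x|M. b powr (r - p) * \<bar>f x\<bar> powr p)"
  proof (rule integral_mono_AE[OF ir])
    show "integrable M (\<lambda>x. b powr (r - p) * \<bar>f x\<bar> powr p)" using i[OF p(1)] by simp
    show "AE x in M. \<bar>f x\<bar> powr r \<le> b powr (r - p) * \<bar>f x\<bar> powr p"
    proof (rule AE_mp[OF b(2)], intro AE_I2 impI)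
      fix x assume "\<bar>f x\<bar> \<le> b"
      then have "\<bar>f x\<bar> powr (r - p) * \<bar>f x\<bar> powr p \<le> b powr (r - p) * \<bar>f x\<bar> powr p"
        using pr by (intro mult_right_mono powr_mono2) auto
      then show "\<bar>f x\<bar> powr r \<le> b powr (r - p) * \<bar>f x\<bar> powr p"
        by (simp add: powr_add[symmetric])
    qed
  qed
  also have "\<dots> = b powr (r - p) * (LINT x|M. \<bar>f x\<bar> powr p)" by simp
  also have "\<dots> \<le> b powr (r - p) * s" using s by (intro mult_left_mono) auto
  also have "\<dots> \<le> c powr r" using c by (simp add: r_def)
  finally show ?thesis using ir c q by (simp add: lq_def r_def)
qed

text \<open>In place of Hoelder, the values are split at the target size a: |u|^r <= a^r + a^(r-2)
  u^2, where the second term covers |u| > a because r <= 2.\<close>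

lemma lq_of_square:
  assumes "finite_measure M" and q: "1 \<le> q" "q \<le> 2" and f[measurable]: "f \<in> borel_measurable M"
    and b: "AE x in M. \<bar>f x\<bar> \<le> b"
    and s: "(LINT x|M. (f x)\<^sup>2) \<le> K * a\<^sup>2" and a: "0 < a" and K: "0 \<le> K"
  shows "lq M q f ((1 + measure M (space M) + K) * a)"
proof -
  interpret finite_measure M by fact
  have qi: "q \<noteq> \<infinity>" using q by auto
  define r where "r = real_of_ereal q"
  have r: "1 \<le> r" "r \<le> 2" using q qi by (cases q; auto simp: r_def)+
  have i: "integrable M (\<lambda>x. \<bar>f x\<bar> powr u)" if "0 < u" for u
    using that by (intro integrable_abs_powr[OF f b]) simp
  have i2: "integrable M (\<lambda>x. (f x)\<^sup>2)" using i[of 2] by simp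
  have ir: "integrable M (\<lambda>x. \<bar>f x\<bar> powr r)" using r by (intro i) auto
  let ?m = "measure M (space M)"
  have pw: "\<bar>u\<bar> powr r \<le> a powr r + a powr (r - 2) * u\<^sup>2" for u
  proof (cases "\<bar>u\<bar> \<le> a")
    case True
    then have "\<bar>u\<bar> powr r \<le> a powr r" using r by (intro powr_mono2) auto
    then show ?thesis by (simp add: add_increasing2)
  next
    case False
    have "\<bar>u\<bar> powr r = \<bar>u\<bar> powr (r - 2) * \<bar>u\<bar> powr 2" using powr_add[of "\<bar>u\<bar>" "r - 2" 2] by simp
    also have "\<dots> \<le> a powr (r - 2) * \<bar>u\<bar> powr 2"
      using False r a by (intro mult_right_mono powr_mono2') auto
    finally show ?thesis by (simp add: add_increasing)
  qed
  have "(LINT x|M. \<bar>f x\<bar> powr r) \<le> (LINT x|M. a powr r + a powr (r - 2) * (f x)\<^sup>2)"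
    using i2 by (intro integral_mono[OF ir _ pw]) auto
  also have "\<dots> = a powr r * ?m + a powr (r - 2) * (LINT x|M. (f x)\<^sup>2)" using i2 by simp
  also have "\<dots> \<le> a powr r * ?m + a powr (r - 2) * (K * a\<^sup>2)" using s by (intro add_left_mono mult_left_mono) auto
  also have "a powr (r - 2) * (K * a\<^sup>2) = K * (a powr (r - 2) * a powr 2)" using a by simp
  also have "\<dots> = K * a powr r" by (simp add: powr_add[symmetric])
  also have "a powr r * ?m + K * a powr r \<le> (1 + ?m + K) * a powr r" by (simp add: algebra_simps)
  also have "\<dots> \<le> (1 + ?m + K) powr r * a powr r"
    using powr_mono[of 1 r "1 + ?m + K"] r K by (intro mult_right_mono) auto
  also have "\<dots> = ((1 + ?m + K) * a) powr r" using a K by (simp add: powr_mult)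
  finally show ?thesis using ir a K qi by (simp add: lq_def r_def)
qed

lemma lq_sphere_uminus:
  fixes f :: "real^'d \<Rightarrow> real"
  assumes "lq sphere_measure q f c"
  shows "lq sphere_measure q (\<lambda>x. f (- x)) c"
proof -
  have f[measurable]: "f \<in> borel_measurable sphere_measure" using assms by (simp add: lq_def)
  have fm: "(\<lambda>x. f (- x)) \<in> borel_measurable sphere_measure"
    by (rule measurable_compose[OF sphere_measure_measurable_uminus f])
  show ?thesis
  proof (cases "q = \<infinity>")
    case True
    then show ?thesis using assms fm AE_sphere_uminus[of "\<lambda>x. \<bar>f x\<bar> \<le> c"] by (simp add: lq_def)
  next
    case False
    let ?h = "\<lambda>x. \<bar>f x\<bar> powr real_of_ereal q"
    have h: "integrable sphere_measure ?h" using assms False by (simp add: lq_def)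
    have "integrable (distr sphere_measure sphere_measure uminus) ?h" using h by (simp add: sphere_measure_distr_uminus)
    then have "integrable sphere_measure (\<lambda>x. ?h (- x))" by (subst (asm) integrable_distr_eq) auto
    moreover have "(LINT x|sphere_measure. ?h (- x)) = (LINT x|sphere_measure. ?h x)"
      by (rule sphere_integral_uminus) simp
    ultimately show ?thesis using assms fm False by (simp add: lq_def)
  qed
qed

section \<open>Empirical means over the sphere\<close>

context prob_space begin

text \<open>A union bound over the net controls the net points. Away from them the empirical mean
  and its expectation each move by at most L times the mesh, hence the factor 2. The exceptional set
  is a finite union over the net, so no measurability of a supremum over the sphere is
  involved.\<close>

lemma uniform_deviation:
  fixes G :: "'b::topological_space \<Rightarrow> real^'d \<Rightarrow> real"
  assumes indW: "indep_vars (\<lambda>_. borel) W UNIV"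
    and meas: "\<And>x. (\<lambda>d. G d x) \<in> borel_measurable borel"
    and bnd: "\<And>d x. \<bar>G d x\<bar> \<le> V"
    and mean: "\<And>i x. x \<in> sphere 0 1 \<Longrightarrow> expectation (\<lambda>w. G (W i w) x) = m x"
    and sq: "\<And>i x. x \<in> sphere 0 1 \<Longrightarrow> expectation (\<lambda>w. (G (W i w) x)\<^sup>2) \<le> V"
    and Lip: "\<And>d x y. x \<in> sphere 0 1 \<Longrightarrow> y \<in> sphere 0 1 \<Longrightarrow> \<bar>G d x - G d y\<bar> \<le> L * norm (x - y)"
    and V: "0 < V" and t: "0 \<le> t" "t \<le> 2" and N: "0 < N" and n: "0 < n" and L: "0 \<le> L"
  shows "\<exists>A\<in>events. prob A \<le> real ((2 * n + 1) ^ CARD('d)) * (2 * exp (- (real N * t\<^sup>2 / (4 * V)))) \<and>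
    (\<forall>w\<in>space M - A. \<forall>x\<in>sphere 0 1.
       \<bar>1 / real N * (\<Sum>i<N. G (W i w) x) - m x\<bar> \<le> t + 2 * L * (real CARD('d) / real n))"
proof -
  have W[measurable]: "W i \<in> borel_measurable M" for i using indW by (auto simp: indep_vars_def)
  have GW[measurable]: "(\<lambda>w. G (W i w) x) \<in> borel_measurable M" for i x
    by (rule measurable_compose[OF W meas])
  have iG: "integrable M (\<lambda>w. G (W i w) x)" for i x
    by (rule integrable_const_bound[where B = V]) (use bnd in auto)
  obtain F :: "(real^'d) set" where F: "finite F" "F \<subseteq> sphere 0 1" "card F \<le> (2 * n + 1) ^ CARD('d)"
    "\<And>x. x \<in> sphere 0 1 \<Longrightarrow> \<exists>y\<in>F. norm (x - y) \<le> real CARD('d) / real n"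
    using sphere_finite_net[OF n] by metis
  define D where "D x = {w \<in> space M. \<bar>1 / real N * (\<Sum>i<N. G (W i w) x) - m x\<bar> \<ge> t}" for x
  have D[measurable]: "D x \<in> events" for x unfolding D_def by measurable
  have PD: "prob (D x) \<le> 2 * exp (- (real N * t\<^sup>2 / (4 * V)))" if "x \<in> F" for x
    unfolding D_def
  proof (rule Chernoff_mean_abs_ge)
    show "indep_vars (\<lambda>_. borel) (\<lambda>i w. G (W i w) x) UNIV"
      by (rule indep_vars_compose2[where Y = "\<lambda>_ d. G d x", OF indW]) (rule meas)
  qed (use that F bnd mean sq V t N in auto)
  define A where "A = (\<Union>x\<in>F. D x)"
  have "prob A \<le> (\<Sum>x\<in>F. prob (D x))"
    unfolding A_def by (rule finite_measure_subadditive_finite) (use F in auto)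
  also have "\<dots> \<le> real (card F) * (2 * exp (- (real N * t\<^sup>2 / (4 * V))))"
    by (rule sum_bounded_above[OF PD])
  also have "\<dots> \<le> real ((2 * n + 1) ^ CARD('d)) * (2 * exp (- (real N * t\<^sup>2 / (4 * V))))"
    using of_nat_mono[OF F(3)] by (intro mult_right_mono) (assumption, simp)
  finally have PA: "prob A \<le> real ((2 * n + 1) ^ CARD('d)) * (2 * exp (- (real N * t\<^sup>2 / (4 * V))))" .
  have "\<bar>1 / real N * (\<Sum>i<N. G (W i w) x) - m x\<bar> \<le> t + 2 * L * (real CARD('d) / real n)"
    if d: "w \<in> space M - A" and x: "x \<in> sphere 0 1" for w x
  proof -
    obtain y where y: "y \<in> F" "norm (x - y) \<le> real CARD('d) / real n" using F(4)[OF x] by blast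
    have ys: "y \<in> sphere 0 1" using y F by auto
    let ?e = "L * (real CARD('d) / real n)"
    have Lip': "\<bar>G d x - G d y\<bar> \<le> ?e" for d
      using Lip[OF x ys, of d] mult_left_mono[OF y(2) L] by linarith
    have 1: "\<bar>1 / real N * (\<Sum>i<N. G (W i w) x) - 1 / real N * (\<Sum>i<N. G (W i w) y)\<bar> \<le> ?e"
    proof -
      have "\<bar>(\<Sum>i<N. G (W i w) x - G (W i w) y)\<bar> \<le> (\<Sum>i<N. ?e)"
        by (rule order_trans[OF sum_abs sum_mono]) (rule Lip')
      then have "\<bar>(\<Sum>i<N. G (W i w) x) - (\<Sum>i<N. G (W i w) y)\<bar> \<le> real N * ?e"
        by (simp add: sum_subtractf)
      then show ?thesis using N
        by (simp add: right_diff_distrib[symmetric] diff_divide_distrib[symmetric] abs_divide field_simps)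
    qed
    have 2: "\<bar>m x - m y\<bar> \<le> ?e"
    proof -
      have "\<bar>m x - m y\<bar> = \<bar>expectation (\<lambda>w. G (W 0 w) x - G (W 0 w) y)\<bar>"
        using mean[OF x, of 0] mean[OF ys, of 0] iG[of 0 x] iG[of 0 y] by simp
      also have "\<dots> \<le> expectation (\<lambda>w. \<bar>G (W 0 w) x - G (W 0 w) y\<bar>)" by (rule integral_abs_bound)
      also have "\<dots> \<le> expectation (\<lambda>w. ?e)"
        using iG by (intro integral_mono Lip') auto
      finally show ?thesis by (simp add: prob_space)
    qed
    have 3: "\<bar>1 / real N * (\<Sum>i<N. G (W i w) y) - m y\<bar> < t"
      using d y by (auto simp: A_def D_def)
    show ?thesis using 1 2 3 by linarith
  qed
  then show ?thesis using PA by (intro bexI[of _ A]) (auto simp: A_def F(1))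
qed

text \<open>By Fubini the expected integral of the squared deviation is the integral of pointwise
  second moments, each at most V / N; Markov's inequality follows. Unlike the union bound, this
  costs no logarithm.\<close>

lemma integrated_square_deviation:
  fixes G :: "'b::topological_space \<Rightarrow> real^'d \<Rightarrow> real"
  assumes indW: "indep_vars (\<lambda>_. borel) W UNIV"
    and meas: "(\<lambda>(d, x). G d x) \<in> borel_measurable (borel \<Otimes>\<^sub>M borel)"
    and bnd: "\<And>d x. \<bar>G d x\<bar> \<le> V"
    and mean: "\<And>i x. x \<in> sphere 0 1 \<Longrightarrow> expectation (\<lambda>w. G (W i w) x) = m x"
    and sq: "\<And>i x. x \<in> sphere 0 1 \<Longrightarrow> expectation (\<lambda>w. (G (W i w) x)\<^sup>2) \<le> V"
    and N: "0 < N" and c: "0 < c"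
  shows "\<exists>A\<in>events. prob A \<le> measure (sphere_measure :: (real^'d) measure) (sphere 0 1) * (V / real N) / c \<and>
    (\<forall>w\<in>space M - A. (LINT x|sphere_measure. (1 / real N * (\<Sum>i<N. G (W i w) x) - m x)\<^sup>2) \<le> c)"
proof -
  let ?S = "sphere_measure :: (real^'d) measure"
  interpret S: finite_measure ?S by (rule finite_sphere_measure)
  interpret MS: pair_sigma_finite M ?S ..
  interpret MSf: finite_measure "M \<Otimes>\<^sub>M ?S"
    by (rule finite_measure_pair_measure) (unfold_locales)
  have V: "0 \<le> V" using bnd[of undefined 0] by linarith
  have W[measurable]: "W i \<in> borel_measurable M" for i using indW by (auto simp: indep_vars_def)
  have id[measurable]: "(\<lambda>x. x) \<in> measurable ?S borel" by simp
  have GW[measurable]: "(\<lambda>p. G (W i (fst p)) (snd p)) \<in> borel_measurable (M \<Otimes>\<^sub>M ?S)" for i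
  proof -
    have "(\<lambda>p. (W i (fst p), snd p)) \<in> measurable (M \<Otimes>\<^sub>M ?S) (borel \<Otimes>\<^sub>M borel)"
      by (intro measurable_Pair measurable_compose[OF measurable_fst W] measurable_compose[OF measurable_snd id])
    from measurable_compose[OF this meas] show ?thesis by simp
  qed
  have GWx: "(\<lambda>w. G (W i w) x) \<in> borel_measurable M" if "x \<in> sphere 0 1" for i x
    using measurable_compose[OF measurable_Pair2'[of x ?S M] GW[of i]] that by simp
  have meas_x: "(\<lambda>d. G d x) \<in> borel_measurable borel" for x
    using measurable_compose[OF measurable_Pair2'[of x borel borel] meas] by simp
  have iG: "integrable M (\<lambda>w. G (W i w) x)" if "x \<in> sphere 0 1" for i x
    by (rule integrable_const_bound[where B = V]) (use bnd GWx[OF that] in auto)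
  have m_bnd: "\<bar>m x\<bar> \<le> V" if x: "x \<in> sphere 0 1" for x
  proof -
    have "\<bar>m x\<bar> \<le> expectation (\<lambda>w. \<bar>G (W 0 w) x\<bar>)" unfolding mean[OF x, of 0, symmetric] by (rule integral_abs_bound)
    also have "\<dots> \<le> expectation (\<lambda>w. V)" using iG[OF x] bnd by (intro integral_mono) auto
    finally show ?thesis by (simp add: prob_space)
  qed
  have m_meas: "m \<in> borel_measurable ?S"
  proof -
    have "(\<lambda>x. \<integral>w. G (W 0 w) x \<partial>M) \<in> borel_measurable ?S"
      using GW[of 0] by (intro borel_measurable_lebesgue_integral)
         (auto simp: case_prod_beta' intro!: measurable_compose[OF measurable_pair_swap' GW[of 0], simplified case_prod_beta', simplified])
    then show ?thesis by (subst measurable_cong[where g = "\<lambda>x. \<integral>w. G (W 0 w) x \<partial>M"]) (auto simp: mean)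
  qed
  define f where "f w x = (1 / real N * (\<Sum>i<N. G (W i w) x) - m x)\<^sup>2" for w x
  have f_meas: "(\<lambda>p. f (fst p) (snd p)) \<in> borel_measurable (M \<Otimes>\<^sub>M ?S)"
    unfolding f_def using measurable_compose[OF measurable_snd m_meas]
    by (intro borel_measurable_power borel_measurable_diff borel_measurable_times borel_measurable_sum GW) auto
  \<comment> \<open>A crude bound that serves only integrability on the product space.\<close>
  have f_bnd: "\<bar>f w x\<bar> \<le> (2 * V)\<^sup>2" if x: "x \<in> sphere 0 1" for w x
  proof -
    have "\<bar>\<Sum>i<N. G (W i w) x\<bar> \<le> (\<Sum>i<N. V)" by (rule order_trans[OF sum_abs sum_mono]) (rule bnd)
    then have "\<bar>1 / real N * (\<Sum>i<N. G (W i w) x)\<bar> \<le> V" using N by (simp add: field_simps)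
    then have "\<bar>1 / real N * (\<Sum>i<N. G (W i w) x) - m x\<bar> \<le> \<bar>2 * V\<bar>" using m_bnd[OF x] by linarith
    then have "(1 / real N * (\<Sum>i<N. G (W i w) x) - m x)\<^sup>2 \<le> (2 * V)\<^sup>2" by (simp only: abs_le_square_iff)
    then show ?thesis unfolding f_def by simp
  qed
  have f_int: "integrable (M \<Otimes>\<^sub>M ?S) (\<lambda>(w, x). f w x)"
    using f_meas
    by (intro MSf.integrable_const_bound[where B = "(2 * V)\<^sup>2"])
       (auto simp: case_prod_beta' space_pair_measure intro!: AE_I2 f_bnd[simplified])
  define h where "h w = (LINT x|?S. f w x)" for w
  have h_int: "integrable M h" unfolding h_def by (rule MS.integrable_fst[OF f_int])
  have "expectation h = (LINT x|?S. expectation (\<lambda>w. f w x))"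
    unfolding h_def by (rule MS.Fubini_integral[OF f_int, symmetric])
  also have "\<dots> \<le> (LINT x|?S. V / real N)"
  proof (rule integral_mono)
    show "integrable ?S (\<lambda>x. expectation (\<lambda>w. f w x))" by (rule MS.integrable_snd[OF f_int])
    fix x :: "real^'d" assume "x \<in> space ?S"
    then have x: "x \<in> sphere 0 1" by simp
    show "expectation (\<lambda>w. f w x) \<le> V / real N"
      unfolding f_def
    proof (rule second_moment_mean_le)
      show "indep_vars (\<lambda>_. borel) (\<lambda>i w. G (W i w) x) UNIV"
        by (rule indep_vars_compose2[where Y = "\<lambda>_ d. G d x", OF indW]) (rule meas_x)
    qed (use x bnd mean sq N in auto)
  qed simp
  also have "\<dots> = measure ?S (sphere 0 1) * (V / real N)" by simp
  finally have Eh: "expectation h \<le> measure ?S (sphere 0 1) * (V / real N)" .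
  have "prob {w \<in> space M. h w \<ge> c} \<le> expectation h / c"
    by (rule integral_Markov_inequality_measure[OF h_int sets.top]) (auto simp: h_def f_def c intro!: AE_I2 integral_nonneg_AE)
  also have "\<dots> \<le> measure ?S (sphere 0 1) * (V / real N) / c"
    using Eh c by (intro divide_right_mono) auto
  finally have P: "prob {w \<in> space M. h w \<ge> c} \<le> measure ?S (sphere 0 1) * (V / real N) / c" .
  show ?thesis
  proof (rule bexI[of _ "{w \<in> space M. h w \<ge> c}"])
    have [measurable]: "h \<in> borel_measurable M" using h_int by auto
    show "{w \<in> space M. h w \<ge> c} \<in> events" by measurable
    show "prob {w \<in> space M. h w \<ge> c} \<le> measure ?S (sphere 0 1) * (V / real N) / c \<and>
      (\<forall>w\<in>space M - {w \<in> space M. h w \<ge> c}. (LINT x|?S. (1 / real N * (\<Sum>i<N. G (W i w) x) - m x)\<^sup>2) \<le> c)"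
      using P by (auto simp: h_def f_def)
  qed
qed

end

section \<open>The regression model\<close>

locale sphere_model = prob_space P for P :: "'w measure" +
  fixes X \<beta> :: "'w \<Rightarrow> real^'d" and fX r :: "real^'d \<Rightarrow> real" and e1 :: 'd
    and yx :: "nat \<Rightarrow> 'w \<Rightarrow> real \<times> (real^'d)"
  assumes dim: "2 \<le> CARD('d)"
    and beta_meas: "\<beta> \<in> measurable P sphere_measure"
    and X_dens: "distributed P sphere_measure X (\<lambda>x. ennreal (fX x))"
    and fX_nonneg: "\<And>x. x \<in> sphere 0 1 \<Longrightarrow> 0 \<le> fX x"
    and fX_pos: "AE x in sphere_measure. 0 \<le> x $ e1 \<longrightarrow> 0 < fX x"
    and fX_zero: "\<And>x. x \<in> sphere 0 1 \<Longrightarrow> x $ e1 < 0 \<Longrightarrow> fX x = 0"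
    and r_meas: "r \<in> borel_measurable borel"
    and r_int: "integrable P (\<lambda>w. r (X w))"
    and r_cond: "\<And>A. A \<in> sets borel \<Longrightarrow> measure P {w\<in>space P. 0 \<le> X w \<bullet> \<beta> w \<and> X w \<in> A}
                   = (\<integral>w. r (X w) * indicator A (X w) \<partial>P)"
    and data_indep: "indep_vars (\<lambda>_. borel) yx UNIV"
    and data_distr: "\<And>i. distr P borel (yx i)
                   = distr P borel (\<lambda>w. (if 0 \<le> X w \<bullet> \<beta> w then 1 else 0, X w))"
begin

abbreviation S where "S \<equiv> (sphere_measure :: (real^'d) measure)"

sublocale S: finite_measure S by (rule finite_sphere_measure)

declare r_meas [measurable]

lemma X_sphere_measurable: "X \<in> measurable P S"
  using X_dens by (simp add: distributed_def)

lemma X_measurable [measurable]: "X \<in> borel_measurable P"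
  by (rule borel_measurable_of_sphere_measure[OF X_sphere_measurable])

lemma beta_measurable [measurable]: "\<beta> \<in> borel_measurable P"
  by (rule borel_measurable_of_sphere_measure[OF beta_meas])

lemma X_in_sphere: "w \<in> space P \<Longrightarrow> X w \<in> sphere 0 1"
  using measurable_space[OF X_sphere_measurable] by simp

lemma yx_measurable [measurable]: "yx i \<in> borel_measurable P"
  using data_indep by (auto simp: indep_vars_def)

text \<open>Off the sphere nothing is known about \<open>fX\<close>. Extension by zero gives a
  function that is Borel measurable and nonnegative on the whole space.\<close>

definition dens :: "real^'d \<Rightarrow> real" where
  "dens x = indicator (sphere 0 1) x * fX x"

lemma dens_eq: "x \<in> sphere 0 1 \<Longrightarrow> dens x = fX x"
  by (simp add: dens_def)

lemma dens_nonneg: "0 \<le> dens x"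
  using fX_nonneg[of x] by (auto simp: dens_def indicator_def)

lemma fX_measurable_sphere: "fX \<in> borel_measurable S"
proof -
  have "(\<lambda>x. ennreal (fX x)) \<in> borel_measurable S"
    using X_dens by (simp add: distributed_def)
  then have "(\<lambda>x. enn2real (ennreal (fX x))) \<in> borel_measurable S" by measurable
  then show ?thesis
    by (subst measurable_cong[where g = "\<lambda>x. enn2real (ennreal (fX x))"]) (auto simp: fX_nonneg)
qed

lemma dens_measurable [measurable]: "dens \<in> borel_measurable borel"
proof -
  have "fX \<in> borel_measurable (restrict_space borel (sphere 0 1))"
    using fX_measurable_sphere unfolding measurable_cong_sets[OF sets_sphere_measure refl] .
  then have "(\<lambda>x. indicator (sphere 0 1) x *\<^sub>R fX x) \<in> borel_measurable borel"
    by (subst (asm) borel_measurable_restrict_space_iff) auto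
  then show ?thesis unfolding dens_def[abs_def] by simp
qed

lemma expectation_X:
  assumes [measurable]: "h \<in> borel_measurable borel"
  shows "expectation (\<lambda>w. h (X w)) = (LINT x|S. dens x * h x)"
proof -
  have "(LINT x|S. fX x * h x) = expectation (\<lambda>w. h (X w))"
    by (rule distributed_integral[OF X_dens]) (auto simp: fX_nonneg)
  moreover have "(LINT x|S. fX x * h x) = (LINT x|S. dens x * h x)"
    by (rule Bochner_Integration.integral_cong) (auto simp: dens_eq)
  ultimately show ?thesis by simp
qed

text \<open>By \<open>r_cond\<close> the integral of r over {X in A} is the probability of a
  subevent of {X in A}, hence lies between 0 and P(X in A). Taking A = {r < 0} and A = {r > 1}
  contradicts this unless A is hit with probability zero.\<close>

lemma r_X_bounds: "AE w in P. 0 \<le> r (X w) \<and> r (X w) \<le> 1"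
proof -
  have iA: "integrable P (\<lambda>w. r (X w) * indicator A (X w))" if "A \<in> sets borel" for A
    by (rule Bochner_Integration.integrable_bound[OF r_int]) (use that in \<open>auto simp: indicator_def\<close>)
  have neg: "AE w in P. 0 \<le> r (X w)"
  proof -
    define A where "A = {x. r x < 0}"
    have A[measurable]: "A \<in> sets borel" unfolding A_def by measurable
    let ?h = "\<lambda>w. - (r (X w) * indicator A (X w))"
    have h0: "0 \<le> ?h w" for w by (auto simp: A_def indicator_def)
    have "0 \<le> expectation (\<lambda>w. r (X w) * indicator A (X w))"
      unfolding r_cond[OF A, symmetric] by simp
    moreover have "0 \<le> expectation ?h" using h0 by (intro integral_nonneg_AE AE_I2)
    ultimately have "expectation ?h = 0" by simp
    then have "AE w in P. ?h w = 0"
      using integral_nonneg_eq_0_iff_AE[of P ?h] iA[OF A] h0 by auto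
    then show ?thesis by eventually_elim (auto simp: A_def indicator_def split: if_splits)
  qed
  have "AE w in P. r (X w) \<le> 1"
  proof -
    define A where "A = {x. r x > 1}"
    have A[measurable]: "A \<in> sets borel" unfolding A_def by measurable
    let ?h = "\<lambda>w. r (X w) * indicator A (X w) - indicator A (X w)"
    have h0: "0 \<le> ?h w" for w by (auto simp: A_def indicator_def)
    have iI: "integrable P (\<lambda>w. indicator A (X w) :: real)"
      by (rule integrable_const_bound[where B = 1]) (auto simp: indicator_def)
    have "expectation (\<lambda>w. r (X w) * indicator A (X w)) \<le> measure P {w \<in> space P. X w \<in> A}"
      unfolding r_cond[OF A, symmetric] by (intro finite_measure_mono) auto
    also have "\<dots> = expectation (indicator {w \<in> space P. X w \<in> A})" by simp
    also have "\<dots> = expectation (\<lambda>w. indicator A (X w))"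
      by (rule Bochner_Integration.integral_cong) (auto simp: indicator_def)
    finally have "expectation ?h \<le> 0" using iA[OF A] iI by simp
    moreover have "0 \<le> expectation ?h" using h0 by (intro integral_nonneg_AE AE_I2)
    ultimately have "expectation ?h = 0" by simp
    then have "AE w in P. ?h w = 0"
      using integral_nonneg_eq_0_iff_AE[of P ?h] iA[OF A] iI h0 by auto
    then show ?thesis by eventually_elim (auto simp: A_def indicator_def split: if_splits)
  qed
  with neg show ?thesis by eventually_elim simp
qed

text \<open>Positivity of \<open>fX\<close> on the upper half sphere turns statements about almost
  every value of X into statements about sigma-almost every point there.\<close>

lemma r_bounds: "AE x in S. 0 \<le> x $ e1 \<longrightarrow> 0 \<le> r x \<and> r x \<le> 1"
proof -
  have "AE x in S. 0 < ennreal (fX x) \<longrightarrow> 0 \<le> r x \<and> r x \<le> 1"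
    using r_X_bounds by (subst (asm) distributed_AE2[OF X_dens]) auto
  with fX_pos show ?thesis by eventually_elim (auto simp: ennreal_less_zero_iff)
qed

text \<open>\<open>r_cond\<close> says that the densities 1{X'beta >= 0} and r(X), pushed forward by
  X, give the same measure; integrals of any h against it then coincide.\<close>

lemma expectation_event_X:
  assumes h[measurable]: "h \<in> borel_measurable borel"
  shows "expectation (\<lambda>w. (if 0 \<le> X w \<bullet> \<beta> w then 1 else 0) * h (X w)) = expectation (\<lambda>w. r (X w) * h (X w))"
proof -
  define B where "B w = (if 0 \<le> X w \<bullet> \<beta> w then 1 else 0 :: real)" for w
  have [measurable]: "B \<in> borel_measurable P" unfolding B_def[abs_def] by measurable
  let ?M1 = "distr (density P (\<lambda>w. ennreal (B w))) borel X"
  let ?M2 = "distr (density P (\<lambda>w. ennreal (r (X w)))) borel X"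
  have "?M1 = ?M2"
  proof (rule measure_eqI)
    fix A assume "A \<in> sets ?M1"
    then have A[measurable]: "A \<in> sets borel" by simp
    have "emeasure ?M1 A = (\<integral>\<^sup>+w. ennreal (B w) * indicator (X -` A \<inter> space P) w \<partial>P)"
      by (simp add: emeasure_distr emeasure_density)
    also have "\<dots> = (\<integral>\<^sup>+w. indicator {w\<in>space P. 0 \<le> X w \<bullet> \<beta> w \<and> X w \<in> A} w \<partial>P)"
      by (rule nn_integral_cong) (auto simp: B_def indicator_def)
    also have "\<dots> = ennreal (measure P {w\<in>space P. 0 \<le> X w \<bullet> \<beta> w \<and> X w \<in> A})"
      by (simp add: emeasure_eq_measure)
    also have "\<dots> = ennreal (\<integral>w. r (X w) * indicator A (X w) \<partial>P)" by (simp add: r_cond)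
    also have "\<dots> = (\<integral>\<^sup>+w. ennreal (r (X w) * indicator A (X w)) \<partial>P)"
    proof (rule nn_integral_eq_integral[symmetric])
      show "integrable P (\<lambda>w. r (X w) * indicator A (X w))"
        by (rule Bochner_Integration.integrable_bound[OF r_int]) (auto simp: indicator_def)
      show "AE w in P. 0 \<le> r (X w) * indicator A (X w)"
        using r_X_bounds by eventually_elim auto
    qed
    also have "\<dots> = (\<integral>\<^sup>+w. ennreal (r (X w)) * indicator (X -` A \<inter> space P) w \<partial>P)"
      by (rule nn_integral_cong) (auto simp: indicator_def)
    also have "\<dots> = emeasure ?M2 A" by (simp add: emeasure_distr emeasure_density)
    finally show "emeasure ?M1 A = emeasure ?M2 A" .
  qed simp
  then have "(\<integral>x. h x \<partial>?M1) = (\<integral>x. h x \<partial>?M2)" by simp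
  moreover have "(\<integral>x. h x \<partial>?M1) = (\<integral>w. B w * h (X w) \<partial>P)"
    by (subst integral_distr) (auto simp: integral_density B_def)
  moreover have "(\<integral>x. h x \<partial>?M2) = (\<integral>w. r (X w) * h (X w) \<partial>P)"
    using r_X_bounds by (subst integral_distr) (auto simp: integral_density)
  ultimately show ?thesis by (simp add: B_def)
qed

lemma fst_borel_measurable [measurable]: "fst \<in> measurable (borel :: (real \<times> (real^'d)) measure) borel"
  and snd_borel_measurable [measurable]: "snd \<in> measurable (borel :: (real \<times> (real^'d)) measure) borel"
  by (intro borel_measurable_continuous_onI continuous_intros)+

lemma label_pair_measurable [measurable]:
  "(\<lambda>w. (if 0 \<le> X w \<bullet> \<beta> w then 1 else 0 :: real, X w)) \<in> borel_measurable P"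
  unfolding borel_prod[symmetric] by measurable

text \<open>The sign 2y - 1 of a data point, cut off outside the almost sure range of the data so that
  bounds on summands hold everywhere.\<close>

definition data_sign :: "real \<times> (real^'d) \<Rightarrow> real" where
  "data_sign d = (if snd d \<in> sphere 0 1 then if fst d = 0 then -1 else 1 else 0)"

lemma data_sign_measurable [measurable]: "data_sign \<in> borel_measurable borel"
  unfolding data_sign_def[abs_def] mem_sphere_0 by measurable

lemma abs_data_sign_le: "\<bar>data_sign d\<bar> \<le> 1"
  by (simp add: data_sign_def)

lemma expectation_data:
  fixes h :: "real \<times> (real^'d) \<Rightarrow> real"
  assumes [measurable]: "h \<in> borel_measurable borel"
  shows "expectation (\<lambda>w. h (yx i w)) = expectation (\<lambda>w. h (if 0 \<le> X w \<bullet> \<beta> w then 1 else 0, X w))"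
proof -
  have "expectation (\<lambda>w. h (yx i w)) = (\<integral>d. h d \<partial>distr P borel (yx i))"
    by (rule integral_distr[symmetric]) auto
  also have "\<dots> = expectation (\<lambda>w. h (if 0 \<le> X w \<bullet> \<beta> w then 1 else 0, X w))"
    unfolding data_distr by (rule integral_distr) measurable
  finally show ?thesis .
qed

text \<open>Given X, the sign 2Y - 1 has mean 2 r(X) - 1. The cutoff in \<open>data_sign\<close> is
  invisible here since X takes values on the sphere.\<close>

lemma expectation_signed:
  assumes h[measurable]: "h \<in> borel_measurable borel" and bnd: "\<And>x. \<bar>h x\<bar> \<le> b"
  shows "expectation (\<lambda>w. data_sign (yx i w) * h (snd (yx i w))) = (LINT x|S. dens x * ((2 * r x - 1) * h x))"
proof -
  let ?B = "\<lambda>w. if 0 \<le> X w \<bullet> \<beta> w then 1 else 0 :: real"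
  have ih: "integrable P (\<lambda>w. h (X w))" by (rule integrable_const_bound[where B = b]) (use bnd in auto)
  have irh: "integrable P (\<lambda>w. r (X w) * h (X w))"
  proof (rule integrable_const_bound[where B = b])
    show "AE w in P. norm (r (X w) * h (X w)) \<le> b"
      using r_X_bounds
    proof eventually_elim
      case (elim w)
      then have "\<bar>r (X w)\<bar> * \<bar>h (X w)\<bar> \<le> 1 * b" by (intro mult_mono bnd) auto
      then show ?case by (simp add: abs_mult)
    qed
  qed auto
  have iBh: "integrable P (\<lambda>w. ?B w * h (X w))"
    by (rule Bochner_Integration.integrable_bound[OF ih]) (auto)
  have "expectation (\<lambda>w. data_sign (yx i w) * h (snd (yx i w)))
      = expectation (\<lambda>w. data_sign (?B w, X w) * h (X w))"
    using expectation_data[of "\<lambda>d. data_sign d * h (snd d)" i] by simp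
  also have "\<dots> = expectation (\<lambda>w. 2 * (?B w * h (X w)) - h (X w))"
    by (rule Bochner_Integration.integral_cong) (auto simp: data_sign_def X_in_sphere dest: X_in_sphere)
  also have "\<dots> = 2 * expectation (\<lambda>w. ?B w * h (X w)) - expectation (\<lambda>w. h (X w))"
    using iBh ih by simp
  also have "\<dots> = 2 * expectation (\<lambda>w. r (X w) * h (X w)) - expectation (\<lambda>w. h (X w))"
    unfolding expectation_event_X[OF h] ..
  also have "\<dots> = expectation (\<lambda>w. (2 * r (X w) - 1) * h (X w))"
    using irh ih by (simp add: left_diff_distrib mult.assoc)
  also have "\<dots> = (LINT x|S. dens x * ((2 * r x - 1) * h x))"
    by (rule expectation_X) measurable
  finally show ?thesis .
qed

text \<open>The sign has modulus 1 on the range of the data, so absolute and second moments of the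
  summands depend on the law of X only.\<close>

lemma expectation_abs_signed:
  assumes h[measurable]: "h \<in> borel_measurable borel"
  shows "expectation (\<lambda>w. \<bar>data_sign (yx i w)\<bar> * h (snd (yx i w))) = (LINT x|S. dens x * h x)"
proof -
  have "expectation (\<lambda>w. \<bar>data_sign (yx i w)\<bar> * h (snd (yx i w)))
      = expectation (\<lambda>w. \<bar>data_sign (if 0 \<le> X w \<bullet> \<beta> w then 1 else 0, X w)\<bar> * h (X w))"
    using expectation_data[of "\<lambda>d. \<bar>data_sign d\<bar> * h (snd d)" i] by simp
  also have "\<dots> = expectation (\<lambda>w. h (X w))"
    by (rule Bochner_Integration.integral_cong) (auto simp: data_sign_def dest: X_in_sphere)
  also have "\<dots> = (LINT x|S. dens x * h x)" by (rule expectation_X) measurable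
  finally show ?thesis .
qed

definition good_data :: "'w \<Rightarrow> bool" where
  "good_data w \<longleftrightarrow> (\<forall>i. snd (yx i w) \<in> sphere 0 1 \<and> (fst (yx i w) = 0 \<or> fst (yx i w) = 1))"

text \<open>The data share only the law of (Y, X), so their range is known merely almost surely.
  Countability of the indices gives one null set for all sample sizes.\<close>

lemma AE_good_data: "AE w in P. good_data w"
  unfolding good_data_def
proof (subst AE_all_countable, intro allI)
  fix i
  let ?Q = "\<lambda>d :: real \<times> (real^'d). snd d \<in> sphere 0 1 \<and> (fst d = 0 \<or> fst d = 1)"
  have Q: "Measurable.pred borel ?Q" unfolding mem_sphere_0 by measurable
  have Q': "{d \<in> space borel. ?Q d} \<in> sets borel" using Q by (simp add: pred_def)
  have "AE w in P. ?Q (if 0 \<le> X w \<bullet> \<beta> w then 1 else 0, X w)"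
    by (rule AE_I2) (auto dest: X_in_sphere)
  then have "AE d in distr P borel (\<lambda>w. (if 0 \<le> X w \<bullet> \<beta> w then 1 else 0, X w)). ?Q d"
    using Q' by (subst AE_distr_iff) auto
  then have "AE d in distr P borel (yx i). ?Q d" unfolding data_distr .
  then show "AE w in P. ?Q (yx i w)"
    by (subst (asm) AE_distr_iff) (use Q' in auto)
qed

end

section \<open>Error decomposition of the estimator\<close>

locale sphere_estimator = sphere_model +
  fixes ch :: "nat \<Rightarrow> nat \<Rightarrow> real" and C1 B C2 a2 :: real
  assumes codd_bound: "\<And>T (x::real^'b) y. \<bar>codd ch T x y\<bar> \<le> C1 * real T ^ (CARD('b) - 1)"
    and codd_L1: "\<And>T (x::real^'b). x \<in> sphere 0 1 \<Longrightarrow> (LINT y|sphere_measure. \<bar>codd ch T x y\<bar>) \<le> B"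
    and codd_Lip: "\<And>T (x::real^'b) y z. 1 \<le> T \<Longrightarrow> x \<in> sphere 0 1 \<Longrightarrow> y \<in> sphere 0 1 \<Longrightarrow> z \<in> sphere 0 1
       \<Longrightarrow> \<bar>codd ch T z x - codd ch T z y\<bar> \<le> C2 * norm (x - y) * real T powr a2"
    and B_pos: "0 < B" and C1_nonneg: "0 \<le> C1" and C2_nonneg: "0 \<le> C2"
begin

lemma id_S_measurable [measurable]: "(\<lambda>x. x) \<in> borel_measurable S"
  by simp

lemma pair_S_measurable:
  assumes "f \<in> measurable (borel \<Otimes>\<^sub>M borel) L"
  shows "f \<in> measurable (S \<Otimes>\<^sub>M S) L"
proof -
  have "(\<lambda>p. (fst p, snd p)) \<in> measurable (S \<Otimes>\<^sub>M S) (borel \<Otimes>\<^sub>M borel)"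
    by (intro measurable_Pair measurable_compose[OF measurable_fst id_S_measurable] measurable_compose[OF measurable_snd id_S_measurable])
  from measurable_compose[OF this assms] show ?thesis by simp
qed

lemma integral_S_measurable:
  fixes f :: "real^'b \<Rightarrow> real^'b \<Rightarrow> real"
  assumes "(\<lambda>p. f (fst p) (snd p)) \<in> borel_measurable (borel \<Otimes>\<^sub>M borel)"
  shows "(\<lambda>x. LINT y|S. f x y) \<in> borel_measurable S"
  using pair_S_measurable[OF assms] by (intro S.borel_measurable_lebesgue_integral) (simp add: case_prod_beta')

lemma integrable_codd: "integrable S (\<lambda>y. codd ch T x y)"
  by (rule S.integrable_const_bound[where B = "C1 * real T ^ (CARD('b) - 1)"])
     (use codd_bound in \<open>auto intro!: measurable_sphere_measure borel_measurable_codd\<close>)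

abbreviation R where "R \<equiv> Rfun e1 r"

lemma R_measurable [measurable]: "R \<in> borel_measurable borel"
  unfolding Rfun_def[abs_def] by measurable

lemma R_bounds: "AE x in S. 0 \<le> R x \<and> R x \<le> 1"
  using r_bounds AE_sphere_uminus[OF r_bounds] AE_sphere_coordinate_ne_0[of e1]
  by eventually_elim (auto simp: Rfun_def)

lemma R_uminus: "AE x in S. R (- x) = 1 - R x"
  using AE_sphere_coordinate_ne_0[of e1] by eventually_elim (auto simp: Rfun_def)

text \<open>The summand of \<open>Rhat\<close> - 1/2 with the true density in the denominator. It
  depends on a single data point, so its values along the sample are i.i.d.\<close>

definition G :: "nat \<Rightarrow> real \<Rightarrow> real \<times> (real^'b) \<Rightarrow> real^'b \<Rightarrow> real" where
  "G T tr d x = data_sign d * (codd ch T (snd d) x / max (dens (snd d)) tr)"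

text \<open>The expectation of \<open>G\<close> at a data point, already rewritten as an integral
  over the sphere; \<open>mA\<close> is the same for the modulus of \<open>G\<close>.\<close>

definition mG :: "nat \<Rightarrow> real \<Rightarrow> real^'b \<Rightarrow> real" where
  "mG T tr x = (LINT y|S. dens y * ((2 * r y - 1) * (codd ch T y x / max (dens y) tr)))"

definition mA :: "nat \<Rightarrow> real \<Rightarrow> real^'b \<Rightarrow> real" where
  "mA T tr x = (LINT y|S. dens y * \<bar>codd ch T y x / max (dens y) tr\<bar>)"

text \<open>The odd kernel annihilates constants, so this approximates R - 1/2 rather than
  R.\<close>

definition KR :: "nat \<Rightarrow> real^'b \<Rightarrow> real" where
  "KR T x = (LINT y|S. codd ch T x y * R y)"

abbreviation meanG where
  "meanG N T tr w x \<equiv> 1 / real N * (\<Sum>i<N. G T tr (yx i w) x)"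

abbreviation meanA where
  "meanA N T tr w x \<equiv> 1 / real N * (\<Sum>i<N. \<bar>G T tr (yx i w) x\<bar>)"

section \<open>Moments, Lipschitz bounds and deviations of the empirical means\<close>

lemma G_measurable [measurable]: "(\<lambda>d. G T tr d x) \<in> borel_measurable borel"
  unfolding G_def by measurable

lemma G_measurable_pair: "(\<lambda>(d, x). G T tr d x) \<in> borel_measurable (borel \<Otimes>\<^sub>M borel)"
  unfolding G_def case_prod_beta' by measurable

lemma ratio_bound:
  assumes "0 < tr"
  shows "\<bar>codd ch T y x / max (dens y) tr\<bar> \<le> C1 * real T ^ (CARD('b) - 1) / tr"
  unfolding abs_divide using assms codd_bound[of T y x] C1_nonneg by (intro frac_le) auto

lemma G_bound:
  assumes "0 < tr"
  shows "\<bar>G T tr d x\<bar> \<le> C1 * real T ^ (CARD('b) - 1) / tr"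
proof -
  have "\<bar>G T tr d x\<bar> \<le> 1 * (C1 * real T ^ (CARD('b) - 1) / tr)"
    unfolding G_def abs_mult by (intro mult_mono abs_data_sign_le ratio_bound assms) auto
  then show ?thesis by simp
qed

lemma mG_eq: "0 < tr \<Longrightarrow> expectation (\<lambda>w. G T tr (yx i w) x) = mG T tr x"
  unfolding G_def mG_def by (rule expectation_signed[OF _ ratio_bound]) measurable

lemma abs_G: "\<bar>G T tr d x\<bar> = \<bar>data_sign d\<bar> * \<bar>codd ch T (snd d) x / max (dens (snd d)) tr\<bar>"
  by (simp add: G_def abs_mult)

lemma G_square: "(G T tr d x)\<^sup>2 = \<bar>data_sign d\<bar> * (codd ch T (snd d) x / max (dens (snd d)) tr)\<^sup>2"
  by (simp add: G_def power_mult_distrib data_sign_def)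

lemma mA_eq: "expectation (\<lambda>w. \<bar>G T tr (yx i w) x\<bar>) = mA T tr x"
  unfolding abs_G mA_def by (rule expectation_abs_signed) measurable

lemma dens_div_max_le: "0 < tr \<Longrightarrow> dens y / max (dens y) tr \<le> 1"
  using dens_nonneg[of y] by (simp add: divide_simps)

lemma mA_le:
  assumes tr: "0 < tr" and x: "x \<in> sphere 0 1"
  shows "mA T tr x \<le> B"
proof -
  have le: "\<bar>dens y * \<bar>codd ch T y x / max (dens y) tr\<bar>\<bar> \<le> \<bar>codd ch T x y\<bar>" for y
  proof -
    have "\<bar>dens y * \<bar>codd ch T y x / max (dens y) tr\<bar>\<bar> = (dens y / max (dens y) tr) * \<bar>codd ch T y x\<bar>"
      using dens_nonneg[of y] tr by (simp add: abs_mult)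
    also have "\<dots> \<le> 1 * \<bar>codd ch T y x\<bar>" by (intro mult_right_mono dens_div_max_le tr) auto
    finally show ?thesis by (simp add: codd_commute[of ch T y x])
  qed
  have i: "integrable S (\<lambda>y. \<bar>codd ch T x y\<bar>)" using integrable_codd by simp
  have "mA T tr x \<le> (LINT y|S. \<bar>codd ch T x y\<bar>)"
    unfolding mA_def
  proof (rule integral_mono[OF _ i])
    show "integrable S (\<lambda>y. dens y * \<bar>codd ch T y x / max (dens y) tr\<bar>)"
      by (rule Bochner_Integration.integrable_bound[OF i]) (use le in \<open>auto intro!: measurable_sphere_measure\<close>)
    show "dens y * \<bar>codd ch T y x / max (dens y) tr\<bar> \<le> \<bar>codd ch T x y\<bar>" for y
      using le[of y] abs_ge_self order_trans by blast
  qed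
  also have "\<dots> \<le> B" by (rule codd_L1[OF x])
  finally show ?thesis .
qed

text \<open>Of the two kernel factors in the square, one is bounded in sup norm and the other
  integrated in L1 norm, while the density cancels one denominator. So the bound grows like T^(d-1),
  not like its square.\<close>

lemma G_second_moment:
  assumes tr: "0 < tr" and x: "x \<in> sphere 0 1"
  shows "expectation (\<lambda>w. (G T tr (yx i w) x)\<^sup>2) \<le> B * (C1 * real T ^ (CARD('b) - 1) / tr)"
proof -
  let ?K = "C1 * real T ^ (CARD('b) - 1) / tr"
  have le: "\<bar>dens y * (codd ch T y x / max (dens y) tr)\<^sup>2\<bar> \<le> ?K * \<bar>codd ch T x y\<bar>" for y
  proof -
    have "\<bar>dens y * (codd ch T y x / max (dens y) tr)\<^sup>2\<bar>
        = \<bar>codd ch T y x / max (dens y) tr\<bar> * ((dens y / max (dens y) tr) * \<bar>codd ch T y x\<bar>)"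
      using dens_nonneg[of y] tr by (simp add: abs_mult power2_eq_square)
    also have "\<dots> \<le> ?K * (1 * \<bar>codd ch T y x\<bar>)"
      using tr dens_nonneg[of y] C1_nonneg by (intro mult_mono ratio_bound dens_div_max_le) auto
    finally show ?thesis by (simp add: codd_commute[of ch T y x])
  qed
  have i: "integrable S (\<lambda>y. ?K * \<bar>codd ch T x y\<bar>)" using integrable_codd by simp
  have "expectation (\<lambda>w. (G T tr (yx i w) x)\<^sup>2) = (LINT y|S. dens y * (codd ch T y x / max (dens y) tr)\<^sup>2)"
    unfolding G_square by (rule expectation_abs_signed) measurable
  also have "\<dots> \<le> (LINT y|S. ?K * \<bar>codd ch T x y\<bar>)"
  proof (rule integral_mono[OF _ i])
    show "integrable S (\<lambda>y. dens y * (codd ch T y x / max (dens y) tr)\<^sup>2)"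
    proof (rule Bochner_Integration.integrable_bound[OF i])
      show "AE y in S. norm (dens y * (codd ch T y x / max (dens y) tr)\<^sup>2) \<le> norm (?K * \<bar>codd ch T x y\<bar>)"
        unfolding real_norm_def by (intro AE_I2 order_trans[OF le abs_ge_self])
    qed (auto intro!: measurable_sphere_measure)
    show "dens y * (codd ch T y x / max (dens y) tr)\<^sup>2 \<le> ?K * \<bar>codd ch T x y\<bar>" for y
      using le[of y] abs_ge_self order_trans by blast
  qed
  also have "\<dots> = ?K * (LINT y|S. \<bar>codd ch T x y\<bar>)" by simp
  also have "\<dots> \<le> ?K * B" using tr C1_nonneg by (intro mult_left_mono codd_L1[OF x]) auto
  finally show ?thesis by (simp add: mult.commute)
qed

lemma G_Lip:
  assumes tr: "0 < tr" and T: "1 \<le> T" and x: "x \<in> sphere 0 1" and y: "y \<in> sphere 0 1"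
  shows "\<bar>G T tr d x - G T tr d y\<bar> \<le> (C2 * real T powr a2 / tr) * norm (x - y)"
proof (cases "snd d \<in> sphere 0 1")
  case True
  have "G T tr d x - G T tr d y = data_sign d * ((codd ch T (snd d) x - codd ch T (snd d) y) / max (dens (snd d)) tr)"
    by (simp add: G_def right_diff_distrib diff_divide_distrib)
  also have "\<bar>\<dots>\<bar> \<le> 1 * ((C2 * norm (x - y) * real T powr a2) / tr)"
    unfolding abs_mult abs_divide
    using codd_Lip[OF T x y True] tr C2_nonneg by (intro mult_mono abs_data_sign_le frac_le) auto
  finally show ?thesis by (simp add: mult_ac)
next
  \<comment> \<open>The kernel estimate needs a first argument on the sphere; elsewhere
    \<open>data_sign\<close> makes both terms vanish.\<close>
  case False
  then show ?thesis using C2_nonneg tr by (simp add: G_def data_sign_def)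
qed

lemma G_bounds_by:
  assumes tr: "0 < tr" and V: "(1 + B) * (C1 * real T ^ (CARD('b) - 1) / tr) \<le> V"
  shows "\<bar>G T tr d x\<bar> \<le> V" "x \<in> sphere 0 1 \<Longrightarrow> expectation (\<lambda>w. (G T tr (yx i w) x)\<^sup>2) \<le> V"
proof -
  let ?K = "C1 * real T ^ (CARD('b) - 1) / tr"
  have "0 \<le> ?K" using tr C1_nonneg by simp
  moreover have "0 \<le> B * ?K" by (rule mult_nonneg_nonneg[OF less_imp_le[OF B_pos] calculation])
  moreover have "?K + B * ?K \<le> V" using V by (simp only: distrib_right mult_1_left)
  ultimately have KV: "?K \<le> V" "B * ?K \<le> V" by linarith+
  show "\<bar>G T tr d x\<bar> \<le> V" using order_trans[OF G_bound[OF tr] KV(1)] .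
  show "expectation (\<lambda>w. (G T tr (yx i w) x)\<^sup>2) \<le> V" if "x \<in> sphere 0 1"
    using order_trans[OF G_second_moment[OF tr that] KV(2)] .
qed

text \<open>The uniform bound is applied to \<open>G\<close> and to its modulus, which satisfy the
  same moment and Lipschitz bounds; this doubles the probability. The second application controls
  the mean that multiplies the trimming error.\<close>

lemma deviation_event:
  assumes tr: "0 < tr" and T: "1 \<le> T" and V: "0 < V" "(1 + B) * (C1 * real T ^ (CARD('b) - 1) / tr) \<le> V"
    and t: "0 \<le> t" "t \<le> 2" and N: "0 < N" and n: "0 < n"
  defines "e \<equiv> t + 2 * (C2 * real T powr a2 / tr) * (real CARD('b) / real n)"
  shows "\<exists>A\<in>events. prob A \<le> 2 * (real ((2 * n + 1) ^ CARD('b)) * (2 * exp (- (real N * t\<^sup>2 / (4 * V))))) \<and>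
    (\<forall>w\<in>space P - A. \<forall>x\<in>sphere 0 1.
       \<bar>meanG N T tr w x - mG T tr x\<bar> \<le> e \<and>
       meanA N T tr w x \<le> B + e)"
proof -
  note bnd = G_bounds_by(1)[OF tr V(2)] and sq = G_bounds_by(2)[OF tr V(2)]
  have L: "0 \<le> C2 * real T powr a2 / tr" using C2_nonneg tr by simp
  have "\<exists>A\<in>events. prob A \<le> real ((2 * n + 1) ^ CARD('b)) * (2 * exp (- (real N * t\<^sup>2 / (4 * V)))) \<and>
    (\<forall>w\<in>space P - A. \<forall>x\<in>sphere 0 1. \<bar>meanG N T tr w x - mG T tr x\<bar> \<le> e)"
    unfolding e_def
    by (rule uniform_deviation[OF data_indep G_measurable bnd mG_eq[OF tr] sq G_Lip[OF tr T] V(1) t N n L])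
  then obtain A1 where A1: "A1 \<in> events" "prob A1 \<le> real ((2 * n + 1) ^ CARD('b)) * (2 * exp (- (real N * t\<^sup>2 / (4 * V))))"
    "\<And>w x. w \<in> space P - A1 \<Longrightarrow> x \<in> sphere 0 1 \<Longrightarrow> \<bar>meanG N T tr w x - mG T tr x\<bar> \<le> e"
    by blast
  have "\<exists>A\<in>events. prob A \<le> real ((2 * n + 1) ^ CARD('b)) * (2 * exp (- (real N * t\<^sup>2 / (4 * V)))) \<and>
    (\<forall>w\<in>space P - A. \<forall>x\<in>sphere 0 1. \<bar>meanA N T tr w x - mA T tr x\<bar> \<le> e)"
    unfolding e_def
  proof (rule uniform_deviation[where G = "\<lambda>d x. \<bar>G T tr d x\<bar>", OF data_indep _ _ mA_eq _ _ V(1) t N n L])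
    show "(\<lambda>d. \<bar>G T tr d x\<bar>) \<in> borel_measurable borel" for x by measurable
    show "\<bar>\<bar>G T tr d x\<bar>\<bar> \<le> V" for d x using bnd by simp
    show "expectation (\<lambda>w. \<bar>G T tr (yx i w) x\<bar>\<^sup>2) \<le> V" if "x \<in> sphere 0 1" for i x using sq[OF that] by simp
    show "\<bar>\<bar>G T tr d x\<bar> - \<bar>G T tr d y\<bar>\<bar> \<le> C2 * real T powr a2 / tr * norm (x - y)"
      if "x \<in> sphere 0 1" "y \<in> sphere 0 1" for d x y
      by (rule order_trans[OF abs_triangle_ineq3 G_Lip[OF tr T that]])
  qed
  then obtain A2 where A2: "A2 \<in> events" "prob A2 \<le> real ((2 * n + 1) ^ CARD('b)) * (2 * exp (- (real N * t\<^sup>2 / (4 * V))))"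
    "\<And>w x. w \<in> space P - A2 \<Longrightarrow> x \<in> sphere 0 1 \<Longrightarrow> \<bar>meanA N T tr w x - mA T tr x\<bar> \<le> e"
    by blast
  show ?thesis
  proof (rule bexI[of _ "A1 \<union> A2"], intro conjI ballI)
    have "prob (A1 \<union> A2) \<le> prob A1 + prob A2" using A1 A2 by (intro measure_Un_le) auto
    then show "prob (A1 \<union> A2) \<le> 2 * (real ((2 * n + 1) ^ CARD('b)) * (2 * exp (- (real N * t\<^sup>2 / (4 * V)))))"
      using A1(2) A2(2) by linarith
    fix w x assume d: "w \<in> space P - (A1 \<union> A2)" and x: "x \<in> sphere (0::real^'b) 1"
    show "\<bar>meanG N T tr w x - mG T tr x\<bar> \<le> e" using A1(3)[OF _ x] d by auto
    have "\<bar>meanA N T tr w x - mA T tr x\<bar> \<le> e" using A2(3)[OF _ x] d by auto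
    then have "meanA N T tr w x - mA T tr x \<le> e" by (rule order_trans[OF abs_ge_self])
    then show "meanA N T tr w x \<le> B + e" using mA_le[OF tr x, of T] by linarith
  qed (use A1 A2 in auto)
qed

lemma square_deviation_event:
  assumes tr: "0 < tr" and V: "(1 + B) * (C1 * real T ^ (CARD('b) - 1) / tr) \<le> V"
    and N: "0 < N" and c: "0 < c"
  shows "\<exists>A\<in>events. prob A \<le> measure S (sphere 0 1) * (V / real N) / c \<and>
    (\<forall>w\<in>space P - A. (LINT x|S. (meanG N T tr w x - mG T tr x)\<^sup>2) \<le> c)"
  by (rule integrated_square_deviation[OF data_indep G_measurable_pair G_bounds_by(1)[OF tr V] mG_eq[OF tr] G_bounds_by(2)[OF tr V] N c])

lemma mG_measurable: "mG T tr \<in> borel_measurable S"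
  unfolding mG_def[abs_def] by (rule integral_S_measurable) measurable

lemma KR_measurable: "KR T \<in> borel_measurable S"
  unfolding KR_def[abs_def] by (rule integral_S_measurable) measurable

text \<open>Since k integrates to zero, R may be replaced by R - 1/2. Off the equator k (R - 1/2) is
  even, so both half spheres contribute equally, and on the upper one 2 (R - 1/2) = 2 r - 1. This is
  why data from a half sphere suffice and why the estimator carries the sign 2y - 1.\<close>

lemma KR_eq_half_sphere:
  "KR T x = (LINT y|S. (if 0 \<le> y $ e1 then (2 * r y - 1) * codd ch T y x else 0))"
proof -
  let ?K = "C1 * real T ^ (CARD('b) - 1)"
  define f where "f y = codd ch T y x" for y
  have f_bnd: "\<bar>f y\<bar> \<le> ?K" for y unfolding f_def by (rule codd_bound)
  have fm: "f (- y) = - f y" for y by (simp add: f_def codd_minus)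
  have [measurable]: "f \<in> borel_measurable borel" unfolding f_def[abs_def] by measurable
  have i_f: "integrable S f" by (rule S.integrable_const_bound[where B = ?K]) (use f_bnd in \<open>auto intro!: measurable_sphere_measure\<close>)
  have f0: "(LINT y|S. f y) = 0"
    using sphere_integral_uminus[of f] i_f by (simp add: fm)
  define g where "g y = f y * (R y - 1/2)" for y
  have [measurable]: "g \<in> borel_measurable borel" unfolding g_def[abs_def] by measurable
  have g_bnd: "AE y in S. \<bar>g y\<bar> \<le> ?K"
    using R_bounds
  proof eventually_elim
    case (elim y)
    then have "\<bar>R y - 1/2\<bar> \<le> 1" by (auto simp: abs_le_iff)
    then have "\<bar>f y\<bar> * \<bar>R y - 1/2\<bar> \<le> ?K * 1" using C1_nonneg by (intro mult_mono f_bnd) auto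
    then show ?case by (simp add: g_def abs_mult)
  qed
  let ?p = "\<lambda>y. if 0 \<le> y $ e1 then g y else 0" and ?m = "\<lambda>y. if y $ e1 < 0 then g y else 0"
  have i_p: "integrable S ?p"
    by (rule S.integrable_const_bound[where B = ?K])
       (use g_bnd C1_nonneg in \<open>auto elim!: eventually_mono intro!: measurable_sphere_measure\<close>)
  have i_m: "integrable S ?m"
    by (rule S.integrable_const_bound[where B = ?K])
       (use g_bnd C1_nonneg in \<open>auto elim!: eventually_mono intro!: measurable_sphere_measure\<close>)
  have g_split: "(\<lambda>y. ?p y + ?m y) = g" by auto
  have i_g: "integrable S g" using Bochner_Integration.integrable_add[OF i_p i_m] unfolding g_split .
  have "(LINT y|S. ?m y) = (LINT y|S. ?m (- y))"
    by (rule sphere_integral_uminus[symmetric]) (auto intro!: measurable_sphere_measure)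
  also have "\<dots> = (LINT y|S. ?p y)"
  proof (rule integral_cong_AE)
    show "AE y in S. ?m (- y) = ?p y"
      using R_uminus AE_sphere_coordinate_ne_0[of e1]
    proof eventually_elim
      case (elim y)
      have "g (- y) = g y" unfolding g_def fm elim(1) by (simp add: algebra_simps)
      then show ?case using elim(2) by auto
    qed
  qed (auto intro!: measurable_sphere_measure)
  finally have mp: "(LINT y|S. ?m y) = (LINT y|S. ?p y)" .
  have "KR T x = (LINT y|S. g y + 1/2 * f y)"
    unfolding KR_def
    by (rule Bochner_Integration.integral_cong) (auto simp: g_def f_def codd_commute[of ch T x] algebra_simps)
  also have "\<dots> = (LINT y|S. g y)" using i_g i_f f0 by simp
  also have "\<dots> = (LINT y|S. ?p y + ?m y)" unfolding g_split ..
  also have "\<dots> = 2 * (LINT y|S. ?p y)" using i_p i_m mp by simp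
  also have "\<dots> = (LINT y|S. 2 * ?p y)" by simp
  also have "\<dots> = (LINT y|S. (if 0 \<le> y $ e1 then (2 * r y - 1) * codd ch T y x else 0))"
    by (rule Bochner_Integration.integral_cong) (auto simp: g_def f_def Rfun_def algebra_simps)
  finally show ?thesis .
qed

section \<open>The bias from trimming the true density\<close>

definition low :: "real \<Rightarrow> (real^'b) set" where
  "low tr = {y \<in> sphere 0 1. 0 < fX y \<and> fX y < tr}"

lemma low_measurable [measurable]: "low tr \<in> sets S"
proof -
  have [measurable]: "fX \<in> borel_measurable S" by (rule fX_measurable_sphere)
  have "low tr = {y \<in> space S. 0 < fX y \<and> fX y < tr}" by (simp add: low_def)
  also have "\<dots> \<in> sets S" by measurable
  finally show ?thesis .
qed

text \<open>On the upper half sphere the two integrands differ by (2 r - 1) k (f / max(f, tr) - 1).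
  The last factor vanishes where f >= tr and has modulus at most 1 elsewhere; on the lower half
  sphere both integrands are zero.\<close>

lemma trimming_bias_le:
  assumes tr: "0 < tr"
  shows "\<bar>mG T tr x - KR T x\<bar> \<le> (LINT y|S. indicator (low tr) y * \<bar>codd ch T y x\<bar>)"
proof -
  let ?K = "C1 * real T ^ (CARD('b) - 1)"
  let ?a = "\<lambda>y. dens y * ((2 * r y - 1) * (codd ch T y x / max (dens y) tr))"
  let ?b = "\<lambda>y. if 0 \<le> y $ e1 then (2 * r y - 1) * codd ch T y x else 0"
  have cb: "\<bar>u * codd ch T y x\<bar> \<le> ?K" if "\<bar>u\<bar> \<le> 1" for u y
  proof -
    have "\<bar>u\<bar> * \<bar>codd ch T y x\<bar> \<le> 1 * ?K" using that by (intro mult_mono codd_bound) auto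
    then show ?thesis by (simp add: abs_mult)
  qed
  have rb: "AE y in S. 0 \<le> y $ e1 \<longrightarrow> \<bar>2 * r y - 1\<bar> \<le> 1"
    using r_bounds by eventually_elim (auto simp: abs_le_iff)
  have i_b: "integrable S ?b"
  proof (rule S.integrable_const_bound[where B = ?K])
    show "AE y in S. norm (?b y) \<le> ?K"
      using rb
    proof eventually_elim
      case (elim y)
      then show ?case using cb[of "2 * r y - 1" y] C1_nonneg by (cases "0 \<le> y $ e1") simp_all
    qed
  qed (auto intro!: measurable_sphere_measure)
  have i_l: "integrable S (\<lambda>y. indicator (low tr) y * \<bar>codd ch T y x\<bar>)"
  proof (rule S.integrable_const_bound[where B = ?K])
    show "AE y in S. norm (indicator (low tr) y * \<bar>codd ch T y x\<bar>) \<le> ?K"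
      using C1_nonneg by (auto intro!: AE_I2 simp: indicator_def codd_bound[simplified])
    show "(\<lambda>y. indicator (low tr) y * \<bar>codd ch T y x\<bar>) \<in> borel_measurable S"
      by (intro borel_measurable_times borel_measurable_abs borel_measurable_indicator low_measurable measurable_sphere_measure) measurable
  qed
  have ae: "AE y in S. \<bar>?a y - ?b y\<bar> \<le> indicator (low tr) y * \<bar>codd ch T y x\<bar>"
    using rb fX_pos AE_space[of S]
  proof eventually_elim
    case (elim y)
    then have y: "y \<in> sphere 0 1" by simp
    have d: "dens y = fX y" using y by (rule dens_eq)
    consider "y $ e1 < 0" | "0 \<le> y $ e1" "tr \<le> fX y" | "0 \<le> y $ e1" "fX y < tr" by linarith
    then show ?case
    proof cases
      case 1
      then show ?thesis using fX_zero[OF y] by (simp add: d)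
    next
      case 2
      then have "max (dens y) tr = fX y" "fX y \<noteq> 0" using tr by (auto simp: d)
      then have "?a y = ?b y" using 2 by (simp add: d)
      then show ?thesis by simp
    next
      case 3
      then have f0: "0 < fX y" and u: "\<bar>2 * r y - 1\<bar> \<le> 1" using elim by auto
      then have yl: "y \<in> low tr" using 3 y by (simp add: low_def)
      have "?a y - ?b y = (2 * r y - 1) * (fX y / tr - 1) * codd ch T y x"
      proof -
        have m: "max (fX y) tr = tr" using 3 by simp
        have "fX y * ((2 * r y - 1) * (codd ch T y x / tr)) - (2 * r y - 1) * codd ch T y x
            = (2 * r y - 1) * (fX y / tr - 1) * codd ch T y x"
          by (simp add: algebra_simps)
        then show ?thesis using 3(1) unfolding d m by simp
      qed
      also have "\<bar>\<dots>\<bar> \<le> (1 * 1) * \<bar>codd ch T y x\<bar>"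
      proof -
        have "0 \<le> fX y / tr" "fX y / tr \<le> 1" using f0 3 tr by auto
        then have "\<bar>fX y / tr - 1\<bar> \<le> 1" by (simp add: abs_le_iff)
        then show ?thesis unfolding abs_mult using u by (intro mult_mono) auto
      qed
      finally show ?thesis using yl by simp
    qed
  qed
  have [measurable]: "?a \<in> borel_measurable S" "?b \<in> borel_measurable S"
    by (auto intro!: measurable_sphere_measure)
  have i_ab: "integrable S (\<lambda>y. ?a y - ?b y)"
  proof (rule Bochner_Integration.integrable_bound[OF i_l])
    show "AE y in S. norm (?a y - ?b y) \<le> norm (indicator (low tr) y * \<bar>codd ch T y x\<bar>)"
      using ae by eventually_elim simp
  qed measurable
  \<comment> \<open>Integrability of \<open>?a\<close> comes from adding \<open>?b\<close> back to
    the difference, which the kernel dominates.\<close>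
  have i_a: "integrable S ?a"
    using Bochner_Integration.integrable_add[OF i_ab i_b] by (simp only: diff_add_cancel)
  have eq: "mG T tr x - KR T x = (LINT y|S. ?a y - ?b y)"
    unfolding mG_def KR_eq_half_sphere by (rule Bochner_Integration.integral_diff[OF i_a i_b, symmetric])
  show ?thesis
    unfolding eq
    by (rule order_trans[OF integral_abs_bound integral_mono_AE[OF integrable_abs[OF i_ab] i_l ae]])
qed

lemma trimming_bias_sup:
  assumes tr: "0 < tr"
  shows "\<bar>mG T tr x - KR T x\<bar> \<le> C1 * real T ^ (CARD('b) - 1) * measure S (low tr)"
proof -
  let ?K = "C1 * real T ^ (CARD('b) - 1)"
  have "(LINT y|S. indicator (low tr) y * \<bar>codd ch T y x\<bar>) \<le> (LINT y|S. ?K * indicator (low tr) y)"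
  proof (rule integral_mono)
    show i2: "integrable S (\<lambda>y. ?K * indicator (low tr) y :: real)"
      by (rule S.integrable_const_bound[where B = ?K]) (use C1_nonneg in \<open>auto simp: indicator_def\<close>)
    show le: "indicator (low tr) y * \<bar>codd ch T y x\<bar> \<le> ?K * indicator (low tr) y" for y
      using codd_bound[of T y x] by (auto simp: indicator_def)
    show "integrable S (\<lambda>y. indicator (low tr) y * \<bar>codd ch T y x\<bar>)"
    proof (rule Bochner_Integration.integrable_bound[OF i2])
      show "(\<lambda>y. indicator (low tr) y * \<bar>codd ch T y x\<bar>) \<in> borel_measurable S"
        by (intro borel_measurable_times borel_measurable_abs borel_measurable_indicator low_measurable measurable_sphere_measure) measurable
      show "AE y in S. norm (indicator (low tr) y * \<bar>codd ch T y x\<bar>) \<le> norm (?K * indicator (low tr) y :: real)"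
        using le C1_nonneg by (auto intro!: AE_I2 simp: abs_mult indicator_def codd_bound)
    qed
  qed
  also have "\<dots> = ?K * measure S (low tr)"
    using sets.sets_into_space[OF low_measurable[of tr]] by (simp add: Int_absorb2)
  finally show ?thesis using trimming_bias_le[OF tr, of T x] by linarith
qed

text \<open>After exchanging the integrals, the inner one over x is the L1 norm of the kernel for
  fixed y, at most B. Thus no power of T appears, in contrast to the sup bound.\<close>

lemma trimming_bias_L1:
  assumes tr: "0 < tr"
  shows "(LINT x|S. \<bar>mG T tr x - KR T x\<bar>) \<le> B * measure S (low tr)"
proof -
  let ?K = "C1 * real T ^ (CARD('b) - 1)"
  let ?f = "\<lambda>y x. indicator (low tr) y * \<bar>codd ch T y x\<bar>"
  interpret SS: pair_sigma_finite S S ..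
  interpret SSf: finite_measure "S \<Otimes>\<^sub>M S" by (rule finite_measure_pair_measure) (unfold_locales)
  have fm: "(\<lambda>p. ?f (fst p) (snd p)) \<in> borel_measurable (S \<Otimes>\<^sub>M S)"
  proof (intro borel_measurable_times)
    show "(\<lambda>p. indicator (low tr) (fst p)) \<in> borel_measurable (S \<Otimes>\<^sub>M S)" by measurable
    show "(\<lambda>p. \<bar>codd ch T (fst p) (snd p)\<bar>) \<in> borel_measurable (S \<Otimes>\<^sub>M S)"
      by (rule pair_S_measurable) measurable
  qed
  have fi: "integrable (S \<Otimes>\<^sub>M S) (\<lambda>(y, x). ?f y x)"
  proof (rule SSf.integrable_const_bound[where B = ?K])
    show "AE p in S \<Otimes>\<^sub>M S. norm (case p of (y, x) \<Rightarrow> ?f y x) \<le> ?K"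
      using C1_nonneg by (auto intro!: AE_I2 simp: indicator_def codd_bound[simplified])
  qed (use fm in \<open>simp add: case_prod_beta'\<close>)
  have "(LINT x|S. \<bar>mG T tr x - KR T x\<bar>) \<le> (LINT x|S. (LINT y|S. ?f y x))"
  proof (rule integral_mono)
    show "integrable S (\<lambda>x. LINT y|S. ?f y x)" by (rule SS.integrable_snd[OF fi])
    show "integrable S (\<lambda>x. \<bar>mG T tr x - KR T x\<bar>)"
      by (rule S.integrable_const_bound[where B = "?K * measure S (low tr)"])
         (use trimming_bias_sup[OF tr] mG_measurable KR_measurable in auto)
  qed (rule trimming_bias_le[OF tr])
  also have "\<dots> = (LINT y|S. (LINT x|S. ?f y x))" by (rule SS.Fubini_integral[OF fi])
  also have "\<dots> \<le> (LINT y|S. B * indicator (low tr) y)"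
  proof (rule integral_mono)
    show "integrable S (\<lambda>y. LINT x|S. ?f y x)" by (rule SS.integrable_fst[OF fi])
    show "integrable S (\<lambda>y. B * indicator (low tr) y :: real)"
      by (rule S.integrable_const_bound[where B = B]) (use B_pos in \<open>auto simp: indicator_def\<close>)
    fix y assume "y \<in> space S"
    then have y: "y \<in> sphere 0 1" by simp
    show "(LINT x|S. ?f y x) \<le> B * indicator (low tr) y"
      using codd_L1[OF y, of T] by (simp add: indicator_def)
  qed
  also have "\<dots> = B * measure S (low tr)"
    using sets.sets_into_space[OF low_measurable[of tr]] by (simp add: Int_absorb2)
  finally show ?thesis .
qed

section \<open>The smoothing bias\<close>

lemma czonal_pair_measurable:
  "(\<lambda>p. czonal n (fst p) (snd p)) \<in> borel_measurable (borel \<Otimes>\<^sub>M borel)"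
  unfolding borel_prod by (rule borel_measurable_continuous_onI[OF continuous_on_czonal])

lemma kern_R_bound:
  fixes T :: nat
  assumes x: "x \<in> sphere 0 1"
  defines "Kc \<equiv> (\<Sum>n\<le>T. \<bar>ch n T\<bar> * (harm_dim n CARD('b) / \<bar>sphere_area CARD('b)\<bar>))"
  shows "AE y in S. \<bar>kern ch T x y * R y\<bar> \<le> Kc" "integrable S (\<lambda>y. kern ch T x y * R y)"
proof -
  show ae: "AE y in S. \<bar>kern ch T x y * R y\<bar> \<le> Kc"
    using R_bounds AE_space[of S]
  proof eventually_elim
    case (elim y)
    then have "\<bar>kern ch T x y\<bar> * \<bar>R y\<bar> \<le> Kc * 1"
      unfolding Kc_def using abs_kern_le[OF dim x, of y ch T] by (intro mult_mono) auto
    then show ?case by (simp add: abs_mult)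
  qed
  have "(\<lambda>y. kern ch T x y * R y) \<in> borel_measurable S"
    by (intro borel_measurable_times borel_measurable_kern[OF x]) simp
  then show "integrable S (\<lambda>y. kern ch T x y * R y)"
    using ae by (intro S.integrable_const_bound[where B = Kc]) auto
qed

text \<open>The bound may depend on T; it only certifies that the \<open>lpnorm\<close> in
  \<open>K3\<close> is not a junk value.\<close>

lemma approximation_error_bounded:
  "\<exists>b. AE x in S. \<bar>R x - (LINT y|S. kern ch T x y * R y)\<bar> \<le> b"
proof -
  define Kc where "Kc = (\<Sum>n\<le>T. \<bar>ch n T\<bar> * (harm_dim n CARD('b) / \<bar>sphere_area CARD('b)\<bar>))"
  have int_le: "\<bar>LINT y|S. kern ch T x y * R y\<bar> \<le> Kc * measure S (space S)" if x: "x \<in> sphere 0 1" for x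
  proof -
    have "(LINT y|S. \<bar>kern ch T x y * R y\<bar>) \<le> (LINT y|S. Kc)"
      using kern_R_bound[OF x, of T] by (intro integral_mono_AE) (auto simp: Kc_def)
    then have "(LINT y|S. \<bar>kern ch T x y * R y\<bar>) \<le> Kc * measure S (space S)" by (simp add: mult.commute)
    with integral_abs_bound show ?thesis by (rule order_trans)
  qed
  have "AE x in S. \<bar>R x - (LINT y|S. kern ch T x y * R y)\<bar> \<le> 1 + Kc * measure S (space S)"
    using R_bounds AE_space[of S]
  proof eventually_elim
    case (elim x)
    then have "\<bar>R x\<bar> \<le> 1" "x \<in> sphere 0 1" by auto
    then show ?case
      using order_trans[OF abs_triangle_ineq4 add_mono[OF _ int_le]] by blast
  qed
  then show ?thesis by blast
qed

lemma approximation_error_measurable: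
  "(\<lambda>x. R x - (LINT y|S. kern ch T x y * R y)) \<in> borel_measurable S"
proof -
  have "(\<lambda>x. LINT y|S. (\<Sum>n\<le>T. ch n T * czonal n x y) * R y) \<in> borel_measurable S"
  proof (rule integral_S_measurable)
    have "(\<lambda>p. R (snd p)) \<in> borel_measurable ((borel :: (real^'b) measure) \<Otimes>\<^sub>M borel)" by measurable
    then show "(\<lambda>p. (\<Sum>n\<le>T. ch n T * czonal n (fst p) (snd p)) * R (snd p)) \<in> borel_measurable (borel \<Otimes>\<^sub>M borel)"
      by (intro borel_measurable_times borel_measurable_sum czonal_pair_measurable) auto
  qed
  then have "(\<lambda>x. LINT y|S. kern ch T x y * R y) \<in> borel_measurable S"
  proof (subst measurable_cong)
    fix x assume "x \<in> space S"
    then show "(LINT y|S. kern ch T x y * R y) = (LINT y|S. (\<Sum>n\<le>T. ch n T * czonal n x y) * R y)"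
      by (intro Bochner_Integration.integral_cong) (auto simp: kern_def czonal_eq)
  qed
  then show ?thesis by (intro borel_measurable_diff) simp_all
qed

lemma KR_eq_diff:
  assumes x: "x \<in> sphere 0 1"
  shows "KR T x = ((LINT y|S. kern ch (2*T) x y * R y) - (LINT y|S. kern ch (2*T) (- x) y * R y)) / 2"
proof -
  have mx: "- x \<in> sphere 0 1" using x by simp
  have "KR T x = (LINT y|S. (kern ch (2*T) x y * R y - kern ch (2*T) (- x) y * R y) / 2)"
    unfolding KR_def
    by (rule Bochner_Integration.integral_cong) (auto simp: codd_eq_kern_diff[OF x] field_simps)
  then show ?thesis using kern_R_bound(2)[OF x, of "2*T"] kern_R_bound(2)[OF mx, of "2*T"] by simp
qed

text \<open>Only the odd part of the approximation error enters, so K3 applies although the even part of the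
  kernel is discarded.\<close>

lemma smoothing_bias:
  assumes q: "1 \<le> q" and \<tau>: "0 < \<tau>" and K3: "K3 ch q \<tau> TYPE('b)" and sob: "sobolev q \<tau> R"
  obtains C where "0 \<le> C" "\<And>T. 1 \<le> T \<Longrightarrow> lq S q (\<lambda>x. KR T x + 1/2 - R x) (C * real T powr (- \<tau>))"
proof -
  obtain C0 where C0: "\<And>T. 1 \<le> T \<Longrightarrow> lpnorm S q (\<lambda>x. R x - (LINT y|S. kern ch T x y * R y))
      \<le> C0 * real T powr (- \<tau>) * sob_norm q \<tau> R"
    using K3 sob unfolding K3_def by blast
  define C where "C = \<bar>C0 * sob_norm q \<tau> R\<bar>"
  have main: "lq S q (\<lambda>x. KR T x + 1/2 - R x) (8 * C * real T powr (- \<tau>))" if T: "1 \<le> T" for T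
  proof -
    define F where "F x = R x - (LINT y|S. kern ch (2*T) x y * R y)" for x
    have Fm: "F \<in> borel_measurable S" unfolding F_def[abs_def] by (rule approximation_error_measurable)
    have Fm': "(\<lambda>x. F (- x)) \<in> borel_measurable S"
      by (rule measurable_compose[OF sphere_measure_measurable_uminus Fm])
    let ?c = "C * real T powr (- \<tau>)"
    have c: "0 \<le> ?c" by (simp add: C_def)
    have "lpnorm S q F \<le> (C0 * sob_norm q \<tau> R) * real (2*T) powr (- \<tau>)"
      using C0[of "2*T"] T by (simp add: F_def[abs_def] mult_ac)
    also have "\<dots> \<le> C * real (2*T) powr (- \<tau>)"
      unfolding C_def by (intro mult_right_mono abs_ge_self) auto
    also have "\<dots> \<le> ?c" using T \<tau> by (intro mult_left_mono powr_mono2') (auto simp: C_def)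
    finally have le: "lpnorm S q F \<le> ?c" .
    obtain b where b: "AE x in S. \<bar>F x\<bar> \<le> b"
      using approximation_error_bounded[of "2*T"] by (auto simp: F_def)
    have lqF: "lq S q F ?c" by (rule lq_of_lpnorm_le[OF S.finite_measure_axioms q Fm b c le])
    have lqF': "lq S q (\<lambda>x. F (- x)) ?c" by (rule lq_sphere_uminus[OF lqF])
    have 1: "lq S q (\<lambda>x. - F x / 2) ?c"
      by (rule lq_dominated[OF q lqF]) (use Fm in auto)
    have 2: "lq S q (\<lambda>x. F (- x) / 2) ?c"
      by (rule lq_dominated[OF q lqF']) (use Fm' in auto)
    have sum: "lq S q (\<lambda>x. - F x / 2 + F (- x) / 2) (4 * (?c + ?c))" by (rule lq_add[OF q 1 2])
    have "lq S q (\<lambda>x. KR T x + 1/2 - R x) (4 * (?c + ?c))"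
    proof (rule lq_dominated[OF q sum])
      show "(\<lambda>x. KR T x + 1/2 - R x) \<in> borel_measurable S"
        using KR_measurable[of T] by (intro borel_measurable_diff borel_measurable_add) auto
      show "AE x in S. \<bar>KR T x + 1/2 - R x\<bar> \<le> \<bar>- F x / 2 + F (- x) / 2\<bar>"
        using R_uminus AE_space[of S]
      proof eventually_elim
        case (elim x)
        then have x: "x \<in> sphere 0 1" by simp
        \<comment> \<open>Half the difference of the errors at -x and x: substituting R(-x) = 1 -
          R(x) leaves the summand 1/2 on the left.\<close>
        have "KR T x + 1/2 - R x = - F x / 2 + F (- x) / 2"
          unfolding KR_eq_diff[OF x] F_def elim(1) by (simp add: field_simps)
        then show ?case by simp
      qed
    qed
    then show ?thesis by (simp add: mult.assoc)
  qed
  show ?thesis by (rule that[of "8 * C"]) (use main in \<open>auto simp: C_def\<close>)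
qed

lemma trimming_bias_lq:
  assumes q: "1 \<le> q" and tr: "0 < tr" and c: "0 \<le> c"
    and inf: "q = \<infinity> \<Longrightarrow> C1 * real T ^ (CARD('b) - 1) * measure S (low tr) \<le> c"
    and fin: "q \<noteq> \<infinity> \<Longrightarrow> (C1 * real T ^ (CARD('b) - 1) * measure S (low tr)) powr (real_of_ereal q - 1)
      * (B * measure S (low tr)) \<le> c powr real_of_ereal q"
  shows "lq S q (\<lambda>x. mG T tr x - KR T x) c"
proof -
  have m: "(\<lambda>x. mG T tr x - KR T x) \<in> borel_measurable S"
    using mG_measurable KR_measurable by (rule borel_measurable_diff)
  show ?thesis
  proof (cases "q = \<infinity>")
    case True
    then show ?thesis
      using m c order_trans[OF trimming_bias_sup[OF tr] inf[OF True]] by (simp add: lq_def)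
  next
    case False
    show ?thesis
    proof (rule lq_interpolate[OF S.finite_measure_axioms q False m, where p = 1])
      show "AE x in S. \<bar>mG T tr x - KR T x\<bar> \<le> C1 * real T ^ (CARD('b) - 1) * measure S (low tr)"
        by (intro AE_I2 trimming_bias_sup[OF tr])
      show "(LINT x|S. \<bar>mG T tr x - KR T x\<bar> powr 1) \<le> B * measure S (low tr)"
        using trimming_bias_L1[OF tr] by simp
    qed (use one_le_real_of_ereal[OF q False] C1_nonneg c fin[OF False] in auto)
  qed
qed

section \<open>The plug-in error and the total error for one outcome\<close>

lemma le_Mtrim:
  assumes "i < N"
  shows "\<bar>max (fX (snd (yx i w))) (trim_level rt N) / max (fhat N w (snd (yx i w))) (trim_level rt N) - 1\<bar>
    \<le> Mtrim fX fhat yx rt N w"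
  unfolding Mtrim_def by (rule Max_ge) (use assms in auto)

lemma Mtrim_nonneg: "0 \<le> Mtrim fX fhat yx rt N w"
  unfolding Mtrim_def by (rule Max_ge) auto

text \<open>For good data each summand of \<open>Rhat\<close> is the corresponding \<open>G\<close>
  times max(f, tr) / max(fhat, tr), and this ratio deviates from 1 by at most \<open>Mtrim\<close>.
  No independence is involved.\<close>

lemma plug_in_error:
  assumes good: "good_data w"
    and tr: "0 < trim_level rt N" and N: "0 < N" and x: "x \<in> sphere 0 1"
  shows "\<bar>Rhat ch T rt fhat yx N w x - (1/2 + meanG N (T N) (trim_level rt N) w x)\<bar>
    \<le> Mtrim fX fhat yx rt N w * (meanA N (T N) (trim_level rt N) w x)"
proof -
  let ?tr = "trim_level rt N" and ?M = "Mtrim fX fhat yx rt N w"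
  let ?a = "\<lambda>i. (2 * fst (yx i w) - 1) * kern_odd ch (T N) (snd (yx i w)) x / max (fhat N w (snd (yx i w))) ?tr"
  let ?g = "\<lambda>i. G (T N) ?tr (yx i w) x"
  have trm: "\<bar>?a i - ?g i\<bar> \<le> ?M * \<bar>?g i\<bar>" if i: "i < N" for i
  proof -
    define u where "u = snd (yx i w)"
    have u: "u \<in> sphere 0 1" using good by (simp add: u_def good_data_def)
    have s: "2 * fst (yx i w) - 1 = data_sign (yx i w)" using good by (auto simp: data_sign_def good_data_def)
    have "?a i = ?g i * (max (fX u) ?tr / max (fhat N w u) ?tr)"
      unfolding G_def s u_def[symmetric] codd_eq_kern_odd[OF u x] dens_eq[OF u] using tr by simp
    then have "?a i - ?g i = (max (fX u) ?tr / max (fhat N w u) ?tr - 1) * ?g i"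
      by (simp add: algebra_simps)
    moreover have "\<bar>(max (fX u) ?tr / max (fhat N w u) ?tr - 1) * ?g i\<bar> \<le> ?M * \<bar>?g i\<bar>"
      unfolding abs_mult u_def by (intro mult_right_mono le_Mtrim i) auto
    ultimately show ?thesis by simp
  qed
  have "Rhat ch T rt fhat yx N w x - (1/2 + 1 / real N * (\<Sum>i<N. ?g i)) = 1 / real N * (\<Sum>i<N. ?a i - ?g i)"
    by (simp add: Rhat_def sum_subtractf diff_divide_distrib)
  moreover have "\<bar>1 / real N * (\<Sum>i<N. ?a i - ?g i)\<bar> \<le> 1 / real N * (\<Sum>i<N. ?M * \<bar>?g i\<bar>)"
    unfolding abs_mult using trm by (intro mult_mono order_trans[OF sum_abs sum_mono]) auto
  moreover have "1 / real N * (\<Sum>i<N. ?M * \<bar>?g i\<bar>) = ?M * (1 / real N * (\<Sum>i<N. \<bar>?g i\<bar>))"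
    by (simp add: sum_distrib_left[symmetric])
  ultimately show ?thesis by (simp only:)
qed

lemma meanG_measurable: "(\<lambda>x. meanG N T tr w x) \<in> borel_measurable S"
proof -
  have "(\<lambda>x. G T tr (yx i w) x) \<in> borel_measurable borel" for i
    unfolding G_def by measurable
  then show ?thesis
    by (intro measurable_sphere_measure borel_measurable_times borel_measurable_sum) auto
qed

lemma deviation_measurable: "(\<lambda>x. meanG N T tr w x - mG T tr x) \<in> borel_measurable S"
  using meanG_measurable mG_measurable by (rule borel_measurable_diff)

lemma error_bound:
  assumes q: "1 \<le> q"
    and good: "good_data w"
    and tr: "0 < trim_level rt N" and N: "0 < N"
    and M: "Mtrim fX fhat yx rt N w \<le> M0"
    and dev: "\<And>x. x \<in> sphere 0 1 \<Longrightarrow> meanA N (T N) (trim_level rt N) w x \<le> B'"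
    and c2: "lq S q (\<lambda>x. meanG N (T N) (trim_level rt N) w x - mG (T N) (trim_level rt N) x) c2"
    and c3: "lq S q (\<lambda>x. mG (T N) (trim_level rt N) x - KR (T N) x) c3"
    and c4: "lq S q (\<lambda>x. KR (T N) x + 1/2 - R x) c4"
  shows "lpnorm S q (\<lambda>x. Rhat ch T rt fhat yx N w x - R x)
    \<le> 64 * (M0 * B' * (1 + measure S (space S)) + c2 + c3 + c4)"
proof -
  let ?tr = "trim_level rt N"
  let ?G = "\<lambda>x. 1 / real N * (\<Sum>i<N. G (T N) ?tr (yx i w) x)"
  define D1 where "D1 x = Rhat ch T rt fhat yx N w x - (1/2 + ?G x)" for x
  have Gm: "?G \<in> borel_measurable S" by (rule meanG_measurable)
  \<comment> \<open>For a fixed outcome \<open>fhat\<close> contributes only constants, and on the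
    sphere \<open>kern_odd\<close> may be replaced by the continuous \<open>codd\<close>.\<close>
  have Rm: "(\<lambda>x. Rhat ch T rt fhat yx N w x) \<in> borel_measurable S"
  proof (subst measurable_cong)
    fix x assume "x \<in> space S"
    then show "Rhat ch T rt fhat yx N w x = 1/2 + 1 / real N * (\<Sum>i<N.
      (2 * fst (yx i w) - 1) * codd ch (T N) (snd (yx i w)) x / max (fhat N w (snd (yx i w))) ?tr)"
      using good by (simp add: Rhat_def codd_eq_kern_odd good_data_def)
  next
    show "(\<lambda>x. 1/2 + 1 / real N * (\<Sum>i<N.
      (2 * fst (yx i w) - 1) * codd ch (T N) (snd (yx i w)) x / max (fhat N w (snd (yx i w))) ?tr)) \<in> borel_measurable S"
      by (rule measurable_sphere_measure) measurable
  qed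
  have D1m: "D1 \<in> borel_measurable S"
    unfolding D1_def[abs_def] using Rm Gm by (intro borel_measurable_diff borel_measurable_add) auto
  have M0: "0 \<le> M0" using order_trans[OF Mtrim_nonneg M] .
  \<comment> \<open>Nonnegativity of B' is read off at a sample point of the sphere, the unit vector
    of coordinate \<open>e1\<close>.\<close>
  have "(0::real) \<le> 1 / real N * (\<Sum>i<N. \<bar>G (T N) ?tr (yx i w) (axis e1 1)\<bar>)" by (simp add: sum_nonneg)
  also have "\<dots> \<le> B'" by (rule dev) (simp add: norm_axis_1)
  finally have B': "0 \<le> B'" .
  have lq1: "lq S q D1 (M0 * B' * (1 + measure S (space S)))"
  proof (rule lq_of_bounded[OF S.finite_measure_axioms q D1m])
    show "0 \<le> M0 * B'" using M0 B' by simp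
    show "AE x in S. \<bar>D1 x\<bar> \<le> M0 * B'"
    proof (rule AE_I2)
      fix x assume "x \<in> space S"
      then have x: "x \<in> sphere 0 1" by simp
      have "\<bar>D1 x\<bar> \<le> Mtrim fX fhat yx rt N w * (1 / real N * (\<Sum>i<N. \<bar>G (T N) ?tr (yx i w) x\<bar>))"
        unfolding D1_def by (rule plug_in_error[OF good tr N x])
      also have "\<dots> \<le> M0 * B'" using M0 by (intro mult_mono M dev x) (auto simp: sum_nonneg)
      finally show "\<bar>D1 x\<bar> \<le> M0 * B'" .
    qed
  qed
  let ?c1 = "M0 * B' * (1 + measure S (space S))"
  have nn: "0 \<le> ?c1" "0 \<le> c2" "0 \<le> c3" "0 \<le> c4" using lq1 c2 c3 c4 by (auto simp: lq_def)
  have sum: "lq S q (\<lambda>x. ((D1 x + (?G x - mG (T N) ?tr x)) + (mG (T N) ?tr x - KR (T N) x)) + (KR (T N) x + 1/2 - R x))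
      (4 * (4 * (4 * (?c1 + c2) + c3) + c4))"
    by (intro lq_add q lq1 c2 c3 c4)
  have eq: "((D1 x + (?G x - mG (T N) ?tr x)) + (mG (T N) ?tr x - KR (T N) x)) + (KR (T N) x + 1/2 - R x)
      = Rhat ch T rt fhat yx N w x - R x" for x
    by (simp add: D1_def)
  have "lpnorm S q (\<lambda>x. Rhat ch T rt fhat yx N w x - R x) \<le> 4 * (4 * (4 * (?c1 + c2) + c3) + c4)"
    using lpnorm_le_of_lq[OF q sum] unfolding eq .
  \<comment> \<open>64 is 4^3, one factor for each of the three additions.\<close>
  also have "\<dots> \<le> 64 * (?c1 + c2 + c3 + c4)" using nn by (simp add: algebra_simps)
  finally show ?thesis .
qed

end

section \<open>Rates\<close>

locale rate_setup = sphere_estimator +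
  fixes q :: ereal and \<tau> rt :: real and T :: "nat \<Rightarrow> nat" and c1 c2 :: real
  assumes q: "1 \<le> q" and \<tau>: "0 < \<tau>" and rt: "0 < rt" and a2: "0 \<le> a2" and c1: "0 < c1" and c2: "0 < c2"
    and T_rate: "\<forall>\<^sub>F N in sequentially.
      c1 * base_rate (kappa rt q) N powr (1 / (2 * \<tau> + real CARD('b) - 1)) \<le> real (T N) \<and>
      real (T N) \<le> c2 * base_rate (kappa rt q) N powr (1 / (2 * \<tau> + real CARD('b) - 1))"
begin

definition dl where "dl = 2 * \<tau> + real CARD('b) - 1"
text \<open>The exponent for which T^(d-1) is of order nr^ea.\<close>

definition ea where "ea = (real CARD('b) - 1) / dl"
definition nr where "nr N = base_rate (kappa rt q) N"
definition rho where "rho N = nr N powr (- \<tau> / dl)"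
text \<open>Chosen so that \<open>VV\<close> dominates the bounds for \<open>G\<close>; the summand
  1 ensures that \<open>VV\<close> is at least 1.\<close>

definition C0 where "C0 = (1 + B) * C1 * c2 ^ (CARD('b) - 1) + 1"
text \<open>\<open>VV\<close> bounds the summands and their second moments; \<open>tt\<close> is the radius for which Bernstein's bound
  gives the probability N^(-AA), small enough for a net of mesh N^(-kk).\<close>

definition VV where "VV N = C0 * nr N powr ea * ln (real N) powr (2 * rt)"
definition kk :: nat where "kk = nat \<lceil>a2\<rceil> + 3"
definition AA where "AA = kk * CARD('b) + 2"
definition tt where "tt N = sqrt (4 * real AA * VV N * ln (real N) / real N)"

lemma dl: "1 < dl" using dim \<tau> by (simp add: dl_def)

lemma ea: "0 < ea" "ea < 1" using dim \<tau> by (auto simp: ea_def dl_def field_simps)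

lemma C0: "1 \<le> C0" using B_pos C1_nonneg c2 by (simp add: C0_def)

text \<open>All requirements that N be large, gathered so that the estimates below hold at each
  single regular N.\<close>

definition regular :: "nat \<Rightarrow> bool" where
  "regular N \<longleftrightarrow> 0 < N \<and> 1 \<le> ln (real N) \<and> 1 \<le> nr N \<and> 1 \<le> T N \<and> T N \<le> N
     \<and> c1 * nr N powr (1 / dl) \<le> real (T N) \<and> real (T N) \<le> c2 * nr N powr (1 / dl)
     \<and> tt N \<le> 1 \<and> ln (real N) powr rt \<le> real N \<and> 2 * C2 * real CARD('b) \<le> real N"

text \<open>T <= N holds eventually since 1/dl < 1, and \<open>tt\<close> tends to 0 since ea < 1
  beats every power of the logarithm.\<close>

lemma eventually_regular: "eventually regular sequentially"
proof -
  have nr_top: "filterlim nr at_top sequentially"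
    unfolding nr_def[abs_def] base_rate_def by real_asymp
  have e1: "\<forall>\<^sub>F N in sequentially. 1 \<le> nr N" using nr_top by (simp add: filterlim_at_top)
  have "filterlim (\<lambda>N. c1 * nr N powr (1 / dl)) at_top sequentially"
    using c1 dl nr_top by (intro filterlim_tendsto_pos_mult_at_top[OF tendsto_const] filterlim_compose[OF real_powr_at_top]) auto
  then have e2: "\<forall>\<^sub>F N in sequentially. 1 \<le> c1 * nr N powr (1 / dl)" by (simp add: filterlim_at_top)
  have "(\<lambda>N. nr N powr (1 / dl) / real N) \<longlonglongrightarrow> 0"
  proof -
    have "0 < 1 / dl" "1 / dl < 1" using dl by auto
    then show ?thesis unfolding nr_def[abs_def] base_rate_def by real_asymp
  qed
  then have "(\<lambda>N. c2 * (nr N powr (1 / dl) / real N)) \<longlonglongrightarrow> 0" by (rule tendsto_mult_right_zero)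
  then have e3: "\<forall>\<^sub>F N in sequentially. c2 * (nr N powr (1 / dl) / real N) < 1" by (rule order_tendstoD) simp
  have "(\<lambda>N. nr N powr ea * ln (real N) powr (2 * rt + 1) / real N) \<longlonglongrightarrow> 0"
    using ea unfolding nr_def[abs_def] base_rate_def by real_asymp
  then have "(\<lambda>N. 4 * real AA * C0 * (nr N powr ea * ln (real N) powr (2 * rt + 1) / real N)) \<longlonglongrightarrow> 0"
    by (rule tendsto_mult_right_zero)
  then have e4: "\<forall>\<^sub>F N in sequentially. 4 * real AA * C0 * (nr N powr ea * ln (real N) powr (2 * rt + 1) / real N) < 1"
    by (rule order_tendstoD) simp
  have e5: "\<forall>\<^sub>F N in sequentially. ln (real N) powr rt \<le> real N" by real_asymp
  have e6: "\<forall>\<^sub>F N in sequentially. 1 \<le> ln (real N)" by real_asymp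
  have e7: "\<forall>\<^sub>F N in sequentially. 2 * C2 * real CARD('b) \<le> real N"
    using filterlim_real_sequentially by (simp add: filterlim_at_top)
  have e8: "\<forall>\<^sub>F N in sequentially. 0 < N" by (rule eventually_gt_at_top)
  show ?thesis
    using e1 e2 e3 e4 e5 e6 e7 e8 T_rate
  proof eventually_elim
    case (elim N)
    have c2N: "c2 * nr N powr (1 / dl) \<le> real N" using elim(3,8) by (simp add: field_simps)
    have Tr: "c1 * nr N powr (1 / dl) \<le> real (T N)" "real (T N) \<le> c2 * nr N powr (1 / dl)"
      using elim(9) by (auto simp: dl_def nr_def)
    have lnp: "ln (real N) powr (2 * rt) * ln (real N) = ln (real N) powr (2 * rt + 1)"
      using elim(6) by (simp add: powr_add)
    have tq: "4 * real AA * VV N * ln (real N) / real N = 4 * real AA * C0 * (nr N powr ea * ln (real N) powr (2 * rt + 1) / real N)"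
      unfolding VV_def lnp[symmetric] by simp
    have "tt N \<le> sqrt 1" unfolding tt_def tq using elim(4) by (intro real_sqrt_le_mono) (rule less_imp_le)
    moreover have "1 \<le> T N" using elim(2) Tr(1) by linarith
    moreover have "T N \<le> N" using c2N Tr(2) by linarith
    ultimately show ?case using elim Tr by (simp add: regular_def)
  qed
qed

abbreviation D2 where
  "D2 N w x \<equiv> meanG N (T N) (trim_level rt N) w x - mG (T N) (trim_level rt N) x"

abbreviation D3 where
  "D3 N x \<equiv> mG (T N) (trim_level rt N) x - KR (T N) x"

abbreviation D4 where
  "D4 N x \<equiv> KR (T N) x + 1/2 - R x"

definition well_approximated :: "nat \<Rightarrow> 'a \<Rightarrow> bool" where
  "well_approximated N w \<longleftrightarrow>
    (\<forall>x\<in>sphere 0 1. \<bar>D2 N w x\<bar> \<le> 2 * tt N \<and> meanA N (T N) (trim_level rt N) w x \<le> B + 2)"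

section \<open>Estimates at one regular sample size\<close>

context
  fixes N :: nat
  assumes reg: "regular N"
begin

lemma regular_pos: "0 < N" "0 < real N" "1 \<le> ln (real N)" "0 < ln (real N)" "1 \<le> nr N" "0 < nr N" "0 < rho N"
proof -
  show N: "0 < N" and l: "1 \<le> ln (real N)" and n: "1 \<le> nr N" using reg unfolding regular_def by blast+
  show "0 < real N" using N by simp
  show "0 < ln (real N)" by (rule less_le_trans[OF zero_less_one l])
  show "0 < nr N" by (rule less_le_trans[OF zero_less_one n])
  then show "0 < rho N" by (simp add: rho_def)
qed

lemma trim_pos: "0 < trim_level rt N" and trim_inverse: "1 / trim_level rt N = ln (real N) powr rt"
  using regular_pos by (auto simp: trim_level_def powr_minus_divide)

text \<open>The balance of variance against squared bias: ea - 1 = -2 tau / dl, and trading N for nr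
  costs (log N)^(-kappa).\<close>

lemma powr_ea_over_N: "nr N powr ea / real N = (rho N)\<^sup>2 * ln (real N) powr (- kappa rt q)"
proof -
  have "1 / real N = ln (real N) powr (- kappa rt q) / nr N"
    using regular_pos by (simp add: nr_def base_rate_def powr_minus_divide)
  then have "nr N powr ea / real N = nr N powr ea / nr N * ln (real N) powr (- kappa rt q)"
    unfolding divide_inverse[of _ "real N"] by (simp add: inverse_eq_divide)
  also have "nr N powr ea / nr N = nr N powr (ea - 1)" using regular_pos by (simp add: powr_diff)
  also have "ea - 1 = (- \<tau> / dl) + (- \<tau> / dl)"
  proof -
    have eq: "ea = (dl - 2 * \<tau>) / dl" unfolding ea_def by (simp add: dl_def)
    show ?thesis unfolding eq using dl by (simp add: field_simps)
  qed
  also have "nr N powr \<dots> = (rho N)\<^sup>2" unfolding rho_def powr_add by (simp add: power2_eq_square)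
  finally show ?thesis .
qed

lemma VV_pos: "0 < VV N" and VV_ge_1: "1 \<le> VV N"
proof -
  have "1 \<le> C0 * nr N powr ea"
    by (rule mult_ge1_I[OF C0 ge_one_powr_ge_zero[OF regular_pos(5)]]) (use ea in simp)
  then show "1 \<le> VV N"
    unfolding VV_def by (rule mult_ge1_I[OF _ ge_one_powr_ge_zero[OF regular_pos(3)]]) (use rt in simp)
  then show "0 < VV N" by simp
qed

lemma VV_over_N: "VV N / real N = C0 * (rho N)\<^sup>2 * ln (real N) powr (2 * rt - kappa rt q)"
proof -
  have "VV N / real N = C0 * (nr N powr ea / real N) * ln (real N) powr (2 * rt)" by (simp add: VV_def)
  then show ?thesis unfolding powr_ea_over_N by (simp add: powr_diff powr_minus_divide)
qed

text \<open>The exponent of the logarithm is 0 for q = \<infinity>, 1/q for 2 < q < \<infinity> and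
  1/2 for q <= 2. So the sup norm alone reaches the rate only when q = \<infinity>.\<close>

lemma tt_eq: "tt N = sqrt (4 * real AA * C0) * rho N * ln (real N) powr ((2 * rt + 1 - kappa rt q) / 2)"
proof -
  have e: "2 * rt + 1 - kappa rt q = (2 * rt - kappa rt q) + 1" by simp
  have "4 * real AA * VV N * ln (real N) / real N = 4 * real AA * (VV N / real N) * ln (real N)" by simp
  also have "\<dots> = (4 * real AA * C0) * (rho N)\<^sup>2 * ln (real N) powr (2 * rt + 1 - kappa rt q)"
    unfolding VV_over_N e powr_add using regular_pos by simp
  also have "ln (real N) powr (2 * rt + 1 - kappa rt q) = (ln (real N) powr ((2 * rt + 1 - kappa rt q) / 2))\<^sup>2"
    unfolding power2_eq_square powr_add[symmetric] field_sum_of_halves ..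
  finally show ?thesis unfolding tt_def using regular_pos by (simp add: real_sqrt_mult)
qed

lemma tt_nonneg: "0 \<le> tt N"
  unfolding tt_def using VV_pos regular_pos by simp

text \<open>The square of \<open>tt\<close> is at least 1/N, so the error 1/N left by the net can be
  absorbed into \<open>tt\<close>.\<close>

lemma inverse_N_le_tt: "1 / real N \<le> tt N"
  unfolding tt_def
proof (rule real_le_rsqrt)
  have "1 \<le> 4 * real AA * VV N * ln (real N)"
    using VV_ge_1 regular_pos by (intro mult_ge1_I) (auto simp: AA_def)
  moreover have "(1 / real N)\<^sup>2 \<le> 1 / real N"
    using regular_pos by (simp add: power2_eq_square field_simps)
  moreover have "1 / real N \<le> 4 * real AA * VV N * ln (real N) / real N"
    if "1 \<le> 4 * real AA * VV N * ln (real N)" using that regular_pos by (intro divide_right_mono) auto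
  ultimately show "(1 / real N)\<^sup>2 \<le> 4 * real AA * VV N * ln (real N) / real N"
    by (blast intro: order_trans)
qed

lemma T_power_le: "real (T N) ^ (CARD('b) - 1) \<le> c2 ^ (CARD('b) - 1) * nr N powr ea"
proof -
  have "real (T N) ^ (CARD('b) - 1) \<le> (c2 * nr N powr (1 / dl)) ^ (CARD('b) - 1)"
    using reg by (intro power_mono) (auto simp: regular_def)
  also have "\<dots> = c2 ^ (CARD('b) - 1) * (nr N powr (1 / dl)) ^ (CARD('b) - 1)" by (rule power_mult_distrib)
  also have "(nr N powr (1 / dl)) ^ (CARD('b) - 1) = nr N powr (real (CARD('b) - 1) * (1 / dl))"
    using powr_realpow[of "nr N powr (1 / dl)" "CARD('b) - 1"] regular_pos by (simp add: powr_powr mult.commute)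
  also have "real (CARD('b) - 1) * (1 / dl) = ea" using dim by (simp add: ea_def)
  finally show ?thesis .
qed

lemma T_powr_le: "real (T N) powr (- \<tau>) \<le> c1 powr (- \<tau>) * rho N"
proof -
  have "real (T N) powr (- \<tau>) \<le> (c1 * nr N powr (1 / dl)) powr (- \<tau>)"
    using reg \<tau> c1 regular_pos by (intro powr_mono2') (auto simp: regular_def)
  also have "\<dots> = c1 powr (- \<tau>) * rho N"
    using c1 by (simp add: powr_mult powr_powr rho_def)
  finally show ?thesis .
qed

text \<open>The inverse trimming level gives (log N)^rt. It is enlarged to the power 2 rt that
  \<open>kappa\<close> contains, so that this part cancels in \<open>VV_over_N\<close>.\<close>

lemma VV_dominates: "(1 + B) * (C1 * real (T N) ^ (CARD('b) - 1) / trim_level rt N) \<le> VV N"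
proof -
  have "(1 + B) * (C1 * real (T N) ^ (CARD('b) - 1) / trim_level rt N)
      = (1 + B) * C1 * real (T N) ^ (CARD('b) - 1) * (1 / trim_level rt N)" by simp
  also have "\<dots> = (1 + B) * C1 * real (T N) ^ (CARD('b) - 1) * ln (real N) powr rt" by (simp only: trim_inverse)
  also have "\<dots> \<le> (1 + B) * C1 * (c2 ^ (CARD('b) - 1) * nr N powr ea) * ln (real N) powr (2 * rt)"
    using T_power_le rt regular_pos B_pos C1_nonneg c2 by (intro mult_mono powr_mono) auto
  also have "\<dots> \<le> VV N"
    unfolding VV_def C0_def by (simp add: algebra_simps)
  finally show ?thesis .
qed

text \<open>For regular N the constants, the inverse trimming level and T^a2 are at most N, N and
  N^a2. A net parameter of at least N^(a2 + 3) leaves 1/N, whence the 3 in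
  \<open>kk\<close>.\<close>

lemma discretization_le:
  "2 * (C2 * real (T N) powr a2 / trim_level rt N) * (real CARD('b) / real (N ^ kk)) \<le> tt N"
proof -
  have kk: "a2 + 3 \<le> real kk" using a2 by (simp add: kk_def)
  have "2 * (C2 * real (T N) powr a2 / trim_level rt N) * (real CARD('b) / real (N ^ kk))
      = (2 * C2 * real CARD('b)) * (real (T N) powr a2 * (1 / trim_level rt N) / real N ^ kk)" by simp
  also have "\<dots> \<le> real N * (real N powr a2 * real N / real N powr (a2 + 3))"
  proof (intro mult_mono frac_le)
    show "2 * C2 * real CARD('b) \<le> real N" "real (T N) powr a2 \<le> real N powr a2" "1 / trim_level rt N \<le> real N"
      using reg a2 by (auto simp: regular_def trim_inverse intro!: powr_mono2)
    have "real N powr (a2 + 3) \<le> real N powr real kk" using kk regular_pos by (intro powr_mono) auto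
    then show "real N powr (a2 + 3) \<le> real N ^ kk" using regular_pos by (simp add: powr_realpow)
  qed (use regular_pos trim_pos C2_nonneg in auto)
  also have "real N powr (a2 + 3) = real N powr a2 * (real N * (real N * real N))"
    using regular_pos by (simp add: powr_add power3_eq_cube)
  also have "real N * (real N powr a2 * real N / (real N powr a2 * (real N * (real N * real N)))) = 1 / real N"
    using regular_pos by (simp add: field_simps)
  also have "\<dots> \<le> tt N" by (rule inverse_N_le_tt)
  finally show ?thesis .
qed

text \<open>The exponential equals N^(-AA) and the net has at most (3 N^kk)^d points. With AA = kk d
  + 2 the product is of order N^(-2), which is summable.\<close>

lemma union_bound_le:
  "2 * (real ((2 * N ^ kk + 1) ^ CARD('b)) * (2 * exp (- (real N * (tt N)\<^sup>2 / (4 * VV N))))) \<le> 4 * 3 ^ CARD('b) / (real N)\<^sup>2"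
proof -
  have "(tt N)\<^sup>2 = 4 * real AA * VV N * ln (real N) / real N"
    unfolding tt_def using VV_pos regular_pos by simp
  then have "real N * (tt N)\<^sup>2 / (4 * VV N) = real AA * ln (real N)" using VV_pos regular_pos by simp
  then have ex: "exp (- (real N * (tt N)\<^sup>2 / (4 * VV N))) = 1 / real N ^ AA"
    using regular_pos by (simp add: exp_minus exp_of_nat_mult inverse_eq_divide)
  have "1 \<le> real N ^ kk" using regular_pos by (intro one_le_power) simp
  then have "(2 * real N ^ kk + 1) ^ CARD('b) \<le> (3 * real N ^ kk) ^ CARD('b)"
    by (intro power_mono) auto
  then have "real ((2 * N ^ kk + 1) ^ CARD('b)) \<le> (3 * real N ^ kk) ^ CARD('b)"
    by (simp only: of_nat_power of_nat_add of_nat_mult of_nat_numeral of_nat_1)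
  also have "\<dots> = 3 ^ CARD('b) * real N ^ (kk * CARD('b))" by (simp add: power_mult_distrib power_mult)
  finally have "2 * (real ((2 * N ^ kk + 1) ^ CARD('b)) * (2 * exp (- (real N * (tt N)\<^sup>2 / (4 * VV N)))))
      \<le> 2 * ((3 ^ CARD('b) * real N ^ (kk * CARD('b))) * (2 * (1 / real N ^ AA)))"
    unfolding ex using regular_pos by (intro mult_left_mono mult_right_mono) auto
  also have "\<dots> = 4 * 3 ^ CARD('b) / (real N)\<^sup>2"
    using regular_pos by (simp add: AA_def power_add power2_eq_square)
  finally show ?thesis .
qed

lemma sup_event:
  "\<exists>A\<in>events. prob A \<le> 4 * 3 ^ CARD('b) / (real N)\<^sup>2 \<and> (\<forall>w\<in>space P - A. well_approximated N w)"
proof -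
  let ?e = "tt N + 2 * (C2 * real (T N) powr a2 / trim_level rt N) * (real CARD('b) / real (N ^ kk))"
  have e: "?e \<le> 2 * tt N" using discretization_le by linarith
  have t1: "tt N \<le> 1" and T1: "1 \<le> T N" using reg by (auto simp: regular_def)
  have t2: "tt N \<le> 2" using t1 by simp
  have e2: "B + ?e \<le> B + 2" using e t1 by simp
  have Nk: "0 < N ^ kk" using regular_pos by simp
  obtain A where A: "A \<in> events"
    "prob A \<le> 2 * (real ((2 * N ^ kk + 1) ^ CARD('b)) * (2 * exp (- (real N * (tt N)\<^sup>2 / (4 * VV N)))))"
    "\<forall>w\<in>space P - A. \<forall>x\<in>sphere 0 1. \<bar>D2 N w x\<bar> \<le> ?e \<and>
       meanA N (T N) (trim_level rt N) w x \<le> B + ?e"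
    using deviation_event[OF trim_pos T1 VV_pos VV_dominates tt_nonneg t2 regular_pos(1) Nk] by blast
  show ?thesis
  proof (rule bexI[OF _ A(1)], unfold well_approximated_def, intro conjI ballI)
    show "prob A \<le> 4 * 3 ^ CARD('b) / (real N)\<^sup>2" by (rule order_trans[OF A(2) union_bound_le])
    fix w x assume "w \<in> space P - A" "x \<in> sphere (0::real^'b) 1"
    then have "\<bar>D2 N w x\<bar> \<le> ?e \<and> meanA N (T N) (trim_level rt N) w x \<le> B + ?e"
      using A(3) by blast
    then show "\<bar>D2 N w x\<bar> \<le> 2 * tt N"
      "meanA N (T N) (trim_level rt N) w x \<le> B + 2"
      by (blast intro: order_trans[OF _ e], blast intro: order_trans[OF _ e2])
  qed
qed

text \<open>The free factor K trades the constant in the bound against the probability of the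
  exceptional set.\<close>

lemma square_event:
  assumes "0 < K"
  shows "\<exists>A\<in>events. prob A \<le> measure S (sphere 0 1) / K \<and>
    (\<forall>w\<in>space P - A. (LINT x|S. (D2 N w x)\<^sup>2) \<le> K * (VV N / real N))"
proof -
  have c: "0 < K * (VV N / real N)" using assms VV_pos regular_pos by simp
  have "measure S (sphere 0 1) * (VV N / real N) / (K * (VV N / real N)) = measure S (sphere 0 1) / K"
    using VV_pos regular_pos by simp
  then show ?thesis using square_deviation_event[OF trim_pos VV_dominates regular_pos(1) c] by simp
qed

end

section \<open>The error terms as multiples of the target rate\<close>

lemma deviation_lq_infinity:
  assumes qi: "q = \<infinity>" and reg: "regular N"
    and wa: "well_approximated N w"
  shows "lq S q (D2 N w) (2 * sqrt (4 * real AA * C0) * rho N)"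
proof -
  have "kappa rt q = 2 * rt + 1" by (simp add: kappa_def qi)
  then have "tt N = sqrt (4 * real AA * C0) * rho N"
    using tt_eq[OF reg] regular_pos[OF reg] by simp
  then have eq: "2 * tt N = 2 * sqrt (4 * real AA * C0) * rho N" by simp
  have "0 \<le> 2 * tt N" using tt_nonneg[OF reg] by simp
  moreover have "AE x in S. \<bar>D2 N w x\<bar> \<le> 2 * tt N" using wa by (intro AE_I2) (simp add: well_approximated_def)
  ultimately have "lq S q (D2 N w) (2 * tt N)" unfolding lq_def using qi deviation_measurable by simp
  then show ?thesis unfolding eq .
qed

text \<open>For q > 2 the bound interpolates between the sup norm and the L2 norm; only the sup norm costs a
  factor log N, and this produces the summand 1 - 2/q of kappa.\<close>

lemma deviation_lq_finite:
  assumes qf: "q \<noteq> \<infinity>" and K: "0 < K"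
  obtains c where "0 \<le> c"
    "\<forall>N w. regular N \<longrightarrow> well_approximated N w \<longrightarrow>
      (LINT x|S. (D2 N w x)\<^sup>2) \<le> K * (VV N / real N) \<longrightarrow> lq S q (D2 N w) (c * rho N)"
proof (cases "q \<le> 2")
  case True
  have kap: "kappa rt q = 2 * rt"
  \<comment> \<open>At q = 2 the other branch of \<open>kappa\<close> applies, but its summand 1 -
    2/2 vanishes.\<close>
  proof (cases "q = 2")
    case True
    then show ?thesis by (simp add: kappa_def)
  next
    case False
    then show ?thesis using True qf by (auto simp: kappa_def)
  qed
  show ?thesis
  proof (rule that[of "1 + measure S (space S) + K * C0"])
    show "0 \<le> 1 + measure S (space S) + K * C0" using K C0 by simp
  next
    show "\<forall>N w. regular N \<longrightarrow> well_approximated N w \<longrightarrow>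
      (LINT x|S. (D2 N w x)\<^sup>2) \<le> K * (VV N / real N) \<longrightarrow> lq S q (D2 N w) ((1 + measure S (space S) + K * C0) * rho N)"
    proof (intro allI impI)
      fix N w assume reg: "regular N" and wa: "well_approximated N w"
        and sq: "(LINT x|S. (D2 N w x)\<^sup>2) \<le> K * (VV N / real N)"
      have "K * (VV N / real N) = K * C0 * (rho N)\<^sup>2"
        unfolding VV_over_N[OF reg] kap using regular_pos[OF reg] by simp
      with sq have sq': "(LINT x|S. (D2 N w x)\<^sup>2) \<le> K * C0 * (rho N)\<^sup>2" by (simp only:)
      have ae: "AE x in S. \<bar>D2 N w x\<bar> \<le> 2 * tt N" using wa by (intro AE_I2) (simp add: well_approximated_def)
      show "lq S q (D2 N w) ((1 + measure S (space S) + K * C0) * rho N)"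
        by (rule lq_of_square[OF S.finite_measure_axioms q True deviation_measurable ae sq' regular_pos(7)[OF reg]])
           (use K C0 in simp)
    qed
  qed
next
  case False
  define p where "p = real_of_ereal q"
  have p: "2 < p" using False qf by (cases q) (auto simp: p_def)
  have "2 \<le> q" using False by simp
  then have kap: "kappa rt q = 2 * rt + 1 - 2 / p" using qf by (simp add: kappa_def p_def)
  define s where "s = sqrt (4 * real AA * C0)"
  \<comment> \<open>The constants of the interpolated bound for the p-th power; the norm bound
    carries their p-th root.\<close>
  define E where "E = (2 * s) powr (p - 2) * (K * C0)"
  have s: "0 \<le> s" using C0 by (simp add: s_def)
  have E: "0 \<le> E" using K C0 by (simp add: E_def)
  show ?thesis
  proof (rule that[of "E powr (1 / p)"])
    show "0 \<le> E powr (1 / p)" by simp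
  next
    show "\<forall>N w. regular N \<longrightarrow> well_approximated N w \<longrightarrow>
      (LINT x|S. (D2 N w x)\<^sup>2) \<le> K * (VV N / real N) \<longrightarrow> lq S q (D2 N w) (E powr (1 / p) * rho N)"
    proof (intro allI impI)
      fix N w assume reg: "regular N" and wa: "well_approximated N w"
        and sq: "(LINT x|S. (D2 N w x)\<^sup>2) \<le> K * (VV N / real N)"
      let ?l = "ln (real N)"
      have l: "0 < ?l" and rho: "0 < rho N" using regular_pos[OF reg] by auto
      have ae: "AE x in S. \<bar>D2 N w x\<bar> \<le> 2 * tt N" using wa by (intro AE_I2) (simp add: well_approximated_def)
      have "2 * tt N = (2 * s) * rho N * ?l powr (1 / p)"
        unfolding tt_eq[OF reg] kap s_def by simp
      then have "(2 * tt N) powr (p - 2) = ((2 * s) * rho N * ?l powr (1 / p)) powr (p - 2)" by (simp only:)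
      also have "\<dots> = (2 * s) powr (p - 2) * rho N powr (p - 2) * ?l powr ((p - 2) / p)"
        using s rho by (simp add: powr_mult powr_powr)
      finally have t: "(2 * tt N) powr (p - 2) = (2 * s) powr (p - 2) * rho N powr (p - 2) * ?l powr ((p - 2) / p)" .
      have v: "K * (VV N / real N) = K * C0 * (rho N)\<^sup>2 * ?l powr (- ((p - 2) / p))"
      proof -
        have "2 * rt - kappa rt q = - ((p - 2) / p)" unfolding kap using p by (simp add: field_simps)
        then show ?thesis unfolding VV_over_N[OF reg] by simp
      qed
      have "(2 * tt N) powr (p - 2) * (K * (VV N / real N))
          = E * (rho N powr (p - 2) * (rho N)\<^sup>2) * (?l powr ((p - 2) / p) * ?l powr (- ((p - 2) / p)))"
        unfolding t v E_def by simp
      \<comment> \<open>The logarithm from the sup norm cancels the one gained in the L2 bound.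
        Solving this cancellation for \<open>kappa\<close> gives 2 rt + 1 - 2/p.\<close>
      also have "?l powr ((p - 2) / p) * ?l powr (- ((p - 2) / p)) = 1"
        using l by (simp add: powr_add[symmetric])
      also have "rho N powr (p - 2) * (rho N)\<^sup>2 = rho N powr p"
        using rho powr_add[of "rho N" "p - 2" 2] by simp
      also have "E * rho N powr p * 1 = (E powr (1 / p) * rho N) powr p"
        using E rho p by (simp add: powr_mult powr_powr)
      finally have fin: "(2 * tt N) powr (p - 2) * (K * (VV N / real N)) = (E powr (1 / p) * rho N) powr p" .
      show "lq S q (D2 N w) (E powr (1 / p) * rho N)"
      proof (rule lq_interpolate[OF S.finite_measure_axioms q qf deviation_measurable, where p = 2])
        show "(LINT x|S. \<bar>D2 N w x\<bar> powr 2) \<le> K * (VV N / real N)" using sq by simp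
        show "2 \<le> real_of_ereal q" using p by (simp add: p_def)
        show "(2 * tt N) powr (real_of_ereal q - 2) * (K * (VV N / real N)) \<le> (E powr (1 / p) * rho N) powr real_of_ereal q"
          using fin by (simp add: p_def)
      qed (use ae tt_nonneg[OF reg] rho in auto)
    qed
  qed
qed

text \<open>With T^(d-1) of order nr^ea and trimmed measure at most nr^(-e), the sup bound is nr^(ea
  - e) and the L1 bound nr^(-e), up to constants. The exponent e is the one for which their
  interpolation is exactly rho.\<close>

lemma trimming_lq:
  assumes small: "(\<lambda>N. measure S (low (trim_level rt N)))
      \<in> o(\<lambda>N. nr N powr (- (\<tau> + (real CARD('b) - 1) * (1 - qinv q)) / dl))"
  obtains c where "0 \<le> c"
    "\<forall>\<^sub>F N in sequentially. lq S q (D3 N) (c * rho N)"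
proof -
  let ?m = "\<lambda>N. measure S (low (trim_level rt N))"
  define e where "e = (\<tau> + (real CARD('b) - 1) * (1 - qinv q)) / dl"
  define k where "k = C1 * c2 ^ (CARD('b) - 1)"
  have k: "0 \<le> k" using C1_nonneg c2 by (simp add: k_def)
  have "\<forall>\<^sub>F N in sequentially. norm (?m N) \<le> 1 * norm (nr N powr (- e))"
    using landau_o.smallD[OF small, of 1] by (simp add: e_def minus_divide_left)
  then have small': "\<forall>\<^sub>F N in sequentially. ?m N \<le> nr N powr (- e)" by simp
  have Km: "C1 * real (T N) ^ (CARD('b) - 1) * ?m N \<le> k * nr N powr (ea - e)"
    if reg: "regular N" and m: "?m N \<le> nr N powr (- e)" for N
  proof -
    have "C1 * real (T N) ^ (CARD('b) - 1) * ?m N \<le> C1 * (c2 ^ (CARD('b) - 1) * nr N powr ea) * nr N powr (- e)"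
      using C1_nonneg c2 by (intro mult_mono T_power_le[OF reg] m) auto
    also have "\<dots> = k * (nr N powr ea * nr N powr (- e))" by (simp add: k_def)
    also have "nr N powr ea * nr N powr (- e) = nr N powr (ea - e)" by (simp add: powr_add[symmetric])
    finally show ?thesis .
  qed
  show ?thesis
  proof (cases "q = \<infinity>")
    case True
    have "ea - e = - \<tau> / dl" using dl by (simp add: ea_def e_def qinv_def True field_simps)
    then have er: "nr N powr (ea - e) = rho N" for N by (simp add: rho_def)
    show ?thesis
    proof (rule that[OF k])
      show "\<forall>\<^sub>F N in sequentially. lq S q (D3 N) (k * rho N)"
        using eventually_regular small'
      proof eventually_elim
        case (elim N)
        have inf: "C1 * real (T N) ^ (CARD('b) - 1) * ?m N \<le> k * rho N"
          using Km[OF elim] unfolding er .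
        have "0 \<le> k * rho N" using k by (simp add: rho_def)
        then show ?case
          using True by (intro trimming_bias_lq[OF q trim_pos[OF elim(1)] _ inf]) blast+
      qed
    qed
  next
    case False
    define p where "p = real_of_ereal q"
    have p: "1 \<le> p" using one_le_real_of_ereal[OF q False] by (simp add: p_def)
    define E where "E = k powr (p - 1) * B"
    have E: "0 \<le> E" using B_pos by (simp add: E_def)
    \<comment> \<open>Left: p - 1 powers of the sup bound and one of the L1 bound. Right: the p-th
      power of the target rate.\<close>
    have ep: "(ea - e) * (p - 1) - e = - \<tau> / dl * p"
    proof -
      have qp: "qinv q = 1 / p" using False by (simp add: qinv_def p_def)
      have "(ea - e) * (p - 1) - e = ea * (p - 1) - e * p" by (simp add: algebra_simps)
      also have "e * p = (\<tau> * p + (real CARD('b) - 1) * (p - 1)) / dl"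
      proof -
        have pp: "(1 - 1 / p) * p = p - 1" using p by (simp add: field_simps)
        show ?thesis unfolding e_def qp by (simp only: times_divide_eq_left distrib_right mult.assoc pp)
      qed
      also have "ea * (p - 1) - (\<tau> * p + (real CARD('b) - 1) * (p - 1)) / dl = - \<tau> / dl * p"
      proof -
        have "D / dl * (p - 1) - (\<tau> * p + D * (p - 1)) / dl = - \<tau> / dl * p" for D
          by (simp add: add_divide_distrib)
        then show ?thesis unfolding ea_def .
      qed
      finally show ?thesis .
    qed
    show ?thesis
    proof (rule that[of "E powr (1 / p)"])
      show "0 \<le> E powr (1 / p)" by simp
      show "\<forall>\<^sub>F N in sequentially. lq S q (D3 N) (E powr (1 / p) * rho N)"
        using eventually_regular small'
      proof eventually_elim
        case (elim N)
        let ?K = "C1 * real (T N) ^ (CARD('b) - 1) * ?m N"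
        have K0: "0 \<le> ?K" using C1_nonneg by simp
        have n: "0 < nr N" using regular_pos[OF elim(1)] by simp
        have "?K powr (p - 1) * (B * ?m N) \<le> (k * nr N powr (ea - e)) powr (p - 1) * (B * nr N powr (- e))"
          using p B_pos elim(2) by (intro mult_mono powr_mono2 Km[OF elim] K0) auto
        also have "\<dots> = E * (nr N powr ((ea - e) * (p - 1)) * nr N powr (- e))"
          using k by (simp add: powr_mult powr_powr E_def)
        also have "nr N powr ((ea - e) * (p - 1)) * nr N powr (- e) = nr N powr (- \<tau> / dl * p)"
          unfolding powr_add[symmetric] ep[symmetric] by simp
        also have "\<dots> = rho N powr p" by (simp add: rho_def powr_powr)
        also have "E * rho N powr p = (E powr (1 / p) * rho N) powr p"
          using E p by (simp add: powr_mult powr_powr rho_def)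
        finally have le: "?K powr (p - 1) * (B * ?m N) \<le> (E powr (1 / p) * rho N) powr p" .
        show ?case
          by (rule trimming_bias_lq[OF q trim_pos[OF elim(1)]])
             (use le False in \<open>auto simp: p_def rho_def\<close>)
      qed
    qed
  qed
qed

lemma smoothing_lq:
  assumes K3: "K3 ch q \<tau> TYPE('b)" and sob: "sobolev q \<tau> R"
  obtains c where "0 \<le> c" "\<And>N. regular N \<Longrightarrow> lq S q (D4 N) (c * rho N)"
proof -
  obtain C where C: "0 \<le> C" "\<And>T. 1 \<le> T \<Longrightarrow> lq S q (\<lambda>x. KR T x + 1/2 - R x) (C * real T powr (- \<tau>))"
    using smoothing_bias[OF q \<tau> K3 sob] by metis
  show ?thesis
  proof (rule that[of "C * c1 powr (- \<tau>)"])
    show "0 \<le> C * c1 powr (- \<tau>)" using C by simp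
    fix N assume reg: "regular N"
    have "C * real (T N) powr (- \<tau>) \<le> C * (c1 powr (- \<tau>) * rho N)"
      using C(1) T_powr_le[OF reg] by (rule mult_left_mono[rotated])
    then have "C * real (T N) powr (- \<tau>) \<le> C * c1 powr (- \<tau>) * rho N" by (simp only: mult.assoc)
    moreover have "1 \<le> T N" using reg by (simp add: regular_def)
    ultimately show "lq S q (D4 N) (C * c1 powr (- \<tau>) * rho N)"
      using lq_mono[OF q C(2)] by blast
  qed
qed

section \<open>The rates in probability and almost surely\<close>

context
  fixes fhat :: "nat \<Rightarrow> 'a \<Rightarrow> real^'b \<Rightarrow> real"
  assumes K3: "K3 ch q \<tau> TYPE('b)" and sob: "sobolev q \<tau> R"
    and small: "(\<lambda>N. measure S (low (trim_level rt N)))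
      \<in> o(\<lambda>N. nr N powr (- (\<tau> + (real CARD('b) - 1) * (1 - qinv q)) / dl))"
begin

abbreviation scaled_M where
  "scaled_M N w \<equiv> nr N powr (\<tau> / dl) * ln (real N) powr rt * Mtrim fX fhat yx rt N w"

abbreviation err where
  "err N w \<equiv> lpnorm S q (\<lambda>x. Rhat ch T rt fhat yx N w x - R x)"

lemma Mtrim_le:
  assumes reg: "regular N"
    and le: "scaled_M N w \<le> b"
  shows "Mtrim fX fhat yx rt N w \<le> b * rho N"
proof -
  let ?M = "Mtrim fX fhat yx rt N w"
  have M: "0 \<le> ?M" by (rule Mtrim_nonneg)
  have "1 \<le> ln (real N) powr rt" using regular_pos[OF reg] rt by (intro ge_one_powr_ge_zero) auto
  then have "nr N powr (\<tau> / dl) * 1 * ?M \<le> nr N powr (\<tau> / dl) * ln (real N) powr rt * ?M"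
    using M by (intro mult_right_mono mult_left_mono) auto
  then have "nr N powr (\<tau> / dl) * ?M \<le> b" using le by simp
  then have "rho N * (nr N powr (\<tau> / dl) * ?M) \<le> rho N * b"
    using regular_pos[OF reg] by (intro mult_left_mono) auto
  moreover have "rho N * nr N powr (\<tau> / dl) = 1"
    using regular_pos[OF reg] by (simp add: rho_def powr_add[symmetric])
  ultimately show ?thesis by (simp add: mult.assoc[symmetric] mult.commute)
qed

text \<open>A deterministic statement about one N. The constant c is uniform in the outcome, in the
  trimming bound b and in the deviation constant c2', so the same estimate serves both
  conclusions.\<close>

definition error_estimate :: "real \<Rightarrow> nat \<Rightarrow> bool" where
  "error_estimate c N \<longleftrightarrow> regular N \<and> (\<forall>w b c2'. good_data w \<longrightarrow> well_approximated N w \<longrightarrow>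
      lq S q (D2 N w) (c2' * rho N) \<longrightarrow>
      scaled_M N w \<le> b \<longrightarrow>
      err N w \<le> (c * (b + 1) + 64 * c2') * rho N)"

lemma error_eventually_le:
  obtains c where "0 \<le> c" "\<forall>\<^sub>F N in sequentially. error_estimate c N"
proof -
  obtain c3 where c3: "0 \<le> c3"
    "\<forall>\<^sub>F N in sequentially. lq S q (D3 N) (c3 * rho N)"
    by (rule trimming_lq[OF small])
  obtain c4 where c4: "0 \<le> c4" "\<And>N. regular N \<Longrightarrow> lq S q (D4 N) (c4 * rho N)"
    using smoothing_lq[OF K3 sob] by metis
  define k where "k = (B + 2) * (1 + measure S (space S))"
  have k: "0 \<le> k" using B_pos by (simp add: k_def)
  define c where "c = 64 * (k + c3 + c4)"
  show ?thesis
  proof (rule that[of c])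
    show "0 \<le> c" using k c3 c4 by (simp add: c_def)
    show "\<forall>\<^sub>F N in sequentially. error_estimate c N"
      using eventually_regular c3(2)
    proof eventually_elim
      case (elim N)
      note reg = elim(1)
      show ?case
        unfolding error_estimate_def
      proof (intro conjI allI impI reg)
        fix w b c2'
        assume good: "good_data w" and wa: "well_approximated N w"
          and D2: "lq S q (D2 N w) (c2' * rho N)"
          and M: "scaled_M N w \<le> b"
        have b: "0 \<le> b"
          by (rule order_trans[OF _ M]) (simp add: Mtrim_nonneg)
        have rho: "0 \<le> rho N" by (simp add: rho_def)
        have "err N w
            \<le> 64 * (b * rho N * (B + 2) * (1 + measure S (space S)) + c2' * rho N + c3 * rho N + c4 * rho N)"
          using wa unfolding well_approximated_def by (intro error_bound[where T = T, OF q good trim_pos[OF reg] regular_pos(1)[OF reg] Mtrim_le[OF reg M] _ D2 elim(2) c4(2)[OF reg]]) auto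
        also have "\<dots> = (64 * (b * k + c3 + c4) + 64 * c2') * rho N" by (simp add: k_def algebra_simps)
        also have "\<dots> \<le> (c * (b + 1) + 64 * c2') * rho N"
        proof (intro mult_right_mono add_right_mono rho)
          have "0 \<le> c3 * b" "0 \<le> c4 * b" using b c3 c4 by auto
          then show "64 * (b * k + c3 + c4) \<le> c * (b + 1)" using k unfolding c_def by (simp add: algebra_simps)
        qed
        finally show "err N w \<le> (c * (b + 1) + 64 * c2') * rho N" .
      qed
    qed
  qed
qed

text \<open>Choosing one exceptional set for each N yields a sequence to which Borel-Cantelli
  applies; the empty set at irregular N keeps all members measurable.\<close>

definition sup_exc :: "nat \<Rightarrow> 'a set" where
  "sup_exc N = (if regular N then (SOME A. A \<in> events \<and> prob A \<le> 4 * 3 ^ CARD('b) / (real N)\<^sup>2 \<and>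
     (\<forall>w\<in>space P - A. well_approximated N w)) else {})"

lemma sup_exc:
  assumes "regular N"
  shows "sup_exc N \<in> events" "prob (sup_exc N) \<le> 4 * 3 ^ CARD('b) / (real N)\<^sup>2"
    "\<And>w. w \<in> space P - sup_exc N \<Longrightarrow> well_approximated N w"
proof -
  have "sup_exc N \<in> events \<and> prob (sup_exc N) \<le> 4 * 3 ^ CARD('b) / (real N)\<^sup>2 \<and>
     (\<forall>w\<in>space P - sup_exc N. well_approximated N w)"
    unfolding sup_exc_def if_P[OF assms] by (rule someI_ex) (use sup_event[OF assms] in blast)
  then show "sup_exc N \<in> events" "prob (sup_exc N) \<le> 4 * 3 ^ CARD('b) / (real N)\<^sup>2"
    "\<And>w. w \<in> space P - sup_exc N \<Longrightarrow> well_approximated N w"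
    by blast+
qed

text \<open>Treats all q alike. For q = \<infinity> the supremum bound is enough and A is empty; for
  finite q the set A is where the L2 bound fails.\<close>

lemma deviation_lq_event:
  assumes \<epsilon>: "0 < \<epsilon>"
  obtains c where "0 \<le> c" "\<forall>N. regular N \<longrightarrow> (\<exists>A\<in>events. prob A < \<epsilon> \<and>
      (\<forall>w\<in>space P - (sup_exc N \<union> A). lq S q (D2 N w) (c * rho N)))"
proof (cases "q = \<infinity>")
  case True
  show ?thesis
  proof (rule that[of "2 * sqrt (4 * real AA * C0)"])
    show "0 \<le> 2 * sqrt (4 * real AA * C0)" using C0 by simp
  next
    show "\<forall>N. regular N \<longrightarrow> (\<exists>A\<in>events. prob A < \<epsilon> \<and>
        (\<forall>w\<in>space P - (sup_exc N \<union> A). lq S q (D2 N w) (2 * sqrt (4 * real AA * C0) * rho N)))"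
    proof (intro allI impI)
      fix N assume reg: "regular N"
      show "\<exists>A\<in>events. prob A < \<epsilon> \<and> (\<forall>w\<in>space P - (sup_exc N \<union> A). lq S q (D2 N w) (2 * sqrt (4 * real AA * C0) * rho N))"
      proof (rule bexI[of _ "{}"], intro conjI ballI)
        show "prob {} < \<epsilon>" using \<epsilon> by simp
        fix w assume w: "w \<in> space P - (sup_exc N \<union> {})"
        show "lq S q (D2 N w) (2 * sqrt (4 * real AA * C0) * rho N)"
          by (rule deviation_lq_infinity[OF True reg sup_exc(3)[OF reg]]) (use w in blast)
      qed simp
    qed
  qed
next
  case False
  \<comment> \<open>Makes sigma(S) / K smaller than epsilon; the 1 keeps K positive without knowing
    the total mass to be so.\<close>
  define K where "K = (measure S (sphere 0 1) + 1) / \<epsilon>"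
  have K: "0 < K" using \<epsilon> by (simp add: K_def add_nonneg_pos)
  have small_K: "measure S (sphere 0 1) / K < \<epsilon>"
  proof -
    have m: "0 < measure S (sphere 0 1) + 1" by (simp add: add_nonneg_pos)
    have "measure S (sphere 0 1) * \<epsilon> < \<epsilon> * (measure S (sphere 0 1) + 1)"
      using \<epsilon> by (simp add: algebra_simps)
    then show ?thesis unfolding K_def using m by (simp add: pos_divide_less_eq del: measure_nonneg)
  qed
  obtain c where c: "0 \<le> c"
    "\<forall>N w. regular N \<longrightarrow> well_approximated N w \<longrightarrow>
      (LINT x|S. (D2 N w x)\<^sup>2) \<le> K * (VV N / real N) \<longrightarrow> lq S q (D2 N w) (c * rho N)"
    by (rule deviation_lq_finite[OF False K])
  show ?thesis
  proof (rule that[OF c(1)], intro allI impI)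
    fix N assume reg: "regular N"
    obtain A where A: "A \<in> events" and A': "prob A \<le> measure S (sphere 0 1) / K \<and>
        (\<forall>w\<in>space P - A. (LINT x|S. (D2 N w x)\<^sup>2) \<le> K * (VV N / real N))"
      using square_event[OF reg K] by (rule bexE)
    show "\<exists>A\<in>events. prob A < \<epsilon> \<and> (\<forall>w\<in>space P - (sup_exc N \<union> A). lq S q (D2 N w) (c * rho N))"
    proof (rule bexI[OF _ A], intro conjI ballI)
      show "prob A < \<epsilon>" using conjunct1[OF A'] small_K by (rule le_less_trans)
      fix w assume w: "w \<in> space P - (sup_exc N \<union> A)"
      show "lq S q (D2 N w) (c * rho N)"
      proof (rule c(2)[rule_format, OF reg])
        show "well_approximated N w" by (rule sup_exc(3)[OF reg]) (use w in blast)
        show "(LINT x|S. (D2 N w x)\<^sup>2) \<le> K * (VV N / real N)"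
          by (rule bspec[OF conjunct2[OF A']]) (use w in blast)
      qed
    qed
  qed
qed

text \<open>Outside a measurable exceptional set the error estimate holds for every outcome. This
  set covers the event of a large error, so the error itself need not be measurable in the
  outcome.\<close>

lemma rate_in_probability:
  assumes Tb: "bounded_in_prob P (\<lambda>N w. scaled_M N w) (\<lambda>_. 1)"
  shows "bounded_in_prob P (\<lambda>N w. err N w) rho"
  unfolding bounded_in_prob_def
proof (intro allI impI)
  fix \<epsilon> :: real assume \<epsilon>: "0 < \<epsilon>"
  \<comment> \<open>One third each for the trimming condition, the L2 deviation and the supremum
    event; the null set of bad data costs nothing.\<close>
  then have e3: "0 < \<epsilon> / 3" by simp
  obtain b N1 where b: "\<And>N. N1 \<le> N \<Longrightarrow> \<exists>A\<in>events.
      {w\<in>space P. \<bar>scaled_M N w\<bar> > b * 1} \<subseteq> A \<and> measure P A < \<epsilon> / 3"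
    using Tb e3 unfolding bounded_in_prob_def by blast
  obtain c where c: "0 \<le> c" "\<forall>N. regular N \<longrightarrow> (\<exists>A\<in>events. prob A < \<epsilon> / 3 \<and>
      (\<forall>w\<in>space P - (sup_exc N \<union> A). lq S q (D2 N w) (c * rho N)))"
    by (rule deviation_lq_event[OF e3])
  obtain c' where c': "0 \<le> c'"
    "\<forall>\<^sub>F N in sequentially. error_estimate c' N"
    by (rule error_eventually_le)
  have "(\<lambda>N. 1 / (real N)\<^sup>2) \<longlonglongrightarrow> 0" by real_asymp
  then have "(\<lambda>N. 4 * 3 ^ CARD('b) * (1 / (real N)\<^sup>2)) \<longlonglongrightarrow> 0" by (rule tendsto_mult_right_zero)
  then have "(\<lambda>N. 4 * 3 ^ CARD('b) / (real N)\<^sup>2) \<longlonglongrightarrow> 0" by simp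
  then have small_exc: "\<forall>\<^sub>F N in sequentially. 4 * 3 ^ CARD('b) / (real N)\<^sup>2 < \<epsilon> / 3"
    by (rule order_tendstoD) (use e3 in simp)
  obtain Nul where Nul: "{w \<in> space P. \<not> good_data w} \<subseteq> Nul"
    "emeasure P Nul = 0" "Nul \<in> events"
    using AE_good_data by (rule AE_E)
  have pN: "prob Nul = 0" using Nul(2) by (simp add: measure_def)
  let ?C = "c' * (b + 1) + 64 * c"
  have ev: "\<forall>\<^sub>F N in sequentially. \<exists>A\<in>events.
      {w\<in>space P. \<bar>err N w\<bar> > ?C * rho N} \<subseteq> A \<and> prob A < \<epsilon>"
    using c'(2) small_exc eventually_ge_at_top[of N1]
  proof eventually_elim
    case (elim N)
    have reg: "regular N" using elim(1) by (simp add: error_estimate_def)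
    obtain A1 where A1: "A1 \<in> events" "prob A1 < \<epsilon> / 3"
      "{w\<in>space P. \<bar>scaled_M N w\<bar> > b * 1} \<subseteq> A1"
      using b[OF elim(3)] by blast
    obtain A2 where A2: "A2 \<in> events" "prob A2 < \<epsilon> / 3"
      "\<And>w. w \<in> space P - (sup_exc N \<union> A2) \<Longrightarrow> lq S q (D2 N w) (c * rho N)"
      using c(2) reg by blast
    let ?A = "(sup_exc N \<union> Nul) \<union> (A1 \<union> A2)"
    note [measurable] = A1(1) A2(1) Nul(3) sup_exc(1)[OF reg]
    show ?case
    proof (rule bexI[of _ ?A], intro conjI)
      have "prob ?A \<le> prob (sup_exc N \<union> Nul) + prob (A1 \<union> A2)" by (rule measure_Un_le) measurable
      also have "\<dots> \<le> (prob (sup_exc N) + prob Nul) + (prob A1 + prob A2)"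
        by (intro add_mono measure_Un_le) measurable
      also have "\<dots> < \<epsilon>" using sup_exc(2)[OF reg] elim(2) A1(2) A2(2) pN by linarith
      finally show "prob ?A < \<epsilon>" .
      show "{w\<in>space P. \<bar>err N w\<bar> > ?C * rho N} \<subseteq> ?A"
      proof (rule subsetI, rule ccontr)
        fix w assume w: "w \<in> {w\<in>space P. \<bar>err N w\<bar> > ?C * rho N}"
          and nA: "w \<notin> ?A"
        have ws: "w \<in> space P" using w by blast
        have good: "good_data w"
          using Nul(1) nA ws by blast
        have "\<not> \<bar>scaled_M N w\<bar> > b * 1"
          using A1(3) nA ws by blast
        then have M: "scaled_M N w \<le> b" by linarith
        have lqD: "lq S q (D2 N w) (c * rho N)" by (rule A2(3)) (use nA ws in blast)
        have "w \<in> space P - sup_exc N" using nA ws by blast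
        then have wa: "well_approximated N w" by (rule sup_exc(3)[OF reg])
        have "err N w \<le> ?C * rho N"
          by (rule elim(1)[unfolded error_estimate_def, THEN conjunct2, rule_format, OF good wa lqD M])
        moreover have "\<bar>err N w\<bar> = err N w"
          by (rule abs_of_nonneg[OF lpnorm_nonneg])
        ultimately show False using w by simp
      qed
    qed measurable
  qed
  then obtain N0 where "\<forall>N\<ge>N0. \<exists>A\<in>events.
      {w\<in>space P. \<bar>err N w\<bar> > ?C * rho N} \<subseteq> A \<and> prob A < \<epsilon>"
    unfolding eventually_sequentially by blast
  then show "\<exists>b N0. \<forall>N\<ge>N0. \<exists>A\<in>events.
      {w\<in>space P. \<bar>err N w\<bar> > b * rho N} \<subseteq> A \<and> prob A < \<epsilon>"
    by (intro exI[of _ ?C] exI[of _ N0])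
qed

text \<open>For q = \<infinity> the deviation bound follows from \<open>well_approximated\<close>
  alone, whose exceptional sets have summable probabilities. So almost every outcome lies outside
  all but finitely many of them.\<close>

lemma rate_almost_surely:
  assumes qi: "q = \<infinity>"
    and Tc: "\<exists>C. AE w in P. limsup (\<lambda>N. ereal (scaled_M N w)) \<le> ereal C"
  shows "\<exists>C. AE w in P. limsup (\<lambda>N. ereal (nr N powr (\<tau> / dl) * lpnorm S \<infinity> (\<lambda>x. Rhat ch T rt fhat yx N w x - R x))) \<le> ereal C"
proof -
  obtain C where C: "AE w in P. limsup (\<lambda>N. ereal (scaled_M N w)) \<le> ereal C"
    using Tc by blast
  define k where "k = 2 * sqrt (4 * real AA * C0)"
  obtain c' where c': "0 \<le> c'"
    "\<forall>\<^sub>F N in sequentially. error_estimate c' N"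
    by (rule error_eventually_le)
  have exc: "AE w in P. \<forall>\<^sub>F N in sequentially. w \<in> space P - sup_exc N"
  proof (rule borel_cantelli_AE1)
    show "sup_exc N \<in> events" for N
      by (cases "regular N") (auto intro: sup_exc(1), simp add: sup_exc_def)
    show "emeasure P (sup_exc N) < \<infinity>" for N by (simp add: emeasure_eq_measure)
    have "summable (\<lambda>N. 4 * 3 ^ CARD('b) * (1 / (real N)\<^sup>2))"
      using inverse_power_summable[of 2, where 'a = real] by (intro summable_mult) (simp add: inverse_eq_divide power_one_over)
    then show "summable (\<lambda>N. prob (sup_exc N))"
    proof (rule summable_comparison_test_ev[rotated])
      show "\<forall>\<^sub>F N in sequentially. norm (prob (sup_exc N)) \<le> 4 * 3 ^ CARD('b) * (1 / (real N)\<^sup>2)"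
        using eventually_regular by eventually_elim (use sup_exc(2) in simp)
    qed
  qed
  \<comment> \<open>C + 1 bounds the scaled trimming error eventually, as its limsup is at most C;
    the second 1 is the one in \<open>error_estimate\<close>.\<close>
  let ?K = "c' * (C + 1 + 1) + 64 * k"
  have "AE w in P. limsup (\<lambda>N. ereal (nr N powr (\<tau> / dl) * lpnorm S \<infinity> (\<lambda>x. Rhat ch T rt fhat yx N w x - R x))) \<le> ereal ?K"
    using C exc AE_good_data
  proof eventually_elim
    case (elim w)
    note good = elim(3)
    have "limsup (\<lambda>N. ereal (scaled_M N w)) < ereal (C + 1)"
      using elim(1) by (rule le_less_trans) simp
    then have "\<forall>\<^sub>F N in sequentially. ereal (scaled_M N w) < ereal (C + 1)"
      by (rule Limsup_lessD)
    then have M: "\<forall>\<^sub>F N in sequentially. scaled_M N w \<le> C + 1"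
      by eventually_elim simp
    have "\<forall>\<^sub>F N in sequentially. ereal (nr N powr (\<tau> / dl) * lpnorm S \<infinity> (\<lambda>x. Rhat ch T rt fhat yx N w x - R x)) \<le> ereal ?K"
      using M elim(2) c'(2)
    proof eventually_elim
      case (elim N)
      have reg: "regular N" using elim(3) by (simp add: error_estimate_def)
      have wa: "well_approximated N w" by (rule sup_exc(3)[OF reg elim(2)])
      have lqD: "lq S q (D2 N w) (k * rho N)"
        unfolding k_def by (rule deviation_lq_infinity[OF qi reg wa])
      have "err N w \<le> ?K * rho N"
        by (rule elim(3)[unfolded error_estimate_def, THEN conjunct2, rule_format, OF good wa lqD elim(1)])
      then have "nr N powr (\<tau> / dl) * lpnorm S \<infinity> (\<lambda>x. Rhat ch T rt fhat yx N w x - R x) \<le> nr N powr (\<tau> / dl) * (?K * rho N)"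
        unfolding qi by (rule mult_left_mono) simp
      also have "\<dots> = ?K * (nr N powr (\<tau> / dl) * rho N)" by simp
      also have "nr N powr (\<tau> / dl) * rho N = 1"
        using regular_pos[OF reg] by (simp add: rho_def powr_add[symmetric])
      finally show ?case by simp
    qed
    then show ?case by (rule Limsup_bounded)
  qed
  then show ?thesis by blast
qed

end

end

text \<open>The conditions (T-b) and (T-c) are premises of the two conjuncts, because each
  conclusion comes with its own trimming condition while sharing the remaining hypotheses.\<close>

theorem theorem4p2:
  fixes P :: "'w measure"
    and \<beta> X :: "'w \<Rightarrow> real^'d"
    and f\<beta> fX r :: "real^'d \<Rightarrow> real"
    and e1 :: 'd
    and yx :: "nat \<Rightarrow> 'w \<Rightarrow> real \<times> (real^'d)"
    and fhat :: "nat \<Rightarrow> 'w \<Rightarrow> real^'d \<Rightarrow> real"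
    and ch :: "nat \<Rightarrow> nat \<Rightarrow> real"
    and T :: "nat \<Rightarrow> nat"
    and rt \<tau> :: real
    and q :: ereal
  assumes dim: "CARD('d) \<ge> 2"
    and prob: "prob_space P"
    (* model (M) *)
    and beta_dens: "distributed P sphere_measure \<beta> (\<lambda>x. ennreal (f\<beta> x))"
    and fbeta_nonneg: "\<forall>x\<in>sphere 0 1. 0 \<le> f\<beta> x"
    and X_dens: "distributed P sphere_measure X (\<lambda>x. ennreal (fX x))"
    and fX_nonneg: "\<forall>x\<in>sphere 0 1. 0 \<le> fX x"
    and fX_pos: "AE x in sphere_measure. 0 \<le> x $ e1 \<longrightarrow> 0 < fX x"
    and fX_zero: "\<forall>x\<in>sphere 0 1. x $ e1 < 0 \<longrightarrow> fX x = 0"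
    and indep: "prob_space.indep_var P sphere_measure \<beta> sphere_measure X"
    (* r is a version of P(Y = 1 | X = x), Y = 1{X'beta >= 0} *)
    and r_meas: "r \<in> borel_measurable borel"
    and r_int: "integrable P (\<lambda>\<omega>. r (X \<omega>))"
    and r_cond: "\<forall>A\<in>sets borel. measure P {\<omega>\<in>space P. 0 \<le> X \<omega> \<bullet> \<beta> \<omega> \<and> X \<omega> \<in> A}
                   = (\<integral>\<omega>. r (X \<omega>) * indicator A (X \<omega>) \<partial>P)"
    (* data: i.i.d. copies of (Y, X) *)
    and data_indep: "prob_space.indep_vars P (\<lambda>_. borel) yx UNIV"
    and data_distr: "\<forall>i. distr P borel (yx i)
                   = distr P borel (\<lambda>\<omega>. (if 0 \<le> X \<omega> \<bullet> \<beta> \<omega> then 1 else 0, X \<omega>))"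
    (* fhat: estimator computed from the first N data *)
    and fhat_data: "\<forall>N \<omega> \<omega>'. (\<forall>i<N. yx i \<omega> = yx i \<omega>') \<longrightarrow> fhat N \<omega> = fhat N \<omega>'"
    and fhat_meas: "\<forall>N. (\<lambda>(\<omega>, x). fhat N \<omega> x) \<in> borel_measurable (P \<Otimes>\<^sub>M borel)"
    and rt_pos: "0 < rt"
    and q_ge: "1 \<le> q"
    and tau_pos: "0 < \<tau>"
    (* kernel conditions *)
    and K1: "K1 ch TYPE('d)"
    and K2: "K2 ch TYPE('d)"
    and K3: "K3 ch q \<tau> TYPE('d)"
    and K4: "K4 ch"
    (* (T-a) *)
    and Ta_sup: "\<exists>B. \<forall>x\<in>sphere 0 1. 0 \<le> x $ e1 \<longrightarrow> fX x \<le> B"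
    and Ta_small: "(\<lambda>N. measure sphere_measure {x \<in> sphere 0 1. 0 < fX x \<and> fX x < trim_level rt N})
        \<in> o(\<lambda>N. base_rate (kappa rt q) N
               powr (- (\<tau> + (real CARD('d) - 1) * (1 - qinv q)) / (2 * \<tau> + real CARD('d) - 1)))"
    (* smoothness of R *)
    and R_sob: "sobolev q \<tau> (Rfun e1 r)"
    (* T_N asymptotically proportional to the rate *)
    and T_rate: "\<exists>c1 c2. 0 < c1 \<and> 0 < c2 \<and> (\<forall>\<^sub>F N in sequentially.
        c1 * base_rate (kappa rt q) N powr (1 / (2 * \<tau> + real CARD('d) - 1)) \<le> real (T N) \<and>
        real (T N) \<le> c2 * base_rate (kappa rt q) N powr (1 / (2 * \<tau> + real CARD('d) - 1)))"
  shows "(bounded_in_prob P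
            (\<lambda>N \<omega>. base_rate (kappa rt q) N powr (\<tau> / (2 * \<tau> + real CARD('d) - 1))
                     * ln (real N) powr rt * Mtrim fX fhat yx rt N \<omega>) (\<lambda>_. 1)
          \<longrightarrow> bounded_in_prob P
            (\<lambda>N \<omega>. lpnorm sphere_measure q (\<lambda>x. Rhat ch T rt fhat yx N \<omega> x - Rfun e1 r x))
            (\<lambda>N. base_rate (kappa rt q) N powr (- \<tau> / (2 * \<tau> + real CARD('d) - 1))))
       \<and> (q = \<infinity> \<longrightarrow>
          (\<exists>C. AE \<omega> in P. limsup (\<lambda>N. ereal (base_rate (2 * rt + 1) N powr (\<tau> / (2 * \<tau> + real CARD('d) - 1))
                     * ln (real N) powr rt * Mtrim fX fhat yx rt N \<omega>)) \<le> ereal C)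
          \<longrightarrow> (\<exists>C. AE \<omega> in P. limsup (\<lambda>N. ereal (base_rate (2 * rt + 1) N powr (\<tau> / (2 * \<tau> + real CARD('d) - 1))
                     * lpnorm sphere_measure \<infinity> (\<lambda>x. Rhat ch T rt fhat yx N \<omega> x - Rfun e1 r x))) \<le> ereal C))"
proof -
  interpret prob_space P by (rule prob)
  obtain B where B: "0 < B" "\<And>T x. x \<in> sphere (0::real^'d) 1 \<Longrightarrow> (LINT y|sphere_measure. \<bar>codd ch T x y\<bar>) \<le> B"
    using codd_L1_bound[OF dim K1] by metis
  obtain C2 a2 where C2: "0 \<le> C2" "0 \<le> a2"
    "\<And>T x y z. 1 \<le> T \<Longrightarrow> x \<in> sphere (0::real^'d) 1 \<Longrightarrow> y \<in> sphere 0 1 \<Longrightarrow> z \<in> sphere 0 1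
       \<Longrightarrow> \<bar>codd ch T z x - codd ch T z y\<bar> \<le> C2 * norm (x - y) * real T powr a2"
    using codd_Lipschitz[OF K2] by metis
  obtain c1 c2 where c: "0 < c1" "0 < c2" "\<forall>\<^sub>F N in sequentially.
        c1 * base_rate (kappa rt q) N powr (1 / (2 * \<tau> + real CARD('d) - 1)) \<le> real (T N) \<and>
        real (T N) \<le> c2 * base_rate (kappa rt q) N powr (1 / (2 * \<tau> + real CARD('d) - 1))"
    using T_rate by blast
  have X_meas: "X \<in> measurable P sphere_measure" using X_dens by (simp add: distributed_def)
  have beta_meas: "\<beta> \<in> measurable P sphere_measure" using beta_dens by (simp add: distributed_def)
  \<comment> \<open>The sup-norm constant comes from \<open>abs_codd_le\<close>; the other constants
    are those obtained above from \<open>K1\<close>, \<open>K2\<close> and the rate of T.\<close>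
  interpret rate_setup P X \<beta> fX r e1 yx ch "2 ^ (CARD('d) - 1) / \<bar>sphere_area CARD('d)\<bar>" B C2 a2 q \<tau> rt T c1 c2
  proof unfold_locales
    show "2 \<le> CARD('d)" by (rule dim)
    show "\<beta> \<in> measurable P sphere_measure" by (rule beta_meas)
    show "distributed P sphere_measure X (\<lambda>x. ennreal (fX x))" by (rule X_dens)
    show "0 \<le> fX x" if "x \<in> sphere 0 1" for x using fX_nonneg that by blast
    show "AE x in sphere_measure. 0 \<le> x $ e1 \<longrightarrow> 0 < fX x" by (rule fX_pos)
    show "fX x = 0" if "x \<in> sphere 0 1" "x $ e1 < 0" for x using fX_zero that by blast
    show "r \<in> borel_measurable borel" by (rule r_meas)
    show "integrable P (\<lambda>\<omega>. r (X \<omega>))" by (rule r_int)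
    show "measure P {\<omega>\<in>space P. 0 \<le> X \<omega> \<bullet> \<beta> \<omega> \<and> X \<omega> \<in> A} = (\<integral>\<omega>. r (X \<omega>) * indicator A (X \<omega>) \<partial>P)"
      if "A \<in> sets borel" for A using r_cond that by blast
    show "indep_vars (\<lambda>_. borel) yx UNIV" by (rule data_indep)
    show "distr P borel (yx i) = distr P borel (\<lambda>\<omega>. (if 0 \<le> X \<omega> \<bullet> \<beta> \<omega> then 1 else 0, X \<omega>))" for i
      using data_distr by blast
    show "\<bar>codd ch T x y\<bar> \<le> 2 ^ (CARD('d) - 1) / \<bar>sphere_area CARD('d)\<bar> * real T ^ (CARD('d) - 1)"
      for T and x y :: "real^'d" by (rule abs_codd_le[OF dim K4])
    show "(LINT y|sphere_measure. \<bar>codd ch T x y\<bar>) \<le> B" if "x \<in> sphere (0::real^'d) 1" for T x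
      by (rule B(2)[OF that])
    show "\<bar>codd ch T z x - codd ch T z y\<bar> \<le> C2 * norm (x - y) * real T powr a2"
      if "1 \<le> T" "x \<in> sphere (0::real^'d) 1" "y \<in> sphere 0 1" "z \<in> sphere 0 1" for T x y z
      by (rule C2(3)[OF that])
  qed (use B(1) C2(1,2) c rt_pos q_ge tau_pos in auto)
  have small: "(\<lambda>N. measure sphere_measure (low (trim_level rt N)))
      \<in> o(\<lambda>N. nr N powr (- (\<tau> + (real CARD('d) - 1) * (1 - qinv q)) / dl))"
    unfolding low_def nr_def dl_def by (rule Ta_small)
  show ?thesis
  proof (intro conjI impI, goal_cases)
    case 1
    then show ?case
      using rate_in_probability[OF K3 R_sob small, of fhat] unfolding nr_def rho_def[abs_def] dl_def
      by (rule rev_mp[OF _ impI])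
  next
    case 2
    \<comment> \<open>For q = \<infinity> this identifies \<open>nr\<close> with the base rate of
      the almost sure statement.\<close>
    have kap: "kappa rt q = 2 * rt + 1" by (simp add: kappa_def 2(1))
    show ?case
      using rate_almost_surely[OF K3 R_sob small 2(1), of fhat] 2(2) unfolding nr_def dl_def kap by blast
  qed
qed

end
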